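(* For each (nonempty) connected open basic primary semialgebraic set $\mathfrak{A}$, there exist a graph $\Gamma$ and a stratum $R$ in the realization space of $\Gamma$ such that $R$ is stably equivalent to $\mathfrak{A}$. Here a stratum is a connected component of a class of strong equivalence.
   Context: **Setting.** $\Gamma=(V,E)$ is a finite graph without loops and multiple edges, $V=\{v_1,\dots,v_m\}$. Here a realization is an arbitrary map $p:V\to\mathbb{R}^2$, $p_i:=p(v_i)$ (an edge may be degenerate, i.e. $p_i=p_j$ with $(ij)\in E$ is allowed). The realization space of $\Gamma$ is the space of all such maps modulo the action of the affine group $\mathrm{Aff}(\mathbb{R}^2)$. **Stresses.** An equilibrium stress on $(\Gamma,p)$ is an assignment of real numbers $s(i,j)=s(j,i)$ to the edges such that $\sum_{j:(ij)\in E}s(i,j)(p_i-p_j)=0$ at every vertex $v_i$. The equilibrium stresses form a linear space $S(\Gamma,p)\subset\mathbb{R}^{E}$, which is invariant under invertible affine transformations of $p$. **Strata.** Two realizations $(\Gamma,p)$ and $(\Gamma,p')$ are strongly equivalent if there is a homeomorphism $h:S(\Gamma,p)\to S(\Gamma,p')$ that preserves signs, i.e. for every $s$ and every edge $(ij)$ the numbers $s(i,j)$ and $h(s)(i,j)$ have the same sign in $\{+,-,0\}$. Strata are the connected components of the classes of strong equivalence in the realization space. A stratum is regarded as a semialgebraic set by the usual normalization of the affine quotient: fixing the images of three vertices that are affinely independent in all realizations under consideration. **Semialgebraic sets.** A semialgebraic set in $\mathbb{R}^N$ is a set defined by polynomial equations and inequalities. It is open basic primary if it is the set of common solutions of finitely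 many strict polynomial inequalities, with no equations, where all polynomials have rational coefficients. **Stable equivalence.** This is the equivalence relation on semialgebraic sets generated by: - rational equivalence: $X\subset\mathbb{R}^a$ and $Y\subset\mathbb{R}^b$ are rationally equivalent if there is a homeomorphism $f:X\to Y$ such that $f$ and $f^{-1}$ are given by rational functions with rational coefficients; - stable projections: $X\subset\mathbb{R}^a$ is a stable projection of $Y\subset\mathbb{R}^{a+d}$ if the coordinate projection $\mathbb{R}^{a+d}\to\mathbb{R}^a$ maps $Y$ onto $X$ and $Y=\{(x,y): x\in X,\ \varphi_k^x(y)>0\ (k\in K),\ \psi_l^x(y)=0\ (l\in L)\}$, where $K,L$ are finite (possibly empty) and $\varphi_k^x,\psi_l^x$ are affine functions of $y\in\mathbb{R}^d$ whose coefficients are polynomials in $x$ with rational coefficients. *)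

theory Defs
  imports "HOL-Analysis.Analysis" "HOL-Library.Poly_Mapping"
begin

text \<open>
  Points of \<open>\<real>\<^sup>n\<close> are the elements of \<^term>\<open>topspace (Euclidean_space n)\<close>, i.e. functions
  \<open>nat \<Rightarrow> real\<close> that vanish at all indices \<open>\<ge> n\<close>. The topology of \<^term>\<open>Euclidean_space n\<close> is the
  subspace topology of the type class topology (product topology) on \<open>nat \<Rightarrow> real\<close>, so that
  \<^term>\<open>connected\<close> and \<^term>\<open>homeomorphism\<close> have their usual meaning on subsets of \<open>\<real>\<^sup>n\<close>.
\<close>

abbreviation Rn :: "nat \<Rightarrow> (nat \<Rightarrow> real) set" where
  "Rn n \<equiv> topspace (Euclidean_space n)"

text \<open>A polynomial maps each monomial (an exponent vector) to its coefficient.\<close>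

type_synonym rpoly = "(nat \<Rightarrow>\<^sub>0 nat) \<Rightarrow>\<^sub>0 real"

definition eval_poly :: "rpoly \<Rightarrow> (nat \<Rightarrow> real) \<Rightarrow> real" where
  "eval_poly p x = (\<Sum>u\<in>Poly_Mapping.keys p. Poly_Mapping.lookup p u *
                      (\<Prod>i\<in>Poly_Mapping.keys u. x i ^ Poly_Mapping.lookup u i))"

definition polys :: "real set \<Rightarrow> nat \<Rightarrow> rpoly set" where
  "polys K n = {p. \<forall>u\<in>Poly_Mapping.keys p.
                     Poly_Mapping.lookup p u \<in> K \<and> Poly_Mapping.keys u \<subseteq> {..<n}}"

definition semialgebraic :: "nat \<Rightarrow> (nat \<Rightarrow> real) set \<Rightarrow> bool" where
  "semialgebraic n X \<longleftrightarrow>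
     (\<exists>F. finite F \<and>
          (\<forall>(P, Q)\<in>F. finite P \<and> finite Q \<and> P \<subseteq> polys UNIV n \<and> Q \<subseteq> polys UNIV n) \<and>
          X = (\<Union>(P, Q)\<in>F. {x \<in> Rn n. (\<forall>p\<in>P. eval_poly p x = 0) \<and> (\<forall>q\<in>Q. eval_poly q x > 0)}))"

definition open_basic_primary :: "nat \<Rightarrow> (nat \<Rightarrow> real) set \<Rightarrow> bool" where
  "open_basic_primary n X \<longleftrightarrow>
     (\<exists>Q. finite Q \<and> Q \<subseteq> polys \<rat> n \<and> X = {x \<in> Rn n. \<forall>q\<in>Q. eval_poly q x > 0})"

definition rational_map_on ::
  "nat \<Rightarrow> (nat \<Rightarrow> real) set \<Rightarrow> nat \<Rightarrow> ((nat \<Rightarrow> real) \<Rightarrow> (nat \<Rightarrow> real)) \<Rightarrow> bool" where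
  "rational_map_on a X b f \<longleftrightarrow>
     (\<forall>i<b. \<exists>p\<in>polys \<rat> a. \<exists>q\<in>polys \<rat> a.
        \<forall>x\<in>X. eval_poly q x \<noteq> 0 \<and> f x i = eval_poly p x / eval_poly q x)"

definition rationally_equivalent ::
  "nat \<times> (nat \<Rightarrow> real) set \<Rightarrow> nat \<times> (nat \<Rightarrow> real) set \<Rightarrow> bool" where
  "rationally_equivalent = (\<lambda>(a, X) (b, Y).
     \<exists>f g. homeomorphism X Y f g \<and> rational_map_on a X b f \<and> rational_map_on b Y a g)"

definition proj :: "nat \<Rightarrow> (nat \<Rightarrow> real) \<Rightarrow> (nat \<Rightarrow> real)" where
  "proj a z = (\<lambda>i. if i < a then z i else 0)"

text \<open>
  The family \<open>c\<close> encodes an affine function of the last \<open>d\<close> coordinates of \<open>z \<in> \<real>\<^sup>a\<^sup>+\<^sup>d\<close> whose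
  coefficients are polynomials in the first \<open>a\<close> coordinates: \<open>c 0\<close> is the constant term and
  \<open>c (Suc j)\<close> is the coefficient of the coordinate \<open>z (a + j)\<close>.
\<close>

definition affine_val :: "nat \<Rightarrow> nat \<Rightarrow> (nat \<Rightarrow> rpoly) \<Rightarrow> (nat \<Rightarrow> real) \<Rightarrow> real" where
  "affine_val a d c z =
     eval_poly (c 0) (proj a z) + (\<Sum>j<d. eval_poly (c (Suc j)) (proj a z) * z (a + j))"

definition stable_projection ::
  "nat \<times> (nat \<Rightarrow> real) set \<Rightarrow> nat \<times> (nat \<Rightarrow> real) set \<Rightarrow> bool" where
  "stable_projection = (\<lambda>(a, X) (b, Y).
     \<exists>d. b = a + d \<and> proj a ` Y = X \<and>
       (\<exists>K L. finite K \<and> finite L \<and> (\<forall>c\<in>K \<union> L. \<forall>j\<le>d. c j \<in> polys \<rat> a) \<and>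
          Y = {z \<in> Rn (a + d). proj a z \<in> X \<and>
                 (\<forall>c\<in>K. affine_val a d c z > 0) \<and> (\<forall>c\<in>L. affine_val a d c z = 0)}))"

definition stable_step ::
  "nat \<times> (nat \<Rightarrow> real) set \<Rightarrow> nat \<times> (nat \<Rightarrow> real) set \<Rightarrow> bool" where
  "stable_step P Q \<longleftrightarrow>
     case_prod semialgebraic P \<and> case_prod semialgebraic Q \<and>
     (rationally_equivalent P Q \<or> stable_projection P Q)"

definition stably_equivalent ::
  "nat \<times> (nat \<Rightarrow> real) set \<Rightarrow> nat \<times> (nat \<Rightarrow> real) set \<Rightarrow> bool" where
  "stably_equivalent P Q \<longleftrightarrow>
     case_prod semialgebraic P \<and> case_prod semialgebraic Q \<and> equivclp stable_step P Q"

text \<open>A finite simple graph on the vertices \<open>{..<m}\<close>; its edges are two-element sets.\<close>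

definition simple_graph :: "nat \<Rightarrow> nat set set \<Rightarrow> bool" where
  "simple_graph m E \<longleftrightarrow> (\<forall>e\<in>E. e \<subseteq> {..<m} \<and> card e = 2)"

type_synonym realization = "nat \<Rightarrow> real^2"

definition realizations :: "nat \<Rightarrow> realization topology" where
  "realizations m = product_topology (\<lambda>_. euclidean) {..<m}"

lemma topspace_realizations: "topspace (realizations m) = {..<m} \<rightarrow>\<^sub>E UNIV"
  by (simp add: realizations_def)

definition affine_class :: "nat \<Rightarrow> realization \<Rightarrow> realization set" where
  "affine_class m p =
     {(\<lambda>i\<in>{..<m}. A *v p i + b) |(A :: real^2^2) (b :: real^2). invertible A}"

definition realization_space :: "nat \<Rightarrow> realization set topology" where
  "realization_space m =
     topology (\<lambda>U. U \<subseteq> affine_class m ` topspace (realizations m) \<and>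
                   openin (realizations m) {p \<in> topspace (realizations m). affine_class m p \<in> U})"

lemma openin_realization_space:
  "openin (realization_space m) U \<longleftrightarrow>
     U \<subseteq> affine_class m ` topspace (realizations m) \<and>
     openin (realizations m) {p \<in> topspace (realizations m). affine_class m p \<in> U}"
proof -
  let ?X = "realizations m" and ?q = "affine_class m"
  let ?L = "\<lambda>U. U \<subseteq> ?q ` topspace ?X \<and> openin ?X {p \<in> topspace ?X. ?q p \<in> U}"
  have "?L (S \<inter> T)" if "?L S" "?L T" for S T
  proof -
    have "{p \<in> topspace ?X. ?q p \<in> S \<inter> T} =
          {p \<in> topspace ?X. ?q p \<in> S} \<inter> {p \<in> topspace ?X. ?q p \<in> T}" by blast
    then show ?thesis using that by auto
  qed
  moreover have "?L (\<Union>\<K>)" if "\<forall>K\<in>\<K>. ?L K" for \<K>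
  proof -
    have "{p \<in> topspace ?X. ?q p \<in> \<Union>\<K>} = (\<Union>K\<in>\<K>. {p \<in> topspace ?X. ?q p \<in> K})" by blast
    then show ?thesis using that by auto
  qed
  ultimately have "istopology ?L"
    unfolding istopology_def by blast
  then show ?thesis
    by (simp add: realization_space_def)
qed

lemma topspace_realization_space:
  "topspace (realization_space m) = affine_class m ` topspace (realizations m)"
proof
  show "topspace (realization_space m) \<subseteq> affine_class m ` topspace (realizations m)"
    using openin_realization_space by blast
  have "{p \<in> topspace (realizations m). affine_class m p \<in> affine_class m ` topspace (realizations m)}
        = topspace (realizations m)" by blast
  then have "openin (realization_space m) (affine_class m ` topspace (realizations m))"
    by (simp add: openin_realization_space)
  then show "affine_class m ` topspace (realizations m) \<subseteq> topspace (realization_space m)"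
    by (rule openin_subset)
qed

lemma quotient_map_affine_class:
  "quotient_map (realizations m) (realization_space m) (affine_class m)"
  by (auto simp: quotient_map_def topspace_realization_space openin_realization_space)

text \<open>
  A stress is a function on \<open>E\<close>, extended by zero outside \<open>E\<close>; since edges are unordered pairs,
  the symmetry \<open>s(i,j) = s(j,i)\<close> is automatic.
\<close>

definition stresses :: "nat \<Rightarrow> nat set set \<Rightarrow> realization \<Rightarrow> (nat set \<Rightarrow> real) set" where
  "stresses m E p =
     {s. (\<forall>e. e \<notin> E \<longrightarrow> s e = 0) \<and>
         (\<forall>i<m. (\<Sum>j | j < m \<and> {i, j} \<in> E. s {i, j} *\<^sub>R (p i - p j)) = 0)}"

definition strongly_equivalent :: "nat \<Rightarrow> nat set set \<Rightarrow> realization \<Rightarrow> realization \<Rightarrow> bool" where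
  "strongly_equivalent m E p p' \<longleftrightarrow>
     (\<exists>h k. homeomorphism (stresses m E p) (stresses m E p') h k \<and>
            (\<forall>s\<in>stresses m E p. \<forall>e\<in>E. sgn (h s e) = sgn (s e)))"

definition strong_class :: "nat \<Rightarrow> nat set set \<Rightarrow> realization \<Rightarrow> realization set set" where
  "strong_class m E p =
     affine_class m ` {p' \<in> topspace (realizations m). strongly_equivalent m E p p'}"

definition strata :: "nat \<Rightarrow> nat set set \<Rightarrow> realization set set set" where
  "strata m E =
     (\<Union>p\<in>topspace (realizations m).
        connected_components_of (subtopology (realization_space m) (strong_class m E p)))"

text \<open>
  The cardinality condition is needed because \<^term>\<open>affine_dependent\<close> is a predicate on sets:
  two distinct points counted with repetition would otherwise pass.
\<close>

definition affine_frame :: "nat \<Rightarrow> realization set set \<Rightarrow> nat \<Rightarrow> nat \<Rightarrow> nat \<Rightarrow> bool" where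
  "affine_frame m R i j k \<longleftrightarrow>
     i < m \<and> j < m \<and> k < m \<and>
     (\<forall>p\<in>\<Union>R. card {p i, p j, p k} = 3 \<and> \<not> affine_dependent {p i, p j, p k})"

text \<open>The coordinates of vertex \<open>i\<close> are placed at the positions \<open>2 * i\<close> and \<open>2 * i + 1\<close>.\<close>

definition coords :: "nat \<Rightarrow> realization \<Rightarrow> (nat \<Rightarrow> real)" where
  "coords m p = (\<lambda>l. if l < 2 * m then p (l div 2) $ (if even l then 1 else 2) else 0)"

text \<open>
  The subset of \<open>\<real>\<^sup>2\<^sup>m\<close> representing a set \<open>R\<close> of orbits: each orbit contributes its unique
  realization sending the vertices \<open>i, j, k\<close> to \<open>(0,0), (1,0), (0,1)\<close>.
\<close>

definition normalized :: "nat \<Rightarrow> realization set set \<Rightarrow> nat \<Rightarrow> nat \<Rightarrow> nat \<Rightarrow> (nat \<Rightarrow> real) set" where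
  "normalized m R i j k =
     coords m ` {p \<in> \<Union>R. p i = 0 \<and> p j = axis 1 1 \<and> p k = axis 2 1}"

end

theory Submission
  imports Defs
begin

text \<open>
  An edge whose two ends coincide exerts no force: a stress may take any value on it, and the value enters
  no equilibrium condition.  Take pairwise disjoint triangles and join every corner to one of a few shared
  base vertices.  At a realization that collapses all joining edges, the triangles do not interact: the
  stress space is the direct sum of the stress spaces of the single triangles and of one line for each
  joining edge.  Signs of stresses detect collapsed edges, because an edge is collapsed exactly when some
  stress is supported on it alone; so every strongly equivalent realization collapses the joining edges too.
  A triangle that is not collinear carries no stress at all, and a triangle with its middle corner strictly
  between the other two carries a single line of stresses, with the signs +, +, -; each of the two types is
  recognized by signs.  Hence a whole class of strong equivalence can be made to consist of all
  planar configurations of the base vertices that satisfy an arbitrarily prescribed finite list of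
  betweenness conditions together with one condition that three points are not collinear
  (\<open>triangle_linkage.strong_class_configs\<close>); rescaling by edge lengths gives the homeomorphisms.  The
  position of all other triples of points is left free, which makes the encoding of arithmetic easy.

  It remains to encode the inequalities \<open>q x > 0\<close> by betweenness.  Write \<open>x i = y i - z i\<close> with
  \<open>y i, z i > 1\<close>.  Up to a positive factor every polynomial \<open>q x\<close> becomes a difference of two expressions
  that are built from 1 and the variables \<open>y i, z i\<close> by addition and multiplication and in which every
  subexpression other than 1 has a value greater than 1 (\<open>expressible_poly\<close>).  The values of all
  subexpressions are marked on a line with an origin, a unit and a point at infinity, and additions and
  multiplications are carried out in the manner of von Staudt.  Because all values are at least 1, the order
  of the points on each line involved is known in advance, so betweenness conditions express the whole
  construction.  To stay in the affine plane, the projective plane is drawn with its first quadrant mapped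
  onto a triangle; the normalization of the affine quotient fixes the corners of that triangle, and two
  parameters remain, the positions of the unit and of the diagonal direction.

  Normalized configurations therefore correspond, by rational maps in both directions, to tuples consisting
  of \<open>x\<close> in \<open>A\<close>, of \<open>z\<close> with \<open>z i > 1\<close> and \<open>x i + z i > 1\<close>, and of two positive parameters
  (\<open>expr_system.rationally_equivalent_params\<close>).  Forgetting everything except \<open>x\<close> is a stable projection
  onto \<open>A\<close>.  Its fibres are nonempty, open and convex, so the set of tuples is connected because \<open>A\<close> is;
  hence the class of strong equivalence is connected and is a single stratum.
\<close>

section \<open>Polynomial and rational functions over the rationals\<close>

definition monomial_val :: "(nat \<Rightarrow>\<^sub>0 nat) \<Rightarrow> (nat \<Rightarrow> real) \<Rightarrow> real" where
  "monomial_val u x = (\<Prod>i\<in>Poly_Mapping.keys u. x i ^ Poly_Mapping.lookup u i)"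

lemma monomial_val_superset:
  assumes "finite S" "Poly_Mapping.keys u \<subseteq> S"
  shows "monomial_val u x = (\<Prod>i\<in>S. x i ^ Poly_Mapping.lookup u i)"
  unfolding monomial_val_def
  by (rule prod.mono_neutral_left) (use assms in \<open>auto simp: in_keys_iff\<close>)

lemma monomial_val_add: "monomial_val (u + v) x = monomial_val u x * monomial_val v x"
proof -
  let ?S = "Poly_Mapping.keys u \<union> Poly_Mapping.keys v"
  have "monomial_val (u + v) x = (\<Prod>i\<in>?S. x i ^ Poly_Mapping.lookup (u + v) i)"
    by (rule monomial_val_superset) (auto dest: subsetD[OF Poly_Mapping.keys_add])
  also have "\<dots> = monomial_val u x * monomial_val v x"
    by (simp add: monomial_val_superset[of ?S] lookup_add power_add prod.distrib)
  finally show ?thesis .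
qed

lemma eval_poly_superset:
  assumes "finite S" "Poly_Mapping.keys p \<subseteq> S"
  shows "eval_poly p x = (\<Sum>u\<in>S. Poly_Mapping.lookup p u * monomial_val u x)"
  unfolding eval_poly_def monomial_val_def
  by (rule sum.mono_neutral_left) (use assms in \<open>auto simp: in_keys_iff\<close>)

lemma eval_poly_monomials:
  "eval_poly p x = (\<Sum>u\<in>Poly_Mapping.keys p. Poly_Mapping.lookup p u * monomial_val u x)"
  by (simp add: eval_poly_superset)

lemma eval_poly_add: "eval_poly (p + q) x = eval_poly p x + eval_poly q x"
proof -
  let ?S = "Poly_Mapping.keys p \<union> Poly_Mapping.keys q"
  have "eval_poly (p + q) x = (\<Sum>u\<in>?S. Poly_Mapping.lookup (p + q) u * monomial_val u x)"
    by (rule eval_poly_superset) (auto dest: subsetD[OF Poly_Mapping.keys_add])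
  also have "\<dots> = eval_poly p x + eval_poly q x"
    by (simp add: eval_poly_superset[of ?S] lookup_add distrib_right sum.distrib)
  finally show ?thesis .
qed

lemma eval_poly_single: "eval_poly (Poly_Mapping.single u c) x = c * monomial_val u x"
  by (cases "c = 0") (simp_all add: eval_poly_monomials)

lemma monomial_val_cong:
  assumes "Poly_Mapping.keys u \<subseteq> {..<n}" "\<And>i. i < n \<Longrightarrow> x i = y i"
  shows "monomial_val u x = monomial_val u y"
  unfolding monomial_val_def by (rule prod.cong) (use assms in auto)

lemma eval_poly_cong:
  assumes "p \<in> polys K n" "\<And>i. i < n \<Longrightarrow> x i = y i"
  shows "eval_poly p x = eval_poly p y"
  unfolding eval_poly_monomials
proof (rule sum.cong)
  fix u assume "u \<in> Poly_Mapping.keys p"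
  then have "Poly_Mapping.keys u \<subseteq> {..<n}"
    using assms(1) by (auto simp: polys_def)
  then show "Poly_Mapping.lookup p u * monomial_val u x = Poly_Mapping.lookup p u * monomial_val u y"
    using monomial_val_cong[OF _ assms(2)] by auto
qed simp

lemma polys_mono: "K \<subseteq> K' \<Longrightarrow> n \<le> n' \<Longrightarrow> polys K n \<subseteq> polys K' n'"
  by (fastforce simp: polys_def)

text \<open>
  Arguing with functions instead of formal polynomials keeps the later constructions free of monomials;
  coefficients need to be inspected only in the closure properties below.
\<close>

definition rat_poly_fun :: "nat \<Rightarrow> ((nat \<Rightarrow> real) \<Rightarrow> real) \<Rightarrow> bool" where
  "rat_poly_fun n f \<longleftrightarrow> (\<exists>p\<in>polys \<rat> n. \<forall>x. eval_poly p x = f x)"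

lemma rat_poly_fun_add:
  assumes "rat_poly_fun n f" "rat_poly_fun n g"
  shows "rat_poly_fun n (\<lambda>x. f x + g x)"
proof -
  from assms obtain p q where pq: "p \<in> polys \<rat> n" "q \<in> polys \<rat> n"
    "\<And>x. eval_poly p x = f x" "\<And>x. eval_poly q x = g x"
    unfolding rat_poly_fun_def by metis
  have coeff: "Poly_Mapping.lookup r v \<in> \<rat>" if "r \<in> polys \<rat> n" for r v
    using that by (cases "v \<in> Poly_Mapping.keys r") (auto simp: polys_def in_keys_iff)
  have "Poly_Mapping.keys u \<subseteq> {..<n}" if "u \<in> Poly_Mapping.keys (p + q)" for u
    using subsetD[OF Poly_Mapping.keys_add that] pq(1,2) by (auto simp: polys_def)
  then have "p + q \<in> polys \<rat> n"
    using coeff[OF pq(1)] coeff[OF pq(2)] by (simp add: polys_def lookup_add)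
  then show ?thesis
    unfolding rat_poly_fun_def using pq by (intro bexI[of _ "p + q"]) (auto simp: eval_poly_add)
qed

lemma rat_poly_fun_term:
  assumes "c \<in> \<rat>" "Poly_Mapping.keys u \<subseteq> {..<n}"
  shows "rat_poly_fun n (\<lambda>x. c * monomial_val u x)"
  unfolding rat_poly_fun_def
  by (rule bexI[of _ "Poly_Mapping.single u c"]) (use assms in \<open>auto simp: polys_def eval_poly_single split: if_splits\<close>)

lemma rat_poly_fun_const: "c \<in> \<rat> \<Longrightarrow> rat_poly_fun n (\<lambda>x. c)"
  using rat_poly_fun_term[of c 0 n] by (simp add: monomial_val_def)

lemma rat_poly_fun_var: "i < n \<Longrightarrow> rat_poly_fun n (\<lambda>x. x i)"
  using rat_poly_fun_term[of 1 "Poly_Mapping.single i 1" n] by (simp add: monomial_val_def)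

lemma rat_poly_fun_sum:
  "(\<And>i. i \<in> I \<Longrightarrow> rat_poly_fun n (f i)) \<Longrightarrow> rat_poly_fun n (\<lambda>x. \<Sum>i\<in>I. f i x)"
  by (induction I rule: infinite_finite_induct) (auto intro!: rat_poly_fun_const rat_poly_fun_add)

text \<open>
  Expanding both factors into terms reduces the product to products of monomials, which are again
  monomials, with added exponents.
\<close>

lemma rat_poly_fun_mult:
  assumes "rat_poly_fun n f" "rat_poly_fun n g"
  shows "rat_poly_fun n (\<lambda>x. f x * g x)"
proof -
  from assms obtain p q where pq: "p \<in> polys \<rat> n" "q \<in> polys \<rat> n"
    "\<And>x. eval_poly p x = f x" "\<And>x. eval_poly q x = g x"
    unfolding rat_poly_fun_def by metis
  have "f x * g x = (\<Sum>u\<in>Poly_Mapping.keys p. \<Sum>v\<in>Poly_Mapping.keys q.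
      (Poly_Mapping.lookup p u * Poly_Mapping.lookup q v) * monomial_val (u + v) x)" for x
    unfolding pq(3,4)[symmetric] eval_poly_monomials
    by (simp add: sum_product monomial_val_add algebra_simps)
  moreover have "rat_poly_fun n (\<lambda>x. \<Sum>u\<in>Poly_Mapping.keys p. \<Sum>v\<in>Poly_Mapping.keys q.
      (Poly_Mapping.lookup p u * Poly_Mapping.lookup q v) * monomial_val (u + v) x)"
    using pq(1,2)
    by (intro rat_poly_fun_sum rat_poly_fun_term)
       (auto simp: polys_def dest!: subsetD[OF Poly_Mapping.keys_add])
  ultimately show ?thesis by simp
qed

lemma rat_poly_fun_diff:
  assumes "rat_poly_fun n f" "rat_poly_fun n g"
  shows "rat_poly_fun n (\<lambda>x. f x - g x)"
  using rat_poly_fun_add[OF assms(1) rat_poly_fun_mult[OF rat_poly_fun_const[of "-1"] assms(2)]] by simp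

lemma rat_poly_fun_eval:
  assumes "p \<in> polys \<rat> k" "k \<le> n"
  shows "rat_poly_fun n (eval_poly p)"
  using assms polys_mono[of \<rat> \<rat> k n] by (auto simp: rat_poly_fun_def)

lemma rat_poly_fun_polys_UNIV:
  "rat_poly_fun n f \<Longrightarrow> \<exists>p\<in>polys UNIV n. \<forall>x. eval_poly p x = f x"
  using polys_mono[of \<rat> UNIV n n] by (auto simp: rat_poly_fun_def)

lemma continuous_on_eval_poly: "continuous_on S (eval_poly p)"
proof -
  have "continuous_on S (\<lambda>x. \<Sum>u\<in>Poly_Mapping.keys p. Poly_Mapping.lookup p u *
         (\<Prod>i\<in>Poly_Mapping.keys u. x i ^ Poly_Mapping.lookup u i))"
    by (intro continuous_intros continuous_on_subset[OF continuous_on_product_coordinates]) auto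
  then show ?thesis by (simp add: eval_poly_def[abs_def])
qed

lemma basic_semialgebraic:
  assumes "finite I" "finite J"
    and "\<And>i. i \<in> I \<Longrightarrow> rat_poly_fun n (f i)" "\<And>j. j \<in> J \<Longrightarrow> rat_poly_fun n (g j)"
    and "X = {x \<in> Rn n. (\<forall>i\<in>I. f i x = 0) \<and> (\<forall>j\<in>J. g j x > 0)}"
  shows "semialgebraic n X"
proof -
  have "\<forall>i\<in>I. \<exists>p. p \<in> polys UNIV n \<and> (\<forall>x. eval_poly p x = f i x)"
    using assms(3) rat_poly_fun_polys_UNIV by blast
  then obtain p where p: "\<forall>i\<in>I. p i \<in> polys UNIV n \<and> (\<forall>x. eval_poly (p i) x = f i x)"
    by (rule bchoice[THEN exE])
  have "\<forall>j\<in>J. \<exists>q. q \<in> polys UNIV n \<and> (\<forall>x. eval_poly q x = g j x)"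
    using assms(4) rat_poly_fun_polys_UNIV by blast
  then obtain q where q: "\<forall>j\<in>J. q j \<in> polys UNIV n \<and> (\<forall>x. eval_poly (q j) x = g j x)"
    by (rule bchoice[THEN exE])
  have "X = {x \<in> Rn n. (\<forall>r\<in>p ` I. eval_poly r x = 0) \<and> (\<forall>r\<in>q ` J. eval_poly r x > 0)}"
    unfolding assms(5) using p q by (simp cong: ball_cong)
  moreover have "p ` I \<subseteq> polys UNIV n" "q ` J \<subseteq> polys UNIV n"
    using p q by blast+
  ultimately show ?thesis
    unfolding semialgebraic_def using assms(1,2)
    by (intro exI[of _ "{(p ` I, q ` J)}"]) simp
qed

definition rat_fun_on :: "nat \<Rightarrow> (nat \<Rightarrow> real) set \<Rightarrow> ((nat \<Rightarrow> real) \<Rightarrow> real) \<Rightarrow> bool" where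
  "rat_fun_on n X f \<longleftrightarrow> (\<exists>p q. rat_poly_fun n p \<and> rat_poly_fun n q \<and>
      (\<forall>x\<in>X. q x \<noteq> 0 \<and> f x = p x / q x))"

lemma rat_fun_on_poly: "rat_poly_fun n f \<Longrightarrow> rat_fun_on n X f"
  unfolding rat_fun_on_def
  by (intro exI[of _ f] exI[of _ "\<lambda>_. 1"]) (auto intro: rat_poly_fun_const)

lemma rat_fun_on_diff:
  assumes "rat_fun_on n X f" "rat_fun_on n X g"
  shows "rat_fun_on n X (\<lambda>x. f x - g x)"
proof -
  from assms obtain p q p' q' where *: "rat_poly_fun n p" "rat_poly_fun n q" "rat_poly_fun n p'" "rat_poly_fun n q'"
    "\<And>x. x \<in> X \<Longrightarrow> q x \<noteq> 0 \<and> f x = p x / q x" "\<And>x. x \<in> X \<Longrightarrow> q' x \<noteq> 0 \<and> g x = p' x / q' x"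
    unfolding rat_fun_on_def by metis
  have "rat_poly_fun n (\<lambda>x. p x * q' x - p' x * q x)" "rat_poly_fun n (\<lambda>x. q x * q' x)"
    by (intro rat_poly_fun_diff rat_poly_fun_mult *(1-4))+
  moreover have "q x * q' x \<noteq> 0 \<and> f x - g x = (p x * q' x - p' x * q x) / (q x * q' x)" if "x \<in> X" for x
    using *(5,6)[OF that] by (simp add: diff_frac_eq)
  ultimately show ?thesis
    unfolding rat_fun_on_def by blast
qed

lemma rat_fun_on_mult:
  assumes "rat_fun_on n X f" "rat_fun_on n X g"
  shows "rat_fun_on n X (\<lambda>x. f x * g x)"
proof -
  from assms obtain p q p' q' where *: "rat_poly_fun n p" "rat_poly_fun n q" "rat_poly_fun n p'" "rat_poly_fun n q'"
    "\<And>x. x \<in> X \<Longrightarrow> q x \<noteq> 0 \<and> f x = p x / q x" "\<And>x. x \<in> X \<Longrightarrow> q' x \<noteq> 0 \<and> g x = p' x / q' x"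
    unfolding rat_fun_on_def by metis
  have "rat_poly_fun n (\<lambda>x. p x * p' x)" "rat_poly_fun n (\<lambda>x. q x * q' x)"
    by (intro rat_poly_fun_diff rat_poly_fun_mult *(1-4))+
  moreover have "q x * q' x \<noteq> 0 \<and> f x * g x = (p x * p' x) / (q x * q' x)" if "x \<in> X" for x
    using *(5,6)[OF that] by simp
  ultimately show ?thesis
    unfolding rat_fun_on_def by blast
qed

lemma rat_fun_on_divide:
  assumes "rat_fun_on n X f" "rat_fun_on n X g" and nz: "\<And>x. x \<in> X \<Longrightarrow> g x \<noteq> 0"
  shows "rat_fun_on n X (\<lambda>x. f x / g x)"
proof -
  from assms obtain p q p' q' where *: "rat_poly_fun n p" "rat_poly_fun n q" "rat_poly_fun n p'" "rat_poly_fun n q'"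
    "\<And>x. x \<in> X \<Longrightarrow> q x \<noteq> 0 \<and> f x = p x / q x" "\<And>x. x \<in> X \<Longrightarrow> q' x \<noteq> 0 \<and> g x = p' x / q' x"
    unfolding rat_fun_on_def by metis
  have "rat_poly_fun n (\<lambda>x. p x * q' x)" "rat_poly_fun n (\<lambda>x. q x * p' x)"
    by (intro rat_poly_fun_diff rat_poly_fun_mult *(1-4))+
  moreover have "q x * p' x \<noteq> 0 \<and> f x / g x = (p x * q' x) / (q x * p' x)" if "x \<in> X" for x
    using *(5,6)[OF that] nz[OF that] by auto
  ultimately show ?thesis
    unfolding rat_fun_on_def by blast
qed

lemma rat_fun_on_continuous:
  assumes "rat_fun_on n X f" shows "continuous_on X f"
proof -
  from assms obtain p q where *: "rat_poly_fun n p" "rat_poly_fun n q"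
     "\<And>x. x \<in> X \<Longrightarrow> q x \<noteq> 0 \<and> f x = p x / q x"
    unfolding rat_fun_on_def by metis
  then obtain p' q' where "p = eval_poly p'" "q = eval_poly q'"
    unfolding rat_poly_fun_def by (metis ext)
  then have "continuous_on X (\<lambda>x. p x / q x)"
    using * by (auto intro!: continuous_on_divide continuous_on_eval_poly)
  moreover have "continuous_on X f \<longleftrightarrow> continuous_on X (\<lambda>x. p x / q x)"
    using * by (intro continuous_on_cong) auto
  ultimately show ?thesis by simp
qed

lemma Rn_iff: "x \<in> Rn n \<longleftrightarrow> (\<forall>i\<ge>n. x i = 0)"
  by (simp add: topspace_Euclidean_space)

text \<open>
  Rational maps with nonvanishing denominators are continuous, so mutually inverse ones form a homeomorphism.
\<close>

lemma rationally_equivalentI: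
  assumes X: "X \<subseteq> Rn a" and Y: "Y \<subseteq> Rn b"
    and f: "\<And>x. x \<in> X \<Longrightarrow> f x \<in> Y \<and> g (f x) = x" and g: "\<And>y. y \<in> Y \<Longrightarrow> g y \<in> X \<and> f (g y) = y"
    and rf: "\<And>i. i < b \<Longrightarrow> rat_fun_on a X (\<lambda>x. f x i)"
    and rg: "\<And>i. i < a \<Longrightarrow> rat_fun_on b Y (\<lambda>y. g y i)"
  shows "rationally_equivalent (a, X) (b, Y)"
proof -
  have cont: "continuous_on X' f'" if "Y' \<subseteq> Rn b'" "\<And>x. x \<in> X' \<Longrightarrow> f' x \<in> Y'"
    "\<And>i. i < b' \<Longrightarrow> rat_fun_on a' X' (\<lambda>x. f' x i)" for X' f' Y' a' b'
  proof (rule continuous_on_coordinatewise_then_product)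
    fix i
    show "continuous_on X' (\<lambda>x. f' x i)"
    proof (cases "i < b'")
      case True then show ?thesis using that(3) rat_fun_on_continuous by blast
    next
      case False
      then have "\<And>x. x \<in> X' \<Longrightarrow> f' x i = 0" using that(1,2) by (fastforce simp: Rn_iff)
      then show ?thesis by (simp cong: continuous_on_cong)
    qed
  qed
  have rat: "rational_map_on a' X' b' f'" if r: "\<And>i. i < b' \<Longrightarrow> rat_fun_on a' X' (\<lambda>x. f' x i)" for a' X' b' f'
    unfolding rational_map_on_def
  proof (intro allI impI)
    fix i assume "i < b'"
    then obtain p q where "rat_poly_fun a' p" "rat_poly_fun a' q"
      and pq: "\<forall>x\<in>X'. q x \<noteq> 0 \<and> f' x i = p x / q x"
      using r[of i] unfolding rat_fun_on_def by blast
    then obtain p' q' where "p' \<in> polys \<rat> a'" "q' \<in> polys \<rat> a'"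
      "\<And>x. eval_poly p' x = p x" "\<And>x. eval_poly q' x = q x"
      unfolding rat_poly_fun_def by blast
    then show "\<exists>p\<in>polys \<rat> a'. \<exists>q\<in>polys \<rat> a'. \<forall>x\<in>X'.
        eval_poly q x \<noteq> 0 \<and> f' x i = eval_poly p x / eval_poly q x"
      using pq by (intro bexI[of _ p'] bexI[of _ q']) auto
  qed
  have "continuous_on X f" "continuous_on Y g"
    using cont[OF Y, of X f a] cont[OF X, of Y g b] f g rf rg by blast+
  moreover have "f ` X = Y" "g ` Y = X"
    using f g by (force simp: image_iff)+
  ultimately have "homeomorphism X Y f g"
    unfolding homeomorphism_def using f g by blast
  moreover have "rational_map_on a X b f" "rational_map_on b Y a g"
    using rat[of b a X f] rat[of a b Y g] rf rg by blast+
  ultimately show ?thesis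
    unfolding rationally_equivalent_def by blast
qed

section \<open>Stresses of a triangle\<close>

text \<open>
  The numbers \<open>x\<close>, \<open>y\<close>, \<open>z\<close> belong to the edges \<open>ab\<close>, \<open>bc\<close>, \<open>ac\<close>.
\<close>

definition tri_equilibrium :: "'a::real_vector \<Rightarrow> 'a \<Rightarrow> 'a \<Rightarrow> real \<Rightarrow> real \<Rightarrow> real \<Rightarrow> bool" where
  "tri_equilibrium a b c x y z \<longleftrightarrow>
     x *\<^sub>R (a - b) + z *\<^sub>R (a - c) = 0 \<and> x *\<^sub>R (b - a) + y *\<^sub>R (b - c) = 0 \<and>
     z *\<^sub>R (c - a) + y *\<^sub>R (c - b) = 0"

text \<open>
  All three edges lie on one line, so equilibrium says that the products of stress and edge length, which
  are the tensions, agree up to sign.  In terms of tensions the condition is the same for all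
  configurations of this type, which is what makes rescaling by edge lengths map stresses to stresses.
\<close>

lemma tri_equilibrium_open_segment:
  fixes a b c :: "'a::euclidean_space"
  assumes "b \<in> open_segment a c"
  shows "tri_equilibrium a b c x y z \<longleftrightarrow>
    x * dist a b = y * dist b c \<and> z * dist a c = - (x * dist a b)"
proof -
  obtain t where t: "0 < t" "t < 1" "b = (1 - t) *\<^sub>R a + t *\<^sub>R c" and ne: "a \<noteq> c"
    using assms by (auto simp: in_segment)
  define v where "v = c - a"
  have v: "v \<noteq> 0" using ne by (simp add: v_def)
  have ab: "b - a = t *\<^sub>R v" "a - b = (-t) *\<^sub>R v" and bc: "c - b = (1 - t) *\<^sub>R v" "b - c = (t - 1) *\<^sub>R v"
    and ac: "c - a = v" "a - c = (-1) *\<^sub>R v"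
    by (simp_all add: t(3) v_def algebra_simps)
  have d: "dist a b = t * norm v" "dist b c = (1 - t) * norm v" "dist a c = norm v"
    unfolding dist_norm ab bc ac using t by simp_all
  have *: "x *\<^sub>R (a - b) + z *\<^sub>R (a - c) = (- (x * t + z)) *\<^sub>R v"
    "x *\<^sub>R (b - a) + y *\<^sub>R (b - c) = (x * t - y * (1 - t)) *\<^sub>R v"
    "z *\<^sub>R (c - a) + y *\<^sub>R (c - b) = (z + y * (1 - t)) *\<^sub>R v"
    unfolding ab bc ac by (simp_all add: algebra_simps)
  have "tri_equilibrium a b c x y z \<longleftrightarrow> x * t = y * (1 - t) \<and> z = - (x * t)"
    unfolding tri_equilibrium_def * using v by auto
  moreover have "x * dist a b = y * dist b c \<longleftrightarrow> (x * t) * norm v = (y * (1 - t)) * norm v"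
    "z * dist a c = - (x * dist a b) \<longleftrightarrow> z * norm v = (- (x * t)) * norm v"
    unfolding d by (simp_all only: mult.assoc mult_minus_left)
  ultimately show ?thesis using v by (simp only: mult_cancel_right norm_eq_zero simp_thms)
qed

text \<open>
  Since the signs fix on which side of each corner the other two lie, betweenness can be recovered from
  signs alone, apart from the total collapse of the triangle that \<open>a \<noteq> c\<close> excludes.
\<close>

lemma open_segment_if_tri_equilibrium:
  assumes eq: "tri_equilibrium a b c x y z" and "x > 0" "y > 0" "z < 0" and "a \<noteq> c"
  shows "b \<in> open_segment a c"
proof -
  define t where "t = - z / x"
  have "x *\<^sub>R (b - a) = (- z) *\<^sub>R (c - a)"
    using eq by (simp add: tri_equilibrium_def algebra_simps)
  then have "(1 / x) *\<^sub>R (x *\<^sub>R (b - a)) = (1 / x) *\<^sub>R ((- z) *\<^sub>R (c - a))" by simp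
  then have ba: "b - a = t *\<^sub>R (c - a)"
    using \<open>x > 0\<close> by (simp add: t_def)
  then have b: "b = (1 - t) *\<^sub>R a + t *\<^sub>R c"
    by (simp add: algebra_simps)
  have "z *\<^sub>R (c - a) + y *\<^sub>R (c - b) = (z + y * (1 - t)) *\<^sub>R (c - a)"
    unfolding b by (simp add: algebra_simps)
  then have "z + y * (1 - t) = 0"
    using eq \<open>a \<noteq> c\<close> by (simp add: tri_equilibrium_def)
  then have "1 - t = - z / y"
    using \<open>y > 0\<close> by (simp add: field_simps)
  then have "1 - t > 0" "t > 0"
    using assms(2-4) by (auto simp: t_def divide_neg_pos)
  then show ?thesis
    using b \<open>a \<noteq> c\<close> by (auto simp: in_segment)
qed

lemma not_collinear_independent:
  assumes "\<not> collinear {p, q, r}" "x *\<^sub>R (q - p) + y *\<^sub>R (r - p) = 0"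
  shows "x = 0 \<and> y = 0"
proof -
  have nc: "\<not> collinear {0, q - p, r - p}"
    using assms(1) collinear_3[of q p r] by (simp add: insert_commute)
  have y: "y = 0"
  proof (rule ccontr)
    assume "y \<noteq> 0"
    have "(1 / y) *\<^sub>R (y *\<^sub>R (r - p)) = (1 / y) *\<^sub>R ((- x) *\<^sub>R (q - p))"
      using assms(2) by (simp add: add_eq_0_iff)
    then have "r - p = (- x / y) *\<^sub>R (q - p)"
      using \<open>y \<noteq> 0\<close> by simp
    then show False using nc unfolding collinear_lemma by blast
  qed
  then show ?thesis
    using assms(2) nc by (auto simp: collinear_lemma)
qed

lemma tri_equilibrium_not_collinear:
  assumes "\<not> collinear {a, b, c}" "tri_equilibrium a b c x y z"
  shows "x = 0 \<and> y = 0 \<and> z = 0"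
proof -
  have e: "(- x) *\<^sub>R (b - a) + (- z) *\<^sub>R (c - a) = 0" "(- x) *\<^sub>R (a - b) + (- y) *\<^sub>R (c - b) = 0"
    using assms(2) by (simp_all add: tri_equilibrium_def algebra_simps)
  have "\<not> collinear {b, a, c}"
    using assms(1) by (simp add: insert_commute)
  from not_collinear_independent[OF assms(1) e(1)] not_collinear_independent[OF this e(2)]
  show ?thesis by simp
qed

text \<open>
  An affine dependence with coefficients \<open>\<alpha>\<close> among the corners yields the stress
  \<open>\<alpha>\<^sub>i * \<alpha>\<^sub>j\<close> on the edge joining corners \<open>i\<close> and \<open>j\<close>.
\<close>

lemma tri_equilibrium_collinear:
  assumes "collinear {a, b, c}"
  obtains x y z where "tri_equilibrium a b c x y z" "\<not> (x = 0 \<and> y = 0 \<and> z = 0)"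
proof (cases "a = c")
  case True
  then have "tri_equilibrium a b c 0 0 1" by (simp add: tri_equilibrium_def)
  then show thesis using that by force
next
  case False
  then obtain u where b: "b = u *\<^sub>R a + (1 - u) *\<^sub>R c"
    using assms by (auto simp: collinear_3_expand)
  have "tri_equilibrium a b c (- u) (- (1 - u)) (u * (1 - u))"
    unfolding tri_equilibrium_def b by (simp add: algebra_simps)
  then show thesis using that by force
qed

section \<open>Signs of stresses and collapsed edges\<close>

lemma degenerate_edge_stress:
  assumes "{i, j} \<in> E" "p i = p j"
  shows "(\<lambda>e. if e = {i, j} then 1 else 0) \<in> stresses m E p"
proof -
  have "(if {k, l} = {i, j} then 1 else 0) *\<^sub>R (p k - p l) = 0" for k l
    using assms(2) by (auto simp: doubleton_eq_iff)
  then show ?thesis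
    unfolding stresses_def using assms(1) by (auto intro!: sum.neutral)
qed

lemma degenerate_edge_if_stress:
  assumes "s \<in> stresses m E p" "i < m" "j < m" "{i, j} \<in> E"
    and "s {i, j} \<noteq> 0" "\<And>e. e \<noteq> {i, j} \<Longrightarrow> s e = 0"
  shows "p i = p j"
proof -
  have "(\<Sum>l | l < m \<and> {i, l} \<in> E. s {i, l} *\<^sub>R (p i - p l)) = (\<Sum>l\<in>{j}. s {i, l} *\<^sub>R (p i - p l))"
    using assms(3,4,6) by (intro sum.mono_neutral_right) (auto simp: doubleton_eq_iff)
  then have "s {i, j} *\<^sub>R (p i - p j) = 0"
    using assms(1,2) by (simp add: stresses_def)
  then show ?thesis using assms(5) by simp
qed

text \<open>
  The part of strong equivalence that recovers geometric information: every sign pattern occurring in one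
  stress space occurs in the other one.
\<close>

definition sign_dominated :: "('a \<Rightarrow> real) set \<Rightarrow> ('a \<Rightarrow> real) set \<Rightarrow> bool" where
  "sign_dominated S S' \<longleftrightarrow> (\<forall>s\<in>S. \<exists>s'\<in>S'. \<forall>e. sgn (s' e) = sgn (s e))"

lemma sign_dominatedE:
  assumes "sign_dominated S S'" "s \<in> S"
  obtains s' where "s' \<in> S'" "\<And>e. sgn (s' e) = sgn (s e)"
  using assms unfolding sign_dominated_def by blast

lemma strongly_equivalent_sign_dominated:
  assumes "strongly_equivalent m E p p'"
  shows "sign_dominated (stresses m E p) (stresses m E p')"
    "sign_dominated (stresses m E p') (stresses m E p)"
proof -
  obtain h k where hk: "homeomorphism (stresses m E p) (stresses m E p') h k"
    and "\<forall>s\<in>stresses m E p. \<forall>e\<in>E. sgn (h s e) = sgn (s e)"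
    using assms unfolding strongly_equivalent_def by blast
  moreover have zero: "s e = 0" if "e \<notin> E" "s \<in> stresses m E q" for s e q
    using that by (simp add: stresses_def)
  moreover have h: "h s \<in> stresses m E p'" if "s \<in> stresses m E p" for s
    using hk that by (auto simp: homeomorphism_def)
  ultimately have sgn: "sgn (h s e) = sgn (s e)" if "s \<in> stresses m E p" for s e
    using that by (cases "e \<in> E") (metis, metis)
  show "sign_dominated (stresses m E p) (stresses m E p')"
    unfolding sign_dominated_def using h sgn by blast
  have "k s \<in> stresses m E p \<and> h (k s) = s" if "s \<in> stresses m E p'" for s
    using hk that by (auto simp: homeomorphism_def)
  then show "sign_dominated (stresses m E p') (stresses m E p)"
    unfolding sign_dominated_def using sgn by metis
qed

text \<open>
  The unit stress on a collapsed edge has a one-element support, and a stress with that support forces the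
  edge to be collapsed.
\<close>

lemma sign_dominated_degenerate:
  assumes sd: "sign_dominated (stresses m E p) (stresses m E p')"
    and ij: "i < m" "j < m" "{i, j} \<in> E" and "p i = p j"
  shows "p' i = p' j"
proof -
  obtain s' where s': "s' \<in> stresses m E p'" "\<And>e. sgn (s' e) = sgn (if e = {i, j} then 1 else 0 :: real)"
    by (rule sign_dominatedE[OF sd degenerate_edge_stress[where p = p, OF ij(3) \<open>p i = p j\<close>]]) (rule that)
  have "s' {i, j} \<noteq> 0"
    using s'(2)[of "{i, j}"] by auto
  moreover have "s' e = 0" if "e \<noteq> {i, j}" for e
    using s'(2)[of e] that by (simp add: sgn_zero_iff)
  ultimately show ?thesis
    using degenerate_edge_if_stress[OF s'(1) ij] by blast
qed

section \<open>Linkages of triangles\<close>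

text \<open>
  There are \<open>N\<close> base vertices and the gadgets \<open>0, \<dots>, G\<close>.  Gadget \<open>g\<close> is a triangle on three new vertices,
  its corners; corner \<open>r\<close> is linked by an edge to the base vertex \<open>tri g r\<close>.  Gadget 0 will be kept from
  being collinear, and in every other gadget corner 1 will lie between corners 0 and 2.
\<close>

locale triangle_linkage =
  fixes N G :: nat and tri :: "nat \<Rightarrow> nat \<Rightarrow> nat"
  assumes tri_less: "\<And>g r. g \<le> G \<Longrightarrow> r < 3 \<Longrightarrow> tri g r < N"
begin

definition num_vertices :: nat where "num_vertices = N + 3 * Suc G"

definition corner :: "nat \<Rightarrow> nat \<Rightarrow> nat" where "corner g r = N + 3 * g + r"

text \<open>
  The base vertex with which a vertex has to coincide; base vertices coincide with themselves.
\<close>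

definition base :: "nat \<Rightarrow> nat" where
  "base v = (if v < N then v else tri ((v - N) div 3) ((v - N) mod 3))"

definition links :: "nat set set" where
  "links = {{v, base v} | v. N \<le> v \<and> v < num_vertices}"

definition sides :: "nat set set" where
  "sides = {{corner g r, corner g r'} | g r r'. g \<le> G \<and> r < 3 \<and> r' < 3 \<and> r \<noteq> r'}"

definition edges :: "nat set set" where "edges = links \<union> sides"

definition linked :: "realization \<Rightarrow> bool" where
  "linked p \<longleftrightarrow> (\<forall>v<num_vertices. p v = p (base v))"

definition config :: "realization \<Rightarrow> bool" where
  "config q \<longleftrightarrow> \<not> collinear {q (tri 0 0), q (tri 0 1), q (tri 0 2)} \<and>
     (\<forall>g. 1 \<le> g \<and> g \<le> G \<longrightarrow> q (tri g 1) \<in> open_segment (q (tri g 0)) (q (tri g 2)))"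

definition configs :: "realization set" where
  "configs = {p \<in> topspace (realizations num_vertices). linked p \<and> config p}"

lemma base_corner: "r < 3 \<Longrightarrow> base (corner g r) = tri g r"
  by (simp add: base_def corner_def)

lemma corner_inject: "r < 3 \<Longrightarrow> r' < 3 \<Longrightarrow> corner g r = corner g' r' \<longleftrightarrow> g = g' \<and> r = r'"
  unfolding corner_def by (auto; presburger)

lemma corner_less: "g \<le> G \<Longrightarrow> r < 3 \<Longrightarrow> corner g r < num_vertices"
  by (simp add: corner_def num_vertices_def)

lemma corner_ge: "N \<le> corner g r"
  by (simp add: corner_def)

lemma vertex_cases:
  assumes "v < num_vertices"
  obtains "v < N" | g r where "g \<le> G" "r < 3" "v = corner g r"
proof (cases "v < N")
  case False
  then have "v = corner ((v - N) div 3) ((v - N) mod 3)" by (simp add: corner_def)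
  moreover have "(v - N) div 3 \<le> G" "(v - N) mod 3 < 3"
    using assms False by (auto simp: num_vertices_def)
  ultimately show thesis using that by blast
qed (use that in blast)

lemma base_less: "v < num_vertices \<Longrightarrow> base v < N"
  by (elim vertex_cases) (auto simp: base_corner tri_less, simp add: base_def)

lemma simple_graph_edges: "simple_graph num_vertices edges"
proof -
  have "e \<subseteq> {..<num_vertices} \<and> card e = 2" if e: "e \<in> links" for e
  proof -
    obtain v where v: "e = {v, base v}" "N \<le> v" "v < num_vertices" using e by (auto simp: links_def)
    then show ?thesis using base_less[OF v(3)] by auto
  qed
  moreover have "e \<subseteq> {..<num_vertices} \<and> card e = 2" if "e \<in> sides" for e
    using that by (auto simp: sides_def corner_less corner_inject)
  ultimately show ?thesis
    by (auto simp: simple_graph_def edges_def)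
qed

lemma corner_edge: "g \<le> G \<Longrightarrow> r < 3 \<Longrightarrow> r' < 3 \<Longrightarrow> r \<noteq> r' \<Longrightarrow> {corner g r, corner g r'} \<in> edges"
  by (auto simp: edges_def sides_def)

text \<open>
  In a linked realization only the sides of the triangles can transmit forces.
\<close>

lemma edge_cases:
  assumes "{i, j} \<in> edges" "i < num_vertices" "j < num_vertices" "linked p"
  obtains "p i = p j" | g r r' where "g \<le> G" "r < 3" "r' < 3" "i = corner g r" "j = corner g r'"
proof (cases "{i, j} \<in> links")
  case True
  then obtain v where v: "{i, j} = {v, base v}" "N \<le> v" "v < num_vertices" by (auto simp: links_def)
  then have "p i = p j"
    using assms(4) by (auto simp: linked_def doubleton_eq_iff)
  then show thesis using that by blast
next
  case False
  then obtain g r r' where "g \<le> G" "r < 3" "r' < 3" "{i, j} = {corner g r, corner g r'}"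
    using assms(1) by (auto simp: edges_def sides_def)
  then show thesis using that by (auto simp: doubleton_eq_iff)
qed

lemma vertex_force:
  assumes p: "linked p" and g: "g \<le> G" and r: "r < 3"
  shows "(\<Sum>j | j < num_vertices \<and> {corner g r, j} \<in> edges. s {corner g r, j} *\<^sub>R (p (corner g r) - p j)) =
    (\<Sum>r'<3. s {corner g r, corner g r'} *\<^sub>R (p (tri g r) - p (tri g r')))"
proof -
  let ?i = "corner g r" and ?A = "{j. j < num_vertices \<and> {corner g r, j} \<in> edges}" and ?B = "corner g ` {..<3}"
  let ?f = "\<lambda>j. s {?i, j} *\<^sub>R (p ?i - p j)"
  have pc: "p (corner g r) = p (tri g r)" if "r < 3" for r
    using p g that corner_less[OF g that] by (auto simp: linked_def base_corner)
  have "?f j = 0" if "j \<in> ?A - ?B" for j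
  proof -
    have *: "{?i, j} \<in> edges" "j < num_vertices" using that by auto
    show ?thesis
      by (rule edge_cases[OF *(1) corner_less[OF g r] *(2) p]) (use that r in \<open>auto simp: corner_inject\<close>)
  qed
  then have "sum ?f ?A = sum ?f (?A \<inter> ?B)"
    by (intro sum.mono_neutral_right) auto
  also have "\<dots> = sum ?f ?B"
  proof (rule sum.mono_neutral_left)
    show "\<forall>j\<in>?B - ?A \<inter> ?B. ?f j = 0"
    proof
      fix j assume j: "j \<in> ?B - ?A \<inter> ?B"
      then obtain r' where r': "r' < 3" "j = corner g r'" by auto
      then have "r' = r" using j corner_edge[OF g r, of r'] corner_less[OF g] by auto
      then show "?f j = 0" using r' by simp
    qed
  qed auto
  also have "\<dots> = (\<Sum>r'<3. ?f (corner g r'))"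
    by (subst sum.reindex) (auto simp: inj_on_def corner_inject)
  also have "\<dots> = (\<Sum>r'<3. s {corner g r, corner g r'} *\<^sub>R (p (tri g r) - p (tri g r')))"
    using pc r by (intro sum.cong) auto
  finally show ?thesis .
qed

text \<open>
  The links contribute nothing to any force, so the equilibrium conditions split into separate conditions
  for the triangles.
\<close>

lemma stresses_linked:
  assumes p: "linked p"
  shows "s \<in> stresses num_vertices edges p \<longleftrightarrow> (\<forall>e. e \<notin> edges \<longrightarrow> s e = 0) \<and>
    (\<forall>g\<le>G. tri_equilibrium (p (tri g 0)) (p (tri g 1)) (p (tri g 2))
       (s {corner g 0, corner g 1}) (s {corner g 1, corner g 2}) (s {corner g 0, corner g 2}))"
proof -
  let ?F = "\<lambda>i. \<Sum>j | j < num_vertices \<and> {i, j} \<in> edges. s {i, j} *\<^sub>R (p i - p j)"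
  have low: "?F i = 0" if "i < N" for i
  proof (rule sum.neutral, rule ballI)
    fix j assume "j \<in> {j. j < num_vertices \<and> {i, j} \<in> edges}"
    then have j: "{i, j} \<in> edges" "j < num_vertices" by auto
    have "i < num_vertices" using that by (simp add: num_vertices_def)
    show "s {i, j} *\<^sub>R (p i - p j) = 0"
      by (rule edge_cases[OF j(1) \<open>i < num_vertices\<close> j(2) p]) (use that corner_ge in \<open>auto simp: not_le[symmetric]\<close>)
  qed
  have "(\<forall>i<num_vertices. ?F i = 0) \<longleftrightarrow> (\<forall>g\<le>G. \<forall>r<3. ?F (corner g r) = 0)"
  proof (intro iffI allI impI)
    fix i assume *: "\<forall>g\<le>G. \<forall>r<3. ?F (corner g r) = 0" and i: "i < num_vertices"
    show "?F i = 0"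
      using i by (rule vertex_cases) (use low * in auto)
  qed (use corner_less in blast)
  also have "\<dots> \<longleftrightarrow> (\<forall>g\<le>G. ?F (corner g 0) = 0 \<and> ?F (corner g 1) = 0 \<and> ?F (corner g 2) = 0)"
  proof -
    have "(\<forall>r<3. P r) \<longleftrightarrow> P 0 \<and> P 1 \<and> P (2::nat)" for P
      by (simp add: numeral_3_eq_3 numeral_2_eq_2 All_less_Suc conj_ac)
    then show ?thesis by presburger
  qed
  also have "\<dots> \<longleftrightarrow> (\<forall>g\<le>G. tri_equilibrium (p (tri g 0)) (p (tri g 1)) (p (tri g 2))
       (s {corner g 0, corner g 1}) (s {corner g 1, corner g 2}) (s {corner g 0, corner g 2}))"
  proof (intro all_cong1 imp_cong refl)
    fix g assume g: "g \<le> G"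
    have three: "(\<Sum>r'<3. f r') = f 0 + f 1 + f 2" for f :: "nat \<Rightarrow> real^2"
      by (simp add: numeral_3_eq_3 numeral_2_eq_2)
    have lt: "0 < (3::nat)" "1 < (3::nat)" "2 < (3::nat)" by simp_all
    show "(?F (corner g 0) = 0 \<and> ?F (corner g 1) = 0 \<and> ?F (corner g 2) = 0) =
       tri_equilibrium (p (tri g 0)) (p (tri g 1)) (p (tri g 2))
       (s {corner g 0, corner g 1}) (s {corner g 1, corner g 2}) (s {corner g 0, corner g 2})"
      unfolding vertex_force[OF p g lt(1)] vertex_force[OF p g lt(2)] vertex_force[OF p g lt(3)] three
      by (simp add: tri_equilibrium_def insert_commute)
  qed
  finally show ?thesis by (simp add: stresses_def)
qed

definition tri_stress :: "nat \<Rightarrow> real \<Rightarrow> real \<Rightarrow> real \<Rightarrow> nat set \<Rightarrow> real" where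
  "tri_stress g x y z = (\<lambda>e. if e = {corner g 0, corner g 1} then x
      else if e = {corner g 1, corner g 2} then y else if e = {corner g 0, corner g 2} then z else 0)"

lemma tri_stress_corner:
  "tri_stress g x y z {corner g' 0, corner g' 1} = (if g' = g then x else 0)"
  "tri_stress g x y z {corner g' 1, corner g' 2} = (if g' = g then y else 0)"
  "tri_stress g x y z {corner g' 0, corner g' 2} = (if g' = g then z else 0)"
  by (auto simp: tri_stress_def doubleton_eq_iff corner_inject)

lemma tri_stress_in_stresses:
  assumes "linked p" "g \<le> G"
    "tri_equilibrium (p (tri g 0)) (p (tri g 1)) (p (tri g 2)) x y z"
  shows "tri_stress g x y z \<in> stresses num_vertices edges p"
  unfolding stresses_linked[OF assms(1)] tri_stress_corner
proof (intro conjI allI impI)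
  fix e assume "e \<notin> edges"
  then show "tri_stress g x y z e = 0"
    using corner_edge[OF assms(2), of 0 1] corner_edge[OF assms(2), of 1 2] corner_edge[OF assms(2), of 0 2]
    by (auto simp: tri_stress_def)
next
  fix g' assume "g' \<le> G"
  then show "tri_equilibrium (p (tri g' 0)) (p (tri g' 1)) (p (tri g' 2))
     (if g' = g then x else 0) (if g' = g then y else 0) (if g' = g then z else 0)"
    using assms(3) by (auto simp: tri_equilibrium_def)
qed

text \<open>
  Signs first transfer the collapse of the links.  Then the stresses of both realizations decouple, and the
  type of each triangle is read off from stresses supported on that triangle: a stress on gadget 0 of \<open>p'\<close>
  would give one on gadget 0 of \<open>p\<close>, and the stress of another gadget of \<open>p\<close> gives one with the signs +, +, -
  for \<open>p'\<close>.
\<close>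

lemma configs_if_strongly_equivalent:
  assumes p: "p \<in> configs" and p': "p' \<in> topspace (realizations num_vertices)"
    and se: "strongly_equivalent num_vertices edges p p'"
  shows "p' \<in> configs"
proof -
  note sd = strongly_equivalent_sign_dominated[OF se]
  have lp: "linked p" and cp: "config p" using p by (auto simp: configs_def)
  have lp': "linked p'"
    unfolding linked_def
  proof (intro allI impI)
    fix v assume v: "v < num_vertices"
    show "p' v = p' (base v)"
    proof (cases "v < N")
      case False
      then have "{v, base v} \<in> edges" using v by (auto simp: edges_def links_def)
      moreover have "base v < num_vertices" using base_less[OF v] by (simp add: num_vertices_def)
      ultimately show ?thesis
        using sign_dominated_degenerate[OF sd(1) v] lp v by (auto simp: linked_def)
    qed (simp add: base_def)
  qed
  have corner: "q (corner g r) = q (tri g r)" if "linked q" "g \<le> G" "r < 3" for q g r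
    using that corner_less unfolding linked_def by (simp add: base_corner)
  have "\<not> collinear {p' (tri 0 0), p' (tri 0 1), p' (tri 0 2)}"
  proof
    assume "collinear {p' (tri 0 0), p' (tri 0 1), p' (tri 0 2)}"
    then obtain x y z where
      xyz: "tri_equilibrium (p' (tri 0 0)) (p' (tri 0 1)) (p' (tri 0 2)) x y z" "\<not> (x = 0 \<and> y = 0 \<and> z = 0)"
      by (rule tri_equilibrium_collinear)
    obtain s where s: "s \<in> stresses num_vertices edges p" "\<And>e. sgn (s e) = sgn (tri_stress 0 x y z e)"
      by (rule sign_dominatedE[OF sd(2) tri_stress_in_stresses[OF lp' le0 xyz(1)]]) (rule that)
    have "tri_equilibrium (p (tri 0 0)) (p (tri 0 1)) (p (tri 0 2))
       (s {corner 0 0, corner 0 1}) (s {corner 0 1, corner 0 2}) (s {corner 0 0, corner 0 2})"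
      using s(1) unfolding stresses_linked[OF lp] by blast
    then have "s {corner 0 0, corner 0 1} = 0 \<and> s {corner 0 1, corner 0 2} = 0 \<and> s {corner 0 0, corner 0 2} = 0"
      using tri_equilibrium_not_collinear cp unfolding config_def by blast
    then show False
      using xyz(2) s(2)[of "{corner 0 0, corner 0 1}"] s(2)[of "{corner 0 1, corner 0 2}"] s(2)[of "{corner 0 0, corner 0 2}"]
      by (simp add: tri_stress_corner sgn_zero_iff del: One_nat_def)
  qed
  moreover have "p' (tri g 1) \<in> open_segment (p' (tri g 0)) (p' (tri g 2))" if g: "1 \<le> g" "g \<le> G" for g
  proof -
    let ?a = "p (tri g 0)" and ?b = "p (tri g 1)" and ?c = "p (tri g 2)"
    have seg: "?b \<in> open_segment ?a ?c" using cp g by (simp add: config_def)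
    then have pos: "dist ?a ?b > 0" "dist ?b ?c > 0" "dist ?a ?c > 0"
      by (auto simp: open_segment_def)
    let ?x = "1 / dist ?a ?b" and ?y = "1 / dist ?b ?c" and ?z = "- 1 / dist ?a ?c"
    have eq: "tri_equilibrium ?a ?b ?c ?x ?y ?z"
      unfolding tri_equilibrium_open_segment[OF seg] using pos by simp
    obtain s where s: "s \<in> stresses num_vertices edges p'" "\<And>e. sgn (s e) = sgn (tri_stress g ?x ?y ?z e)"
      by (rule sign_dominatedE[OF sd(1) tri_stress_in_stresses[OF lp g(2) eq]]) (rule that)
    have "s {corner g 0, corner g 1} > 0" "s {corner g 1, corner g 2} > 0" "s {corner g 0, corner g 2} < 0"
      using s(2)[of "{corner g 0, corner g 1}"] s(2)[of "{corner g 1, corner g 2}"] s(2)[of "{corner g 0, corner g 2}"] pos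
      by (simp_all add: tri_stress_corner sgn_1_pos sgn_1_neg del: One_nat_def)
    moreover have "tri_equilibrium (p' (tri g 0)) (p' (tri g 1)) (p' (tri g 2))
       (s {corner g 0, corner g 1}) (s {corner g 1, corner g 2}) (s {corner g 0, corner g 2})"
      using s(1) g unfolding stresses_linked[OF lp'] by blast
    moreover have "p' (tri g 0) \<noteq> p' (tri g 2)"
    proof
      assume "p' (tri g 0) = p' (tri g 2)"
      then have "p' (corner g 0) = p' (corner g 2)" using corner[OF lp' g(2)] by simp
      then have "p (corner g 0) = p (corner g 2)"
        using sign_dominated_degenerate[OF sd(2)] corner_less[OF g(2)] corner_edge[OF g(2)] by simp
      then show False using corner[OF lp g(2)] pos by simp
    qed
    ultimately show ?thesis by (blast intro: open_segment_if_tri_equilibrium)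
  qed
  ultimately show ?thesis using p' lp' by (simp add: configs_def config_def)
qed

text \<open>
  Edges are unordered, so the length is written as a symmetric sum, which counts the distance twice.
\<close>

definition edge_length :: "realization \<Rightarrow> nat set \<Rightarrow> real" where
  "edge_length p e = (\<Sum>i\<in>e. \<Sum>j\<in>e. dist (p i) (p j)) / 2"

text \<open>
  The value 1 on collapsed edges makes the weights positive, so that rescaling by them keeps all signs.
\<close>

definition edge_weight :: "realization \<Rightarrow> nat set \<Rightarrow> real" where
  "edge_weight p e = (if edge_length p e = 0 then 1 else edge_length p e)"

lemma edge_weight_pos: "edge_weight p e > 0"
proof -
  have "edge_length p e \<ge> 0" by (simp add: edge_length_def sum_nonneg)
  then show ?thesis by (simp add: edge_weight_def)
qed

lemma edge_weight_doubleton: "p i \<noteq> p j \<Longrightarrow> edge_weight p {i, j} = dist (p i) (p j)"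
  by (cases "i = j") (auto simp: edge_weight_def edge_length_def dist_commute)

text \<open>
  The rescaling preserves the tensions in the sides of the collinear triangles, and the stresses on the sides
  of gadget 0 are zero anyway.
\<close>

lemma rescaled_stress:
  assumes p: "p \<in> configs" and p': "p' \<in> configs" and s: "s \<in> stresses num_vertices edges p"
  shows "(\<lambda>e. s e * edge_weight p e / edge_weight p' e) \<in> stresses num_vertices edges p'"
proof -
  have lp: "linked p" and cp: "config p" and lp': "linked p'" and cp': "config p'"
    using p p' by (auto simp: configs_def)
  let ?h = "\<lambda>e. s e * edge_weight p e / edge_weight p' e"
  have corner: "q (corner g r) = q (tri g r)" if "linked q" "g \<le> G" "r < 3" for q g r
    using that corner_less unfolding linked_def by (simp add: base_corner)
  have "tri_equilibrium (p' (tri g 0)) (p' (tri g 1)) (p' (tri g 2))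
       (?h {corner g 0, corner g 1}) (?h {corner g 1, corner g 2}) (?h {corner g 0, corner g 2})" if g: "g \<le> G" for g
  proof -
    have eq: "tri_equilibrium (p (tri g 0)) (p (tri g 1)) (p (tri g 2))
       (s {corner g 0, corner g 1}) (s {corner g 1, corner g 2}) (s {corner g 0, corner g 2})"
      using s g unfolding stresses_linked[OF lp] by blast
    show ?thesis
    proof (cases "g = 0")
      case True
      then have "s {corner g 0, corner g 1} = 0 \<and> s {corner g 1, corner g 2} = 0 \<and> s {corner g 0, corner g 2} = 0"
        using tri_equilibrium_not_collinear[OF _ eq] cp unfolding config_def by blast
      then show ?thesis by (simp add: tri_equilibrium_def)
    next
      case False
      have seg: "q (tri g 1) \<in> open_segment (q (tri g 0)) (q (tri g 2))" if "config q" for q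
        using that False g by (simp add: config_def)
      have w: "edge_weight q {corner g 0, corner g 1} = dist (q (tri g 0)) (q (tri g 1))"
        "edge_weight q {corner g 1, corner g 2} = dist (q (tri g 1)) (q (tri g 2))"
        "edge_weight q {corner g 0, corner g 2} = dist (q (tri g 0)) (q (tri g 2))"
        "q (tri g 0) \<noteq> q (tri g 1)" "q (tri g 1) \<noteq> q (tri g 2)" "q (tri g 0) \<noteq> q (tri g 2)"
        if "linked q" "config q" for q
      proof -
        show ne: "q (tri g 0) \<noteq> q (tri g 1)" "q (tri g 1) \<noteq> q (tri g 2)" "q (tri g 0) \<noteq> q (tri g 2)"
          using seg[OF that(2)] by (auto simp: open_segment_def)
        show "edge_weight q {corner g 0, corner g 1} = dist (q (tri g 0)) (q (tri g 1))"
          "edge_weight q {corner g 1, corner g 2} = dist (q (tri g 1)) (q (tri g 2))"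
          "edge_weight q {corner g 0, corner g 2} = dist (q (tri g 0)) (q (tri g 2))"
          using ne corner[OF that(1) g] by (simp_all add: edge_weight_doubleton)
      qed
      have "?h e * edge_weight p' e = s e * edge_weight p e" for e
        using edge_weight_pos[of p' e] by (simp add: less_imp_neq[symmetric])
      note h = this[of "{corner g 0, corner g 1}", unfolded w[OF lp cp] w[OF lp' cp']]
        this[of "{corner g 1, corner g 2}", unfolded w[OF lp cp] w[OF lp' cp']]
        this[of "{corner g 0, corner g 2}", unfolded w[OF lp cp] w[OF lp' cp']]
      show ?thesis
        using eq unfolding tri_equilibrium_open_segment[OF seg[OF cp]] tri_equilibrium_open_segment[OF seg[OF cp']]
          w[OF lp cp] w[OF lp' cp'] h .
    qed
  qed
  moreover have "?h e = 0" if "e \<notin> edges" for e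
    using s that by (simp add: stresses_def)
  ultimately show ?thesis
    unfolding stresses_linked[OF lp'] by blast
qed

lemma strongly_equivalent_configs:
  assumes p: "p \<in> configs" and p': "p' \<in> configs"
  shows "strongly_equivalent num_vertices edges p p'"
proof -
  let ?h = "\<lambda>p p' s e. s e * edge_weight p e / edge_weight p' e"
  have nz: "edge_weight q e \<noteq> 0" for q e
    using edge_weight_pos[of q e] by simp
  have cont: "continuous_on S (?h q q')" for S :: "(nat set \<Rightarrow> real) set" and q q'
    by (intro continuous_on_coordinatewise_then_product continuous_intros
        continuous_on_subset[OF continuous_on_product_coordinates]) (auto simp: nz)
  have inv: "?h q' q (?h q q' s) = s" for q q' s
    using nz by (auto simp: fun_eq_iff)
  have into: "?h q q' ` stresses num_vertices edges q \<subseteq> stresses num_vertices edges q'" if "q \<in> configs" "q' \<in> configs" for q q'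
    using rescaled_stress[OF that] by blast
  have "homeomorphism (stresses num_vertices edges p) (stresses num_vertices edges p') (?h p p') (?h p' p)"
    by (intro homeomorphismI cont into p p' inv)
  moreover have "sgn (?h p p' s e) = sgn (s e)" for s e
    using edge_weight_pos[of p e] edge_weight_pos[of p' e] by (simp add: sgn_mult sgn_divide)
  ultimately show ?thesis unfolding strongly_equivalent_def by blast
qed

lemma strong_class_configs:
  assumes "p \<in> configs"
  shows "strong_class num_vertices edges p = affine_class num_vertices ` configs"
proof -
  have "{p' \<in> topspace (realizations num_vertices). strongly_equivalent num_vertices edges p p'} = configs"
    using configs_if_strongly_equivalent[OF assms] strongly_equivalent_configs[OF assms]
    by (auto simp: configs_def)
  then show ?thesis by (simp add: strong_class_def)
qed

end

section \<open>Affine classes and betweenness in coordinates\<close>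

lemma mem_affine_class:
  "q \<in> affine_class m p \<longleftrightarrow>
     (\<exists>(A::real^2^2) b. invertible A \<and> q = (\<lambda>i\<in>{..<m}. A *v p i + b))"
  unfolding affine_class_def by blast

lemma affine_class_self:
  assumes "p \<in> topspace (realizations m)"
  shows "p \<in> affine_class m p"
proof -
  have "p = (\<lambda>i\<in>{..<m}. mat 1 *v p i + 0)"
    using assms by (auto simp: topspace_realizations PiE_def extensional_def fun_eq_iff)
  moreover have "invertible (mat 1 :: real^2^2)" unfolding invertible_def by (metis matrix_mul_lid)
  ultimately show ?thesis unfolding mem_affine_class by blast
qed

lemma affine_class_subset:
  assumes "q \<in> affine_class m p"
  shows "affine_class m q \<subseteq> affine_class m p"
proof
  fix r assume "r \<in> affine_class m q"
  then obtain B :: "real^2^2" and c where B: "invertible B" "r = (\<lambda>i\<in>{..<m}. B *v q i + c)"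
    unfolding mem_affine_class by blast
  obtain A :: "real^2^2" and b where A: "invertible A" "q = (\<lambda>i\<in>{..<m}. A *v p i + b)"
    using assms unfolding mem_affine_class by blast
  have "r = (\<lambda>i\<in>{..<m}. (B ** A) *v p i + (B *v b + c))"
    unfolding A(2) B(2)
    by (auto simp: fun_eq_iff matrix_vector_right_distrib matrix_vector_mul_assoc algebra_simps)
  then show "r \<in> affine_class m p"
    unfolding mem_affine_class using invertible_mult[OF B(1) A(1)] by blast
qed

lemma affine_class_sym:
  assumes "q \<in> affine_class m p" "p \<in> topspace (realizations m)"
  shows "p \<in> affine_class m q"
proof -
  obtain A :: "real^2^2" and b where A: "invertible A" "q = (\<lambda>i\<in>{..<m}. A *v p i + b)"
    using assms unfolding mem_affine_class by blast
  obtain B :: "real^2^2" where B: "A ** B = mat 1" "B ** A = mat 1"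
    using A(1) unfolding invertible_def by blast
  have "B *v (A *v p i + b) + (- (B *v b)) = p i" for i
    by (simp add: matrix_vector_right_distrib matrix_vector_mul_assoc B)
  then have "p = (\<lambda>i\<in>{..<m}. B *v q i + (- (B *v b)))"
    using assms(2) by (auto simp: A(2) topspace_realizations PiE_def extensional_def fun_eq_iff)
  moreover have "invertible B" unfolding invertible_def using B by blast
  ultimately show ?thesis unfolding mem_affine_class by blast
qed

lemma affine_class_eq:
  assumes "q \<in> affine_class m p" "p \<in> topspace (realizations m)"
  shows "affine_class m q = affine_class m p"
  using affine_class_subset[OF assms(1)] affine_class_subset[OF affine_class_sym[OF assms]] by blast

lemma affine_image_open_segment:
  fixes A :: "real^2^2"
  assumes "invertible A" "b \<in> open_segment a c"
  shows "A *v b + d \<in> open_segment (A *v a + d) (A *v c + d)"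
proof -
  have "inj ((*v) A)"
    using assms(1) unfolding invertible_left_inverse matrix_left_invertible_injective .
  then have "A *v b \<in> open_segment (A *v a) (A *v c)"
    using assms(2) by (simp add: open_segment_linear_image matrix_vector_mul_linear)
  then show ?thesis
    using open_segment_translation_eq[of d "A *v b" "A *v a" "A *v c"] by (simp add: add.commute)
qed

lemma affine_image_collinear:
  fixes A :: "real^2^2"
  assumes "invertible A" "collinear {A *v a + d, A *v b + d, A *v c + d}"
  shows "collinear {a, b, c}"
proof -
  have inj: "inj ((*v) A)"
    using assms(1) unfolding invertible_left_inverse matrix_left_invertible_injective .
  have "A *v a = A *v c \<or> (\<exists>u. A *v b = A *v (u *\<^sub>R a + (1 - u) *\<^sub>R c))"
    using assms(2) unfolding collinear_3_expand by (auto simp: algebra_simps)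
  then show ?thesis
    unfolding collinear_3_expand using inj by (auto dest: injD)
qed

text \<open>
  The matrix with columns \<open>b - a\<close> and \<open>c - a\<close> sends the unit vectors to these differences; its inverse
  normalizes.
\<close>

lemma affine_normalization:
  fixes a b c :: "real^2"
  assumes "\<not> collinear {a, b, c}"
  obtains A :: "real^2^2" and d where "invertible A" "A *v a + d = 0" "A *v b + d = axis 1 1" "A *v c + d = axis 2 1"
proof -
  define M :: "real^2^2" where "M = (\<chi> r s. if s = 1 then (b - a) $ r else (c - a) $ r)"
  have M: "M *v x = x $ 1 *\<^sub>R (b - a) + x $ 2 *\<^sub>R (c - a)" for x
    by (simp add: vec_eq_iff M_def matrix_vector_mult_def sum_2 mult.commute)
  have "x = 0" if "M *v x = 0" for x
    using not_collinear_independent[OF assms, of "x $ 1" "x $ 2"] that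
    by (simp add: M vec_eq_iff forall_2)
  then obtain B where B: "B ** M = mat 1"
    using matrix_left_invertible_ker[of M] by blast
  then have inv: "invertible B"
    using matrix_left_right_inverse[of B M] unfolding invertible_def by blast
  have BM: "B *v (M *v x) = x" for x
    by (simp add: matrix_vector_mul_assoc B)
  have "M *v axis 1 1 = b - a" "M *v axis 2 1 = c - a"
    by (simp_all add: M axis_def)
  then have "B *v (b - a) = axis 1 1" "B *v (c - a) = axis 2 1"
    using BM[of "axis 1 1"] BM[of "axis 2 1"] by simp_all
  then show thesis
    using that[of B "- (B *v a)"] inv by (simp add: matrix_vector_mult_diff_distrib)
qed

text \<open>
  Collinearity is the vanishing of a determinant, and a positive inner product of \<open>b - a\<close> and \<open>c - b\<close>
  excludes the other orders and coinciding points.  In this form betweenness is semialgebraic without an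
  existential quantifier.
\<close>

lemma open_segment_plane_iff:
  fixes a b c :: "real^2"
  shows "b \<in> open_segment a c \<longleftrightarrow>
    (b$1 - a$1) * (c$2 - b$2) - (b$2 - a$2) * (c$1 - b$1) = 0 \<and>
    (b$1 - a$1) * (c$1 - b$1) + (b$2 - a$2) * (c$2 - b$2) > 0" (is "_ \<longleftrightarrow> ?cross = 0 \<and> ?dot > 0")
proof
  assume "b \<in> open_segment a c"
  then obtain t where t: "0 < t" "t < 1" "b = (1 - t) *\<^sub>R a + t *\<^sub>R c" and ne: "a \<noteq> c"
    by (auto simp: in_segment)
  define u v where "u = c $ 1 - a $ 1" and "v = c $ 2 - a $ 2"
  have "u \<noteq> 0 \<or> v \<noteq> 0" using ne by (auto simp: u_def v_def vec_eq_iff forall_2)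
  then have "u * u + v * v > 0"
    by (metis add_nonneg_pos add_pos_nonneg not_real_square_gt_zero zero_le_square)
  moreover have b: "b$1 - a$1 = t * u" "b$2 - a$2 = t * v" "c$1 - b$1 = (1 - t) * u" "c$2 - b$2 = (1 - t) * v"
    by (simp_all add: t(3) u_def v_def algebra_simps)
  moreover have "t * u * ((1 - t) * u) + t * v * ((1 - t) * v) = (t * (1 - t)) * (u * u + v * v)"
    by (simp add: algebra_simps)
  ultimately show "?cross = 0 \<and> ?dot > 0"
    using t(1,2) unfolding b by (auto intro!: mult_pos_pos)
next
  assume *: "?cross = 0 \<and> ?dot > 0"
  define u v w z where "u = b$1 - a$1" and "v = b$2 - a$2" and "w = c$1 - b$1" and "z = c$2 - b$2"
  have cross: "u * z = v * w" and dot: "u * w + v * z > 0"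
    using * by (simp_all add: u_def v_def w_def z_def)
  define n d where "n = u * u + v * v" and "d = u * w + v * z"
  have "n > 0"
    using dot unfolding n_def
    by (metis add_nonneg_pos add_pos_nonneg not_real_square_gt_zero zero_le_square mult_zero_left add_0 less_irrefl)
  have "d > 0" using dot by (simp add: d_def)
  have nw: "n * w = d * u" and nz: "n * z = d * v"
    using cross unfolding n_def d_def by algebra+
  \<comment> \<open>Then \<open>u = t * (u + w)\<close> and \<open>v = t * (v + z)\<close>, so \<open>t\<close> is the position of \<open>b\<close> on the segment.\<close>
  define t where "t = n / (n + d)"
  have t: "0 < t" "t < 1" using \<open>n > 0\<close> \<open>d > 0\<close> by (auto simp: t_def)
  have "(n + d) * u = n * (u + w)" "(n + d) * v = n * (v + z)"
    using nw nz by (simp_all add: algebra_simps)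
  then have "u = t * (u + w)" "v = t * (v + z)"
    using \<open>n > 0\<close> \<open>d > 0\<close> by (simp_all add: t_def field_simps)
  then have "b $ 1 = (1 - t) * a $ 1 + t * c $ 1" "b $ 2 = (1 - t) * a $ 2 + t * c $ 2"
    by (simp_all add: u_def v_def w_def z_def algebra_simps)
  then have b: "b = (1 - t) *\<^sub>R a + t *\<^sub>R c"
    by (simp add: vec_eq_iff forall_2)
  moreover have "a \<noteq> c"
  proof
    assume "a = c"
    then have "w = - u" "z = - v" by (simp_all add: u_def v_def w_def z_def)
    then have "d = - n" by (simp add: n_def d_def)
    then show False using \<open>n > 0\<close> \<open>d > 0\<close> by simp
  qed
  ultimately show "b \<in> open_segment a c" using t by (auto simp: in_segment)
qed

text \<open>
  Inverse to \<open>coords\<close> on each single vertex.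
\<close>

definition point_at :: "(nat \<Rightarrow> real) \<Rightarrow> nat \<Rightarrow> real^2" where
  "point_at z v = vector [z (2 * v), z (2 * v + 1)]"

lemma point_at_coords: "v < m \<Longrightarrow> point_at (coords m p) v = p v"
  by (simp add: point_at_def coords_def vec_eq_iff forall_2)

lemma coords_point_at:
  assumes "z \<in> Rn (2 * m)"
  shows "coords m (\<lambda>v\<in>{..<m}. point_at z v) = z"
proof
  fix l
  show "coords m (\<lambda>v\<in>{..<m}. point_at z v) l = z l"
  proof (cases "l < 2 * m")
    case True
    then have "l div 2 < m" by simp
    moreover have "even l \<Longrightarrow> 2 * (l div 2) = l" "odd l \<Longrightarrow> Suc (2 * (l div 2)) = l" by simp_all
    ultimately show ?thesis using True by (simp add: coords_def point_at_def)
  next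
    case False
    then show ?thesis using assms by (simp add: coords_def Rn_iff)
  qed
qed

section \<open>Strata of linkages\<close>

context triangle_linkage
begin

definition normal_form :: "realization \<Rightarrow> bool" where
  "normal_form q \<longleftrightarrow> q (tri 0 0) = 0 \<and> q (tri 0 1) = axis 1 1 \<and> q (tri 0 2) = axis 2 1"

lemma tri_less_num_vertices: "g \<le> G \<Longrightarrow> r < 3 \<Longrightarrow> tri g r < num_vertices"
  using tri_less[of g r] by (simp add: num_vertices_def)

lemma affine_class_configs:
  assumes "p \<in> configs" "q \<in> affine_class num_vertices p"
  shows "q \<in> configs"
proof -
  obtain A :: "real^2^2" and b where A: "invertible A" and q: "q = (\<lambda>i\<in>{..<num_vertices}. A *v p i + b)"
    using assms(2) unfolding mem_affine_class by blast
  have lp: "linked p" and cp: "config p" using assms(1) by (auto simp: configs_def)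
  have qv: "q v = A *v p v + b" if "v < num_vertices" for v using that by (simp add: q)
  have "base v < num_vertices" if "v < num_vertices" for v using base_less[OF that] by (simp add: num_vertices_def)
  then have "linked q"
    using lp by (simp add: linked_def qv)
  moreover have "config q"
    using cp affine_image_open_segment[OF A] affine_image_collinear[OF A]
    unfolding config_def by (auto simp: qv tri_less_num_vertices)
  moreover have "q \<in> topspace (realizations num_vertices)"
    by (auto simp: q topspace_realizations)
  ultimately show ?thesis by (simp add: configs_def)
qed

lemma configs_normal_form:
  assumes p: "p \<in> configs"
  obtains q where "q \<in> configs" "normal_form q" "affine_class num_vertices q = affine_class num_vertices p"
proof -
  have "\<not> collinear {p (tri 0 0), p (tri 0 1), p (tri 0 2)}"
    using p by (simp add: configs_def config_def)
  then obtain A :: "real^2^2" and d where A: "invertible A" "A *v p (tri 0 0) + d = 0"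
    "A *v p (tri 0 1) + d = axis 1 1" "A *v p (tri 0 2) + d = axis 2 1"
    by (rule affine_normalization)
  define q where "q = (\<lambda>i\<in>{..<num_vertices}. A *v p i + d)"
  have q: "q \<in> affine_class num_vertices p"
    unfolding mem_affine_class using A(1) q_def by blast
  have "normal_form q"
    using A by (simp add: normal_form_def q_def tri_less_num_vertices)
  moreover have "affine_class num_vertices q = affine_class num_vertices p"
    using q p by (intro affine_class_eq) (auto simp: configs_def)
  ultimately show thesis
    using that affine_class_configs[OF p q] by blast
qed

definition normal_configs :: "realization set" where
  "normal_configs = {q \<in> configs. normal_form q}"

lemma affine_class_normal_configs: "affine_class num_vertices ` configs = affine_class num_vertices ` normal_configs"
proof
  show "affine_class num_vertices ` configs \<subseteq> affine_class num_vertices ` normal_configs"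
  proof
    fix C assume "C \<in> affine_class num_vertices ` configs"
    then obtain p where p: "p \<in> configs" "C = affine_class num_vertices p" by blast
    obtain q where "q \<in> configs" "normal_form q" "affine_class num_vertices q = affine_class num_vertices p"
      using p(1) by (rule configs_normal_form)
    then show "C \<in> affine_class num_vertices ` normal_configs"
      unfolding normal_configs_def p(2) by (metis (mono_tags, lifting) imageI mem_Collect_eq)
  qed
qed (auto simp: normal_configs_def)

lemma Union_affine_class_configs: "\<Union> (affine_class num_vertices ` configs) = configs"
proof
  show "\<Union> (affine_class num_vertices ` configs) \<subseteq> configs"
    using affine_class_configs by blast
  show "configs \<subseteq> \<Union> (affine_class num_vertices ` configs)"
    using affine_class_self unfolding configs_def by blast
qed

text \<open>
  Every orbit contains a normalized configuration, so the class is a continuous image of the set of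
  normalized configurations; if that set is connected, the class has just one component.
\<close>

lemma stratum_configs:
  assumes "normal_configs \<noteq> {}" "connectedin (realizations num_vertices) normal_configs"
  shows "affine_class num_vertices ` configs \<in> strata num_vertices edges"
proof -
  let ?R = "affine_class num_vertices ` configs" and ?X = "realization_space num_vertices"
  obtain p where p: "p \<in> configs" using assms(1) by (auto simp: normal_configs_def)
  then have "p \<in> topspace (realizations num_vertices)" by (simp add: configs_def)
  have "connectedin ?X ?R"
    unfolding affine_class_normal_configs
    using quotient_imp_continuous_map[OF quotient_map_affine_class] assms(2)
    by (rule connectedin_continuous_map_image)
  then have conn: "connected_space (subtopology ?X ?R)" and sub: "?R \<subseteq> topspace ?X"
    by (auto simp: connectedin_def)
  have top: "topspace (subtopology ?X ?R) = ?R"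
    using sub by (simp add: inf_absorb2)
  moreover have "?R \<noteq> {}" using p by blast
  ultimately have "subtopology ?X ?R \<noteq> trivial_topology" by (metis null_topspace_iff_trivial)
  then have "?R \<in> connected_components_of (subtopology ?X (strong_class num_vertices edges p))"
    using connected_components_of_connected_space[OF conn] top
    by (simp add: strong_class_configs[OF p])
  then show ?thesis
    unfolding strata_def using \<open>p \<in> topspace (realizations num_vertices)\<close> by blast
qed

lemma affine_frame_configs:
  "affine_frame num_vertices (affine_class num_vertices ` configs) (tri 0 0) (tri 0 1) (tri 0 2)"
  unfolding affine_frame_def Union_affine_class_configs
proof (intro conjI ballI tri_less_num_vertices)
  fix p assume "p \<in> configs"
  then have "\<not> collinear {p (tri 0 0), p (tri 0 1), p (tri 0 2)}"
    by (simp add: configs_def config_def)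
  then show "card {p (tri 0 0), p (tri 0 1), p (tri 0 2)} = 3"
    "\<not> affine_dependent {p (tri 0 0), p (tri 0 1), p (tri 0 2)}"
    by (auto simp: collinear_3_eq_affine_dependent)
qed simp_all

lemma normalized_configs:
  "normalized num_vertices (affine_class num_vertices ` configs) (tri 0 0) (tri 0 1) (tri 0 2) = coords num_vertices ` normal_configs"
  unfolding normalized_def Union_affine_class_configs normal_configs_def normal_form_def by simp

lemma coords_normal_configs:
  "coords num_vertices ` normal_configs =
     {z \<in> Rn (2 * num_vertices). (\<forall>v<num_vertices. point_at z v = point_at z (base v)) \<and> normal_form (point_at z) \<and>
        (\<forall>g. 1 \<le> g \<and> g \<le> G \<longrightarrow> point_at z (tri g 1) \<in> open_segment (point_at z (tri g 0)) (point_at z (tri g 2)))}"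
  (is "_ = ?Z")
proof
  have base: "base v < num_vertices" if "v < num_vertices" for v using base_less[OF that] by (simp add: num_vertices_def)
  show "coords num_vertices ` normal_configs \<subseteq> ?Z"
  proof
    fix z assume "z \<in> coords num_vertices ` normal_configs"
    then obtain p where p: "p \<in> configs" "normal_form p" and z: "z = coords num_vertices p"
      by (auto simp: normal_configs_def)
    have pt: "point_at z v = p v" if "v < num_vertices" for v
      using that by (simp add: z point_at_coords)
    have "z \<in> Rn (2 * num_vertices)" by (simp add: z Rn_iff coords_def)
    moreover have "\<forall>v<num_vertices. point_at z v = point_at z (base v)"
      using p(1) base by (simp add: pt configs_def linked_def)
    moreover have "normal_form (point_at z)"
      using p(2) by (simp add: normal_form_def pt tri_less_num_vertices)
    moreover have "\<forall>g. 1 \<le> g \<and> g \<le> G \<longrightarrow>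
        point_at z (tri g 1) \<in> open_segment (point_at z (tri g 0)) (point_at z (tri g 2))"
      using p(1) by (simp add: pt configs_def config_def tri_less_num_vertices)
    ultimately show "z \<in> ?Z" by blast
  qed
  show "?Z \<subseteq> coords num_vertices ` normal_configs"
  proof
    fix z assume z: "z \<in> ?Z"
    let ?p = "\<lambda>v\<in>{..<num_vertices}. point_at z v"
    have nc: "\<not> collinear {0, axis 1 1, axis 2 1 :: real^2}"
      by (auto simp: collinear_lemma vec_eq_iff forall_2 axis_def)
    have "linked ?p"
      using z base by (simp add: linked_def)
    moreover have nf: "normal_form (point_at z)" and seg: "\<forall>g. 1 \<le> g \<and> g \<le> G \<longrightarrow>
        point_at z (tri g 1) \<in> open_segment (point_at z (tri g 0)) (point_at z (tri g 2))"
      using z by blast+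
    moreover have "normal_form ?p"
      using nf by (simp add: normal_form_def tri_less_num_vertices)
    moreover have "config ?p"
      using nf seg nc by (simp add: config_def normal_form_def tri_less_num_vertices)
    ultimately have "?p \<in> normal_configs"
      by (simp add: normal_configs_def configs_def topspace_realizations)
    then show "z \<in> coords num_vertices ` normal_configs"
      using coords_point_at[of z num_vertices] z by (metis (no_types, lifting) image_eqI mem_Collect_eq)
  qed
qed

lemma semialgebraic_normal_configs: "semialgebraic (2 * num_vertices) (coords num_vertices ` normal_configs)"
proof -
  let ?x = "\<lambda>v z. z (2 * v) :: real" and ?y = "\<lambda>v z. z (2 * v + 1) :: real"
  define I where "I = (\<lambda>v z. ?x v z - ?x (base v) z) ` {..<num_vertices} \<union> (\<lambda>v z. ?y v z - ?y (base v) z) ` {..<num_vertices} \<union>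
     {?x (tri 0 0), ?y (tri 0 0), \<lambda>z. ?x (tri 0 1) z - 1, ?y (tri 0 1), ?x (tri 0 2), \<lambda>z. ?y (tri 0 2) z - 1} \<union>
     (\<lambda>g z. (?x (tri g 1) z - ?x (tri g 0) z) * (?y (tri g 2) z - ?y (tri g 1) z) -
            (?y (tri g 1) z - ?y (tri g 0) z) * (?x (tri g 2) z - ?x (tri g 1) z)) ` {1..G}"
  define J where "J = (\<lambda>g z. (?x (tri g 1) z - ?x (tri g 0) z) * (?x (tri g 2) z - ?x (tri g 1) z) +
            (?y (tri g 1) z - ?y (tri g 0) z) * (?y (tri g 2) z - ?y (tri g 1) z)) ` {1..G}"
  have base: "base v < num_vertices" if "v < num_vertices" for v using base_less[OF that] by (simp add: num_vertices_def)
  have var: "rat_poly_fun (2 * num_vertices) (?x v)" "rat_poly_fun (2 * num_vertices) (?y v)" if "v < num_vertices" for v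
    using that by (auto intro!: rat_poly_fun_var)
  have t: "tri g 0 < num_vertices" "tri g 1 < num_vertices" "tri g 2 < num_vertices" if "g \<le> G" for g
    using that by (auto intro: tri_less_num_vertices)
  have one: "rat_poly_fun k (\<lambda>z. 1)" for k by (simp add: rat_poly_fun_const)
  show ?thesis
  proof (rule basic_semialgebraic[of I J])
    show "finite I" "finite J" by (simp_all add: I_def J_def)
    show "rat_poly_fun (2 * num_vertices) f" if "f \<in> I" for f
      using that unfolding I_def
      by (elim UnE imageE insertE emptyE)
         (auto intro!: rat_poly_fun_diff rat_poly_fun_mult var base t one simp del: One_nat_def add_Suc_right)
    show "rat_poly_fun (2 * num_vertices) f" if "f \<in> J" for f
      using that unfolding J_def
      by (elim UnE imageE insertE emptyE)
         (auto intro!: rat_poly_fun_add rat_poly_fun_diff rat_poly_fun_mult var t simp del: One_nat_def add_Suc_right)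
    show "coords num_vertices ` normal_configs = {z \<in> Rn (2 * num_vertices). (\<forall>f\<in>I. f z = 0) \<and> (\<forall>f\<in>J. f z > 0)}"
      unfolding coords_normal_configs I_def J_def normal_form_def open_segment_plane_iff
      by (auto simp: point_at_def vec_eq_iff forall_2 axis_def ball_Un)
  qed
qed

end

section \<open>Polynomials as differences of expressions with values above 1\<close>

datatype expr = One | Var nat | Add expr expr | Mul expr expr

fun val :: "(nat \<Rightarrow> real) \<Rightarrow> expr \<Rightarrow> real" where
  "val \<rho> One = 1"
| "val \<rho> (Var i) = \<rho> i"
| "val \<rho> (Add e f) = val \<rho> e + val \<rho> f"
| "val \<rho> (Mul e f) = val \<rho> e * val \<rho> f"

fun vars :: "expr \<Rightarrow> nat set" where
  "vars One = {}"
| "vars (Var i) = {i}"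
| "vars (Add e f) = vars e \<union> vars f"
| "vars (Mul e f) = vars e \<union> vars f"

text \<open>
  Products with 1 are excluded: a factor 1 would make two points coincide that the configuration for the
  product has to keep apart.
\<close>

fun wf_expr :: "expr \<Rightarrow> bool" where
  "wf_expr One = True"
| "wf_expr (Var i) = True"
| "wf_expr (Add e f) = (wf_expr e \<and> wf_expr f)"
| "wf_expr (Mul e f) = (wf_expr e \<and> wf_expr f \<and> e \<noteq> One \<and> f \<noteq> One)"

fun subexprs :: "expr \<Rightarrow> expr set" where
  "subexprs One = {One}"
| "subexprs (Var i) = {Var i}"
| "subexprs (Add e f) = insert (Add e f) (subexprs e \<union> subexprs f)"
| "subexprs (Mul e f) = insert (Mul e f) (subexprs e \<union> subexprs f)"

lemma finite_subexprs: "finite (subexprs e)"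
  by (induction e) auto

lemma subexprs_self: "e \<in> subexprs e"
  by (cases e) auto

lemma subexprs_closed: "Add f g \<in> subexprs e \<or> Mul f g \<in> subexprs e \<Longrightarrow> f \<in> subexprs e \<and> g \<in> subexprs e"
  by (induction e) (auto simp: subexprs_self)

lemma subexprs_wf: "wf_expr e \<Longrightarrow> f \<in> subexprs e \<Longrightarrow> wf_expr f \<and> vars f \<subseteq> vars e"
  by (induction e) auto

lemma val_ge_1:
  assumes "wf_expr e" "\<And>i. i \<in> vars e \<Longrightarrow> \<rho> i > 1"
  shows "(e \<noteq> One \<longrightarrow> val \<rho> e > 1) \<and> val \<rho> e \<ge> 1"
  using assms
proof (induction e)
  case (Mul e f)
  then have "val \<rho> e > 1" "val \<rho> f > 1" by auto
  then show ?case using less_1_mult by fastforce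
qed force+

lemma val_cong: "(\<And>i. i \<in> vars e \<Longrightarrow> \<rho> i = \<rho>' i) \<Longrightarrow> val \<rho> e = val \<rho>' e"
  by (induction e) auto

text \<open>
  The first \<open>n\<close> coordinates of \<open>\<omega>\<close> stand for \<open>x\<close>, the next \<open>n\<close> for \<open>z\<close>.  The environment assigns
  \<open>y i = x i + z i\<close> to the variable \<open>i\<close> and \<open>z i\<close> to the variable \<open>n + i\<close>.
\<close>

definition split_env :: "nat \<Rightarrow> (nat \<Rightarrow> real) \<Rightarrow> nat \<Rightarrow> real" where
  "split_env n \<omega> j = (if j < n then \<omega> j + \<omega> (n + j) else \<omega> j)"

definition admissible :: "nat \<Rightarrow> expr \<Rightarrow> bool" where
  "admissible n e \<longleftrightarrow> wf_expr e \<and> e \<noteq> One \<and> vars e \<subseteq> {..<2 * n}"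

text \<open>
  The factor \<open>d\<close> clears the denominators of rational coefficients.  It is an expression rather than a
  number so that it can itself occur in the products that put sums over a common denominator; it does not
  affect signs, being positive whenever all variables exceed 1.
\<close>

definition expressible :: "nat \<Rightarrow> ((nat \<Rightarrow> real) \<Rightarrow> real) \<Rightarrow> bool" where
  "expressible n f \<longleftrightarrow> (\<exists>d e1 e2. admissible n d \<and> admissible n e1 \<and> admissible n e2 \<and>
     (\<forall>\<omega>. val (split_env n \<omega>) d * f \<omega> = val (split_env n \<omega>) e1 - val (split_env n \<omega>) e2))"

lemma expressible_add:
  assumes "expressible n f" "expressible n g"
  shows "expressible n (\<lambda>x. f x + g x)"
proof -
  from assms obtain d e1 e2 d' e1' e2' where
    *: "admissible n d" "admissible n e1" "admissible n e2" "admissible n d'" "admissible n e1'" "admissible n e2'"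
    "\<And>\<omega>. val (split_env n \<omega>) d * f \<omega> = val (split_env n \<omega>) e1 - val (split_env n \<omega>) e2"
    "\<And>\<omega>. val (split_env n \<omega>) d' * g \<omega> = val (split_env n \<omega>) e1' - val (split_env n \<omega>) e2'"
    unfolding expressible_def by blast
  show ?thesis
    unfolding expressible_def
  proof (intro exI conjI allI)
    fix \<omega>
    let ?v = "val (split_env n \<omega>)"
    have "?v d * ?v d' * (f \<omega> + g \<omega>) = ?v d' * (?v d * f \<omega>) + ?v d * (?v d' * g \<omega>)"
      by (simp add: algebra_simps)
    then show "?v (Mul d d') * (f \<omega> + g \<omega>) =
       ?v (Add (Mul d' e1) (Mul d e1')) - ?v (Add (Mul d' e2) (Mul d e2'))"
      unfolding *(7,8) by (simp add: algebra_simps)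
  qed (use * in \<open>auto simp: admissible_def\<close>)
qed

lemma expressible_mult:
  assumes "expressible n f" "expressible n g"
  shows "expressible n (\<lambda>x. f x * g x)"
proof -
  from assms obtain d e1 e2 d' e1' e2' where
    *: "admissible n d" "admissible n e1" "admissible n e2" "admissible n d'" "admissible n e1'" "admissible n e2'"
    "\<And>\<omega>. val (split_env n \<omega>) d * f \<omega> = val (split_env n \<omega>) e1 - val (split_env n \<omega>) e2"
    "\<And>\<omega>. val (split_env n \<omega>) d' * g \<omega> = val (split_env n \<omega>) e1' - val (split_env n \<omega>) e2'"
    unfolding expressible_def by blast
  show ?thesis
    unfolding expressible_def
  proof (intro exI conjI allI)
    fix \<omega>
    let ?v = "val (split_env n \<omega>)"
    have "?v d * ?v d' * (f \<omega> * g \<omega>) = (?v d * f \<omega>) * (?v d' * g \<omega>)"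
      by (simp add: algebra_simps)
    then show "?v (Mul d d') * (f \<omega> * g \<omega>) =
       ?v (Add (Mul e1 e1') (Mul e2 e2')) - ?v (Add (Mul e1 e2') (Mul e2 e1'))"
      unfolding *(7,8) by (simp add: algebra_simps)
  qed (use * in \<open>auto simp: admissible_def\<close>)
qed

fun nat_expr :: "nat \<Rightarrow> expr" where
  "nat_expr 0 = One"
| "nat_expr (Suc k) = Add One (nat_expr k)"

lemma val_nat_expr: "val \<rho> (nat_expr k) = real k + 1"
  by (induction k) auto

lemma admissible_nat_expr: "admissible n (nat_expr (Suc k))"
proof -
  have "wf_expr (nat_expr k) \<and> vars (nat_expr k) = {}" by (induction k) auto
  then show ?thesis by (simp add: admissible_def)
qed

text \<open>
  For \<open>c = a / b\<close> the factor is \<open>2 * b\<close> and not \<open>b\<close>, and the numerator is the difference of the positive and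
  negative parts of \<open>2 * a\<close>, each increased by 2.  All three numbers are then at least 2, so none of them is
  represented by the forbidden factor \<open>One\<close>.
\<close>

lemma expressible_const:
  assumes "c \<in> \<rat>" shows "expressible n (\<lambda>x. c)"
proof -
  obtain a b where ab: "b > 0" "c = of_int a / of_int b"
    using assms by (rule Rats_cases')
  \<comment> \<open>The numeral \<open>nat_expr (Suc k)\<close> has the value \<open>k + 2 = 2 * b\<close>.\<close>
  define k where "k = nat (b + b) - 2"
  have k: "real (Suc k) + 1 = 2 * of_int b" using ab(1) by (auto simp: k_def)
  have "(real (Suc k) + 1) * c = (real (Suc (nat (2 * a))) + 1) - (real (Suc (nat (- 2 * a))) + 1)"
    unfolding k ab(2) using ab(1) by simp
  then show ?thesis
    unfolding expressible_def val_nat_expr[symmetric] using admissible_nat_expr by (metis val_nat_expr)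
qed

lemma expressible_var:
  assumes "i < n" shows "expressible n (\<lambda>x. x i)"
  unfolding expressible_def
proof (intro exI conjI allI)
  show "val (split_env n \<omega>) (nat_expr (Suc 0)) * \<omega> i =
    val (split_env n \<omega>) (Add (Var i) (Var i)) - val (split_env n \<omega>) (Add (Var (n + i)) (Var (n + i)))" for \<omega>
    using assms by (simp add: split_env_def)
  show "admissible n (nat_expr (Suc 0))" by (rule admissible_nat_expr)
qed (use assms in \<open>auto simp: admissible_def\<close>)

lemma expressible_sum: "(\<And>i. i \<in> I \<Longrightarrow> expressible n (f i)) \<Longrightarrow> expressible n (\<lambda>x. \<Sum>i\<in>I. f i x)"
  by (induction I rule: infinite_finite_induct) (auto intro: expressible_const expressible_add)

lemma expressible_prod: "(\<And>i. i \<in> I \<Longrightarrow> expressible n (f i)) \<Longrightarrow> expressible n (\<lambda>x. \<Prod>i\<in>I. f i x)"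
  by (induction I rule: infinite_finite_induct) (auto intro: expressible_const expressible_mult)

lemma expressible_power: "expressible n f \<Longrightarrow> expressible n (\<lambda>x. f x ^ k)"
  by (induction k) (auto intro: expressible_const expressible_mult)

lemma expressible_poly:
  assumes "p \<in> polys \<rat> n" shows "expressible n (eval_poly p)"
  unfolding eval_poly_def[abs_def]
  using assms by (auto simp: polys_def intro!: expressible_sum expressible_mult expressible_prod
      expressible_power expressible_const expressible_var)

section \<open>A projective chart of the plane\<close>

text \<open>
  In the chart the point \<open>(u, v)\<close> of the first quadrant is drawn at the image under a projective map that sends
  the closed projective quadrant onto the triangle with corners \<open>0\<close>, \<open>(1, 0)\<close> and \<open>(0, 1)\<close>.  The positive numbers
  \<open>\<tau>\<close> and \<open>h\<close> are the scales of the two axes.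
\<close>

definition finite_pt :: "real \<Rightarrow> real \<Rightarrow> real \<Rightarrow> real \<Rightarrow> real^2" where
  "finite_pt \<tau> h u v = vector [\<tau> * u / (1 + \<tau> * u + h * v), h * v / (1 + \<tau> * u + h * v)]"

text \<open>
  The image of the point at infinity in direction \<open>(a, b)\<close>.
\<close>

definition infinite_pt :: "real \<Rightarrow> real \<Rightarrow> real \<Rightarrow> real \<Rightarrow> real^2" where
  "infinite_pt \<tau> h a b = vector [\<tau> * a / (\<tau> * a + h * b), h * b / (\<tau> * a + h * b)]"

lemma finite_pt_inject:
  assumes "\<tau> > 0" "h > 0" "u \<ge> 0" "v \<ge> 0" "u' \<ge> 0" "v' \<ge> 0" "finite_pt \<tau> h u v = finite_pt \<tau> h u' v'"
  shows "u = u' \<and> v = v'"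
proof -
  define s s' where "s = 1 + \<tau> * u + h * v" and "s' = 1 + \<tau> * u' + h * v'"
  have s: "s > 0" "s' > 0" using assms(1-6) by (auto simp: s_def s'_def add_pos_nonneg)
  have e: "\<tau> * u / s = \<tau> * u' / s'" "h * v / s = h * v' / s'"
    using assms(7) by (auto simp: finite_pt_def s_def s'_def vec_eq_iff forall_2)
  have "1 / s = 1 - \<tau> * u / s - h * v / s" "1 / s' = 1 - \<tau> * u' / s' - h * v' / s'"
    using s by (simp_all add: s_def s'_def field_simps)
  then have "1 / s = 1 / s'" using e by simp
  then have "s = s'" by simp
  then show ?thesis using e assms(1,2) s by simp
qed

text \<open>
  A projective map that is defined on a whole segment preserves betweenness; in the quadrant, the points
  between \<open>(u, v)\<close> and infinity are those on the ray in the given direction.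
\<close>

lemma open_segment_finite_infinite:
  assumes "\<tau> > 0" "h > 0" "u \<ge> 0" "v \<ge> 0" "\<tau> * a + h * b > 0"
  shows "q \<in> open_segment (finite_pt \<tau> h u v) (infinite_pt \<tau> h a b) \<longleftrightarrow>
    (\<exists>\<beta>>0. q = finite_pt \<tau> h (u + \<beta> * a) (v + \<beta> * b))"
proof -
  define s where "s = 1 + \<tau> * u + h * v"
  define d where "d = \<tau> * a + h * b"
  have s: "s > 0" using assms(1-4) by (auto simp: s_def add_pos_nonneg)
  have d: "d > 0" using assms by (simp add: d_def)
  let ?P = "finite_pt \<tau> h u v" and ?R = "infinite_pt \<tau> h a b"
  have "?P \<noteq> ?R"
  proof
    assume eq: "?P = ?R"
    have "?P $ 1 + ?P $ 2 = (\<tau> * u + h * v) / s" "?R $ 1 + ?R $ 2 = d / d"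
      by (simp_all add: finite_pt_def infinite_pt_def s_def d_def flip: add_divide_distrib)
    then have "(\<tau> * u + h * v) / s = 1" using d unfolding eq by simp
    then show False using s by (simp add: s_def)
  qed
  \<comment> \<open>The segment parameter \<open>t\<close> and the ray parameter \<open>\<beta>\<close> are related by a projective change of parameter.\<close>
  have key: "(1 - t) *\<^sub>R ?P + t *\<^sub>R ?R = finite_pt \<tau> h (u + \<beta> * a) (v + \<beta> * b)"
    if "t < 1" "\<beta> = t * s / ((1 - t) * d)" for t \<beta>
  proof -
    have "1 + \<tau> * (u + \<beta> * a) + h * (v + \<beta> * b) = s + \<beta> * d"
      by (simp add: s_def d_def algebra_simps)
    also have "\<beta> * d = t * s / (1 - t)"
      using d by (simp add: that(2))
    also have "s + t * s / (1 - t) = s / (1 - t)"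
      using that(1) by (simp add: field_simps)
    finally have den: "1 + \<tau> * (u + \<beta> * a) + h * (v + \<beta> * b) = s / (1 - t)" .
    have \<beta>: "\<beta> * (1 - t) / s = t / d"
      using that(1) s by (simp add: that(2))
    have "c * (x + \<beta> * y) / (s / (1 - t)) = (1 - t) * (c * x / s) + t * (c * y / d)" for c x y
    proof -
      have "c * (x + \<beta> * y) / (s / (1 - t)) = (1 - t) * (c * x / s) + (\<beta> * (1 - t) / s) * (c * y)"
        by (simp add: algebra_simps add_divide_distrib diff_divide_distrib)
      then show ?thesis unfolding \<beta> by simp
    qed
    then show ?thesis
      unfolding finite_pt_def den infinite_pt_def
      by (simp add: vec_eq_iff forall_2 s_def[symmetric] d_def[symmetric])
  qed
  show ?thesis
  proof
    assume "q \<in> open_segment ?P ?R"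
    then obtain t where t: "0 < t" "t < 1" "q = (1 - t) *\<^sub>R ?P + t *\<^sub>R ?R"
      by (auto simp: in_segment)
    have "t * s / ((1 - t) * d) > 0" using t s d by simp
    then show "\<exists>\<beta>>0. q = finite_pt \<tau> h (u + \<beta> * a) (v + \<beta> * b)"
      using key[OF t(2) refl] t(3) by metis
  next
    assume "\<exists>\<beta>>0. q = finite_pt \<tau> h (u + \<beta> * a) (v + \<beta> * b)"
    then obtain \<beta> where \<beta>: "\<beta> > 0" "q = finite_pt \<tau> h (u + \<beta> * a) (v + \<beta> * b)" by blast
    define t where "t = \<beta> * d / (s + \<beta> * d)"
    have pos: "\<beta> * d > 0" "s + \<beta> * d > 0" using \<beta> d s by (simp_all add: add_pos_pos)
    have t: "0 < t" "t < 1" using pos s by (simp_all add: t_def)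
    have "1 - t = s / (s + \<beta> * d)" using pos by (simp add: t_def field_simps)
    then have "\<beta> = t * s / ((1 - t) * d)"
      using pos s d by (simp add: t_def)
    then have "q = (1 - t) *\<^sub>R ?P + t *\<^sub>R ?R" using key[OF t(2)] \<beta>(2) by simp
    then show "q \<in> open_segment ?P ?R"
      using \<open>?P \<noteq> ?R\<close> t by (auto simp: in_segment)
  qed
qed

lemma finite_pt_zero: "finite_pt \<tau> h 0 0 = 0"
  by (simp add: finite_pt_def vec_eq_iff forall_2)

lemma infinite_pt_axes:
  "\<tau> > 0 \<Longrightarrow> infinite_pt \<tau> h 1 0 = axis 1 1" "h > 0 \<Longrightarrow> infinite_pt \<tau> h 0 1 = axis 2 1"
  by (simp_all add: infinite_pt_def vec_eq_iff forall_2 axis_def)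

lemma open_segment_from_origin:
  assumes "\<tau> > 0" "h > 0" "u \<ge> 0" "u' \<ge> 0" "v' > 0"
  shows "finite_pt \<tau> h u 1 \<in> open_segment 0 (finite_pt \<tau> h u' v') \<longleftrightarrow> u' = u * v' \<and> v' > 1"
proof -
  define s s' where "s = 1 + \<tau> * u + h" and "s' = 1 + \<tau> * u' + h * v'"
  have s: "s > 0" "s' > 0" using assms by (auto simp: s_def s'_def add_pos_nonneg add_nonneg_pos)
  let ?P = "finite_pt \<tau> h u 1" and ?R = "finite_pt \<tau> h u' v'"
  have P: "?P = vector [\<tau> * u / s, h / s]" and R: "?R = vector [\<tau> * u' / s', h * v' / s']"
    by (simp_all add: finite_pt_def s_def s'_def)
  have "0 \<noteq> ?R" using assms s by (auto simp: R vec_eq_iff forall_2)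
  then have "?P \<in> open_segment 0 ?R \<longleftrightarrow> (\<exists>t. 0 < t \<and> t < 1 \<and> \<tau> * u / s = t * (\<tau> * u' / s') \<and> h / s = t * (h * v' / s'))"
    by (auto simp: in_segment P R vec_eq_iff forall_2)
  also have "\<dots> \<longleftrightarrow> (\<exists>t. 0 < t \<and> t < 1 \<and> u / s = t * u' / s' \<and> 1 / s = t * v' / s')"
  proof -
    have "c * x / s = t * (c * y / s') \<longleftrightarrow> x / s = t * y / s'" if "c > 0" for c x y t
    proof -
      have "c * x / s = c * (x / s)" "t * (c * y / s') = c * (t * y / s')" by simp_all
      then show ?thesis using that by (simp only: mult_cancel_left) simp
    qed
    from this[OF assms(1), of u _ u'] this[OF assms(2), of 1 _ v'] show ?thesis by simp
  qed
  also have "\<dots> \<longleftrightarrow> u' = u * v' \<and> v' > 1"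
  proof
    assume "\<exists>t. 0 < t \<and> t < 1 \<and> u / s = t * u' / s' \<and> 1 / s = t * v' / s'"
    then obtain t where t: "0 < t" "t < 1" and e: "u / s = t * u' / s'" "1 / s = t * v' / s'" by blast
    have "u * (1 / s) = t * u' / s'" using e(1) by simp
    then have u': "u' = u * v'" unfolding e(2) using t s by (simp add: field_simps)
    have "s' = t * v' * s" using e(2) s by (simp add: field_simps)
    then have "1 + v' * (s - 1) = t * v' * s"
      unfolding s'_def u' by (simp add: s_def algebra_simps)
    moreover have "t * v' * s < v' * s" using t s assms(5) by simp
    ultimately have "v' > 1" by (simp add: algebra_simps)
    then show "u' = u * v' \<and> v' > 1" using u' by blast
  next
    assume *: "u' = u * v' \<and> v' > 1"
    define t where "t = s' / (s * v')"
    have "s' = 1 + v' * (s - 1)" using * by (simp add: s_def s'_def algebra_simps)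
    also have "\<dots> < s * v'" using * by (simp add: algebra_simps)
    finally have "0 < t" "t < 1" using s assms(5) by (simp_all add: t_def)
    moreover have "u / s = t * u' / s'" "1 / s = t * v' / s'"
      using s * assms(5) by (simp_all add: t_def)
    ultimately show "\<exists>t. 0 < t \<and> t < 1 \<and> u / s = t * u' / s' \<and> 1 / s = t * v' / s'" by blast
  qed
  finally show ?thesis .
qed

section \<open>Betweenness conditions that carry out arithmetic\<close>

text \<open>
  The origin, the points at infinity in horizontal, vertical and diagonal direction, and auxiliary points.
  For subexpressions with values \<open>a\<close> and \<open>b\<close> the auxiliary points have quadrant coordinates \<open>(a, 0)\<close>, \<open>(a, a)\<close>, \<open>(a, 1)\<close>,
  \<open>(a + b, b)\<close> and \<open>(a * b, a)\<close>.
\<close>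

datatype pt = Org | InfX | InfY | InfD | Axis expr | Diag expr | Row expr | SumPt expr expr | ProdPt expr expr

fun place :: "real \<Rightarrow> real \<Rightarrow> (nat \<Rightarrow> real) \<Rightarrow> pt \<Rightarrow> real^2" where
  "place \<tau> h \<rho> Org = finite_pt \<tau> h 0 0"
| "place \<tau> h \<rho> InfX = infinite_pt \<tau> h 1 0"
| "place \<tau> h \<rho> InfY = infinite_pt \<tau> h 0 1"
| "place \<tau> h \<rho> InfD = infinite_pt \<tau> h 1 1"
| "place \<tau> h \<rho> (Axis e) = finite_pt \<tau> h (val \<rho> e) 0"
| "place \<tau> h \<rho> (Diag e) = finite_pt \<tau> h (val \<rho> e) (val \<rho> e)"
| "place \<tau> h \<rho> (Row e) = finite_pt \<tau> h (val \<rho> e) 1"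
| "place \<tau> h \<rho> (SumPt e f) = finite_pt \<tau> h (val \<rho> e + val \<rho> f) (val \<rho> f)"
| "place \<tau> h \<rho> (ProdPt e f) = finite_pt \<tau> h (val \<rho> e * val \<rho> f) (val \<rho> e)"

text \<open>
  Each triple lists an outer point, the point in between, and the other outer point.  The point \<open>(a + b, b)\<close> is the
  intersection of the diagonal line through \<open>(a, 0)\<close> and the horizontal line through \<open>(b, b)\<close>, and \<open>(a * b, a)\<close> that
  of the line from the origin through \<open>(b, 1)\<close> and the horizontal line through \<open>(a, a)\<close>; the vertical line below
  such an intersection marks the result on the axis.  None of the triples for a sum or a product compares \<open>a\<close> with \<open>b\<close>,
  whose order may change within the set to be encoded.
\<close>

inductive_set betweenness :: "expr set \<Rightarrow> (expr \<times> expr) set \<Rightarrow> (pt \<times> pt \<times> pt) set"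
  for S L where
  infinite: "(InfX, InfD, InfY) \<in> betweenness S L"
| unit: "(Org, Axis One, InfX) \<in> betweenness S L"
| vertical_diag: "e \<in> S \<Longrightarrow> (Axis e, Diag e, InfY) \<in> betweenness S L"
| diagonal: "e \<in> S \<Longrightarrow> (Org, Diag e, InfD) \<in> betweenness S L"
| beyond_unit: "e \<in> S \<Longrightarrow> e \<noteq> One \<Longrightarrow> (Axis One, Axis e, InfX) \<in> betweenness S L"
| vertical_row: "e \<in> S \<Longrightarrow> e \<noteq> One \<Longrightarrow> (Axis e, Row e, InfY) \<in> betweenness S L"
| horizontal_row: "e \<in> S \<Longrightarrow> e \<noteq> One \<Longrightarrow> (Diag One, Row e, InfX) \<in> betweenness S L"
| sum_parallel: "Add e f \<in> S \<Longrightarrow> (Axis e, SumPt e f, InfD) \<in> betweenness S L"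
| sum_horizontal: "Add e f \<in> S \<Longrightarrow> (Diag f, SumPt e f, InfX) \<in> betweenness S L"
| sum_vertical: "Add e f \<in> S \<Longrightarrow> (Axis (Add e f), SumPt e f, InfY) \<in> betweenness S L"
| prod_ray: "Mul e f \<in> S \<Longrightarrow> (Org, Row f, ProdPt e f) \<in> betweenness S L"
| prod_horizontal: "Mul e f \<in> S \<Longrightarrow> (Diag e, ProdPt e f, InfX) \<in> betweenness S L"
| prod_vertical: "Mul e f \<in> S \<Longrightarrow> (Axis (Mul e f), ProdPt e f, InfY) \<in> betweenness S L"
| less: "(e, f) \<in> L \<Longrightarrow> (Axis e, Axis f, InfX) \<in> betweenness S L"

text \<open>
  A point occurs here only if the triples determine it; the position of any other point would be a spurious
  degree of freedom.
\<close>

definition points :: "expr set \<Rightarrow> pt set" where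
  "points S = {Org, InfX, InfY, InfD} \<union> Axis ` S \<union> Diag ` S \<union> Row ` (S - {One}) \<union>
     {SumPt e f | e f. Add e f \<in> S} \<union> {ProdPt e f | e f. Mul e f \<in> S}"

lemma points_iff:
  "Org \<in> points S" "InfX \<in> points S" "InfY \<in> points S" "InfD \<in> points S"
  "Axis e \<in> points S \<longleftrightarrow> e \<in> S" "Diag e \<in> points S \<longleftrightarrow> e \<in> S"
  "Row e \<in> points S \<longleftrightarrow> e \<in> S \<and> e \<noteq> One"
  "SumPt e f \<in> points S \<longleftrightarrow> Add e f \<in> S" "ProdPt e f \<in> points S \<longleftrightarrow> Mul e f \<in> S"
  by (auto simp: points_def)

text \<open>
  The set \<open>S\<close> contains all expressions whose values are marked on the axis, and \<open>L\<close> the pairs whose values are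
  required to increase.
\<close>

locale expr_system =
  fixes n :: nat and S :: "expr set" and L :: "(expr \<times> expr) set"
  assumes finite_S: "finite S" and One_S: "One \<in> S" and Var_S: "\<And>i. i < 2 * n \<Longrightarrow> Var i \<in> S"
    and closed_S: "\<And>e f. Add e f \<in> S \<or> Mul e f \<in> S \<Longrightarrow> e \<in> S \<and> f \<in> S"
    and wf_S: "\<And>e. e \<in> S \<Longrightarrow> wf_expr e" and vars_S: "\<And>e. e \<in> S \<Longrightarrow> vars e \<subseteq> {..<2 * n}"
    and L_S: "L \<subseteq> S \<times> S"
begin

lemma Add_S: "Add e f \<in> S \<Longrightarrow> e \<in> S \<and> f \<in> S"
  using closed_S by blast

lemma Mul_S: "Mul e f \<in> S \<Longrightarrow> e \<in> S \<and> f \<in> S \<and> e \<noteq> One \<and> f \<noteq> One"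
  using closed_S[of e f] wf_S[of "Mul e f"] by auto

lemma finite_points: "finite (points S)"
proof -
  have sub1: "{SumPt e f | e f. Add e f \<in> S} \<subseteq> (\<lambda>(e, f). SumPt e f) ` (S \<times> S)"
    by (auto dest: Add_S)
  have sub2: "{ProdPt e f | e f. Mul e f \<in> S} \<subseteq> (\<lambda>(e, f). ProdPt e f) ` (S \<times> S)"
    by (auto dest: Mul_S)
  have fin: "finite {SumPt e f | e f. Add e f \<in> S}" "finite {ProdPt e f | e f. Mul e f \<in> S}"
    by (rule finite_subset[OF sub1] finite_subset[OF sub2], simp add: finite_S)+
  show ?thesis
    unfolding points_def by (intro finite_UnI finite_imageI finite_Diff finite.intros finite_S fin)
qed

lemma betweenness_points: "betweenness S L \<subseteq> points S \<times> points S \<times> points S"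
proof
  fix x assume x: "x \<in> betweenness S L"
  obtain a b c where abc: "x = (a, b, c)" by (rule prod_cases3)
  have "a \<in> points S \<and> b \<in> points S \<and> c \<in> points S"
    using x[unfolded abc] by cases (use L_S in \<open>auto simp: points_iff One_S dest: Add_S Mul_S\<close>)
  then show "x \<in> points S \<times> points S \<times> points S" by (simp add: abc)
qed

lemma finite_betweenness: "finite (betweenness S L)"
  by (rule finite_subset[OF betweenness_points]) (intro finite_SigmaI finite_points)

definition realizes :: "(pt \<Rightarrow> real^2) \<Rightarrow> bool" where
  "realizes P \<longleftrightarrow> P Org = 0 \<and> P InfX = axis 1 1 \<and> P InfY = axis 2 1 \<and>
     (\<forall>(a, b, c)\<in>betweenness S L. P b \<in> open_segment (P a) (P c))"

text \<open>
  Apart from the triple at infinity and the multiplication triple that starts at the origin, every triple moves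
  a point by a positive amount towards a point at infinity; the exceptional multiplication triple is a dilation
  by the first factor, which exceeds 1.
\<close>

lemma realizes_place:
  assumes pos: "\<tau> > 0" "h > 0" and env: "\<And>i. i < 2 * n \<Longrightarrow> \<rho> i > 1"
    and lt: "\<And>e f. (e, f) \<in> L \<Longrightarrow> val \<rho> e < val \<rho> f"
  shows "realizes (place \<tau> h \<rho>)"
proof -
  have gt1: "val \<rho> e > 1" if "e \<in> S" "e \<noteq> One" for e
    using val_ge_1[OF wf_S[OF that(1)], of \<rho>] vars_S[OF that(1)] env that(2) by blast
  have ge1: "val \<rho> e \<ge> 1" if "e \<in> S" for e
    using gt1[OF that] by (cases "e = One") auto
  have ge0: "val \<rho> e \<ge> 0" if "e \<in> S" for e
    using ge1[OF that] by simp
  have seg: "finite_pt \<tau> h u' v' \<in> open_segment (finite_pt \<tau> h u v) (infinite_pt \<tau> h a b)"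
    if "u \<ge> 0" "v \<ge> 0" "a \<ge> 0" "b \<ge> 0" "a + b > 0" "\<beta> > 0" "u' = u + \<beta> * a" "v' = v + \<beta> * b" for u v u' v' a b \<beta>
  proof -
    have "\<tau> * a + h * b > 0"
      using that(3-5) pos by (cases "a = 0") (auto simp: add_pos_nonneg)
    then show ?thesis
      using open_segment_finite_infinite[OF pos that(1,2)] that(6-8) by blast
  qed
  have InfD: "infinite_pt \<tau> h 1 1 \<in> open_segment (axis 1 1) (axis 2 1)"
  proof -
    define t where "t = h / (\<tau> + h)"
    have t: "0 < t" "t < 1" using pos by (simp_all add: t_def)
    have "1 - t = \<tau> / (\<tau> + h)" using pos by (simp add: t_def field_simps)
    then have "infinite_pt \<tau> h 1 1 = (1 - t) *\<^sub>R axis 1 1 + t *\<^sub>R axis 2 1"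
      by (simp add: infinite_pt_def vec_eq_iff forall_2 axis_def t_def)
    moreover have "axis 1 1 \<noteq> (axis 2 1 :: real^2)"
      by (simp add: vec_eq_iff forall_2 axis_def)
    ultimately show ?thesis using t by (auto simp: in_segment)
  qed
  have "place \<tau> h \<rho> b \<in> open_segment (place \<tau> h \<rho> a) (place \<tau> h \<rho> c)" if "(a, b, c) \<in> betweenness S L" for a b c
    using that
  proof cases
    case infinite
    then show ?thesis using InfD pos by (simp add: infinite_pt_axes)
  next
    case unit
    then show ?thesis using seg[of 0 0 1 0 1] by simp
  next
    case (vertical_diag e)
    then show ?thesis using ge1[of e] seg[of "val \<rho> e" 0 0 1 "val \<rho> e"] by simp
  next
    case (diagonal e)
    then show ?thesis using ge1[of e] seg[of 0 0 1 1 "val \<rho> e"] by simp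
  next
    case (beyond_unit e)
    then show ?thesis using gt1[of e] seg[of 1 0 1 0 "val \<rho> e - 1"] by simp
  next
    case (vertical_row e)
    then show ?thesis using gt1[of e] seg[of "val \<rho> e" 0 0 1 1] by simp
  next
    case (horizontal_row e)
    then show ?thesis using gt1[of e] seg[of 1 1 1 0 "val \<rho> e - 1"] by simp
  next
    case (sum_parallel e f)
    then show ?thesis using Add_S[of e f] ge1[of e] ge1[of f] seg[of "val \<rho> e" 0 1 1 "val \<rho> f"] by simp
  next
    case (sum_horizontal e f)
    then show ?thesis using Add_S[of e f] ge1[of e] ge1[of f] seg[of "val \<rho> f" "val \<rho> f" 1 0 "val \<rho> e"]
      by (simp add: add.commute)
  next
    case (sum_vertical e f)
    then show ?thesis using Add_S[of e f] ge1[of e] ge1[of f] seg[of "val \<rho> e + val \<rho> f" 0 0 1 "val \<rho> f"] by simp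
  next
    case (prod_ray e f)
    then show ?thesis
      using Mul_S[of e f] gt1[of e] gt1[of f]
        open_segment_from_origin[OF pos, of "val \<rho> f" "val \<rho> e * val \<rho> f" "val \<rho> e"]
      by (simp add: finite_pt_zero)
  next
    case (prod_horizontal e f)
    then have "val \<rho> e > 1" "val \<rho> f > 1" using Mul_S[of e f] gt1 by simp_all
    then show ?thesis
      using prod_horizontal seg[of "val \<rho> e" "val \<rho> e" 1 0 "val \<rho> e * val \<rho> f - val \<rho> e"] by simp
  next
    case (prod_vertical e f)
    then show ?thesis
      using Mul_S[of e f] gt1[of e] gt1[of f] seg[of "val \<rho> e * val \<rho> f" 0 0 1 "val \<rho> e"] by simp
  next
    case (less e f)
    then have "val \<rho> e \<ge> 0" using L_S ge0 by blast
    then show ?thesis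
      using lt[of e f] less seg[of "val \<rho> e" 0 1 0 "val \<rho> f - val \<rho> e"] by simp
  qed
  then show ?thesis
    using pos by (auto simp: realizes_def finite_pt_zero infinite_pt_axes)
qed

text \<open>
  The unit point determines \<open>\<tau>\<close>, the diagonal direction then determines \<open>h\<close>, and inverting the chart on the axis
  gives back the values of the expressions.
\<close>

definition scale_of :: "(pt \<Rightarrow> real^2) \<Rightarrow> real" where
  "scale_of P = P (Axis One) $ 1 / (1 - P (Axis One) $ 1)"

definition height_of :: "(pt \<Rightarrow> real^2) \<Rightarrow> real" where
  "height_of P = scale_of P * (1 - P InfD $ 1) / P InfD $ 1"

definition coord_of :: "(pt \<Rightarrow> real^2) \<Rightarrow> expr \<Rightarrow> real" where
  "coord_of P e = P (Axis e) $ 1 / (scale_of P * (1 - P (Axis e) $ 1))"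

lemma readout_place:
  assumes "\<tau> > 0" "h > 0"
  shows "scale_of (place \<tau> h \<rho>) = \<tau>" "height_of (place \<tau> h \<rho>) = h"
    "val \<rho> e \<ge> 0 \<Longrightarrow> coord_of (place \<tau> h \<rho>) e = val \<rho> e"
proof -
  have one: "1 - x / (1 + x) = 1 / (1 + x)" if "x \<ge> 0" for x :: real
    using that by (simp add: field_simps)
  show s: "scale_of (place \<tau> h \<rho>) = \<tau>"
    using assms by (simp add: scale_of_def finite_pt_def one)
  show "height_of (place \<tau> h \<rho>) = h"
    proof -
    have "1 - \<tau> / (\<tau> + h) = h / (\<tau> + h)" using assms by (simp add: field_simps)
    then show ?thesis using assms by (simp add: height_of_def s infinite_pt_def)
  qed
  show "coord_of (place \<tau> h \<rho>) e = val \<rho> e" if "val \<rho> e \<ge> 0"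
  proof -
    have "1 + \<tau> * val \<rho> e > 0" using assms that by (simp add: add_pos_nonneg)
    then show ?thesis using assms that by (simp add: coord_of_def s finite_pt_def one)
  qed
qed

text \<open>
  Two conditions place an auxiliary point on two different lines and so determine its coordinates; a third one then
  forces the marked result on the axis to be the sum or the product.  Hence the values of the variables
  determine the values of all expressions, and with them the whole configuration.
\<close>

lemma realizes_imp_place:
  assumes "realizes P"
  defines "\<tau> \<equiv> scale_of P" and "h \<equiv> height_of P" and "\<rho> \<equiv> (\<lambda>i. coord_of P (Var i))"
  shows "0 < P (Axis One) $ 1" "P (Axis One) $ 1 < 1" "0 < P InfD $ 1" "P InfD $ 1 < 1"
    "\<tau> > 0" "h > 0" "\<And>e. e \<in> S \<Longrightarrow> P (Axis e) $ 1 < 1"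
    "\<And>i. i < 2 * n \<Longrightarrow> \<rho> i > 1" "\<And>e f. (e, f) \<in> L \<Longrightarrow> val \<rho> e < val \<rho> f"
    "\<And>a. a \<in> points S \<Longrightarrow> P a = place \<tau> h \<rho> a"
proof -
  have Org: "P Org = 0" and InfX: "P InfX = axis 1 1" and InfY: "P InfY = axis 2 1"
    and btw: "\<And>a b c. (a, b, c) \<in> betweenness S L \<Longrightarrow> P b \<in> open_segment (P a) (P c)"
    using assms(1) by (auto simp: realizes_def)
  have "P (Axis One) \<in> open_segment (P Org) (P InfX)" "P InfD \<in> open_segment (P InfX) (P InfY)"
    by (rule btw[OF betweenness.unit], rule btw[OF betweenness.infinite])
  then obtain t e where t: "0 < t" "t < 1" "P (Axis One) = t *\<^sub>R axis 1 1"
    and e: "0 < e" "e < 1" "P InfD = (1 - e) *\<^sub>R axis 1 1 + e *\<^sub>R axis 2 1"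
    by (auto simp: in_segment Org InfX InfY)
  have t1: "P (Axis One) $ 1 = t" "P (Axis One) $ 2 = 0" and e1: "P InfD $ 1 = 1 - e" "P InfD $ 2 = e"
    by (simp_all add: t(3) e(3) axis_def)
  show "0 < P (Axis One) $ 1" "P (Axis One) $ 1 < 1" "0 < P InfD $ 1" "P InfD $ 1 < 1"
    using t(1,2) e(1,2) by (simp_all add: t1 e1)
  have \<tau>_eq: "\<tau> = t / (1 - t)" and h_eq: "h = \<tau> * e / (1 - e)"
    by (simp_all add: \<tau>_def h_def scale_of_def height_of_def t1 e1)
  show \<tau>: "\<tau> > 0" using t by (simp add: \<tau>_eq)
  show h: "h > 0" using e \<tau> by (simp add: h_eq)
  have InfX': "P InfX = infinite_pt \<tau> h 1 0" and InfY': "P InfY = infinite_pt \<tau> h 0 1"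
    using \<tau> h by (simp_all add: InfX InfY infinite_pt_axes)
  have th: "\<tau> + h = \<tau> / (1 - e)" using e by (simp add: h_eq field_simps)
  have InfD': "P InfD = infinite_pt \<tau> h 1 1"
    using \<tau> e by (simp add: vec_eq_iff forall_2 e1 infinite_pt_def th) (simp add: h_eq)
  have Org': "P Org = finite_pt \<tau> h 0 0" by (simp add: Org finite_pt_zero)
  have seg: "\<exists>\<beta>>0. P b = finite_pt \<tau> h (u + \<beta> * x) (v + \<beta> * y)"
    if "(a, b, c) \<in> betweenness S L" "P a = finite_pt \<tau> h u v" "P c = infinite_pt \<tau> h x y"
      "u \<ge> 0" "v \<ge> 0" "\<tau> * x + h * y > 0" for a b c u v x y
    using open_segment_finite_infinite[OF \<tau> h that(4,5,6)] btw[OF that(1)] that(2,3) by simp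
  have inj: "u = u' \<and> v = v'"
    if "finite_pt \<tau> h u v = finite_pt \<tau> h u' v'" "u \<ge> 0" "v \<ge> 0" "u' \<ge> 0" "v' \<ge> 0" for u v u' v'
    using finite_pt_inject[OF \<tau> h that(2-5,1)] .
  define x where "x = coord_of P"
  have coord: "x e = u" "P (Axis e) $ 1 < 1" if "P (Axis e) = finite_pt \<tau> h u 0" "u \<ge> 0" for e u
  proof -
    have pos: "1 + \<tau> * u > 0" using \<tau> that by (simp add: add_pos_nonneg)
    then have "1 - \<tau> * u / (1 + \<tau> * u) = 1 / (1 + \<tau> * u)" by (simp add: field_simps)
    then show "x e = u"
      using \<tau> pos by (simp add: x_def coord_of_def \<tau>_def[symmetric] that finite_pt_def)
    show "P (Axis e) $ 1 < 1" using pos by (simp add: that finite_pt_def)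
  qed
  have AxisOne: "P (Axis One) = finite_pt \<tau> h 1 0"
  proof -
    have "1 + \<tau> = 1 / (1 - t)" using t by (simp add: \<tau>_eq field_simps)
    then show ?thesis using t by (simp add: vec_eq_iff forall_2 t1 finite_pt_def \<tau>_eq)
  qed
  have Axis: "P (Axis e) = finite_pt \<tau> h (x e) 0 \<and> x e \<ge> 1 \<and> (e \<noteq> One \<longrightarrow> x e > 1) \<and> P (Axis e) $ 1 < 1"
    if "e \<in> S" for e
  proof (cases "e = One")
    case True
    then show ?thesis using AxisOne coord[OF AxisOne] by simp
  next
    case False
    have "\<exists>\<beta>>0. P (Axis e) = finite_pt \<tau> h (1 + \<beta> * 1) (0 + \<beta> * 0)"
      by (rule seg[OF betweenness.beyond_unit[OF that False] AxisOne InfX']) (use that False \<tau> in auto)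
    then obtain \<beta> where "\<beta> > 0" "P (Axis e) = finite_pt \<tau> h (1 + \<beta>) 0" by auto
    then show ?thesis using coord[of e "1 + \<beta>"] by simp
  qed
  show "P (Axis e) $ 1 < 1" if "e \<in> S" for e using Axis[OF that] by blast
  have xOne: "x One = 1" using coord[OF AxisOne] by simp
  have Diag: "P (Diag e) = finite_pt \<tau> h (x e) (x e)" if S: "e \<in> S" for e
  proof -
    have "\<exists>\<beta>>0. P (Diag e) = finite_pt \<tau> h (x e + \<beta> * 0) (0 + \<beta> * 1)"
      by (rule seg[OF betweenness.vertical_diag[OF S] _ InfY']) (use S Axis[OF S] h in auto)
    then obtain \<beta> where \<beta>: "\<beta> > 0" "P (Diag e) = finite_pt \<tau> h (x e) \<beta>" by auto
    have "\<exists>\<beta>>0. P (Diag e) = finite_pt \<tau> h (0 + \<beta> * 1) (0 + \<beta> * 1)"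
      by (rule seg[OF betweenness.diagonal[OF S] Org' InfD']) (use S \<tau> h in auto)
    then obtain \<gamma> where \<gamma>: "\<gamma> > 0" "P (Diag e) = finite_pt \<tau> h \<gamma> \<gamma>" by auto
    have "x e = \<gamma> \<and> \<beta> = \<gamma>"
      by (rule inj) (use \<beta> \<gamma> Axis[OF S] in auto)
    then show ?thesis using \<gamma> by simp
  qed
  have Row: "P (Row e) = finite_pt \<tau> h (x e) 1" if S: "e \<in> S" "e \<noteq> One" for e
  proof -
    have "\<exists>\<beta>>0. P (Row e) = finite_pt \<tau> h (x e + \<beta> * 0) (0 + \<beta> * 1)"
      by (rule seg[OF betweenness.vertical_row[OF S] _ InfY']) (use S Axis[OF S(1)] h in auto)
    then obtain \<beta> where \<beta>: "\<beta> > 0" "P (Row e) = finite_pt \<tau> h (x e) \<beta>" by auto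
    have "\<exists>\<beta>>0. P (Row e) = finite_pt \<tau> h (1 + \<beta> * 1) (1 + \<beta> * 0)"
      by (rule seg[OF betweenness.horizontal_row[OF S] _ InfX']) (use S \<tau> Diag[OF One_S] xOne in auto)
    then obtain \<gamma> where \<gamma>: "\<gamma> > 0" "P (Row e) = finite_pt \<tau> h (1 + \<gamma>) 1" by auto
    have "x e = 1 + \<gamma> \<and> \<beta> = 1"
      by (rule inj) (use \<beta> \<gamma> Axis[OF S(1)] in auto)
    then show ?thesis using \<beta> by simp
  qed
  have Sum: "P (SumPt e f) = finite_pt \<tau> h (x e + x f) (x f) \<and> x (Add e f) = x e + x f" if S: "Add e f \<in> S" for e f
  proof -
    have ef: "e \<in> S" "f \<in> S" using Add_S[OF S] by blast+
    have "\<exists>\<beta>>0. P (SumPt e f) = finite_pt \<tau> h (x e + \<beta> * 1) (0 + \<beta> * 1)"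
      by (rule seg[OF betweenness.sum_parallel[OF S] _ InfD']) (use S Axis[OF ef(1)] \<tau> h in auto)
    then obtain \<beta> where \<beta>: "\<beta> > 0" "P (SumPt e f) = finite_pt \<tau> h (x e + \<beta>) \<beta>" by auto
    have "\<exists>\<beta>>0. P (SumPt e f) = finite_pt \<tau> h (x f + \<beta> * 1) (x f + \<beta> * 0)"
      by (rule seg[OF betweenness.sum_horizontal[OF S] _ InfX']) (use S Axis[OF ef(2)] Diag[OF ef(2)] \<tau> in auto)
    then obtain \<gamma> where \<gamma>: "\<gamma> > 0" "P (SumPt e f) = finite_pt \<tau> h (x f + \<gamma>) (x f)" by auto
    have "\<exists>\<beta>>0. P (SumPt e f) = finite_pt \<tau> h (x (Add e f) + \<beta> * 0) (0 + \<beta> * 1)"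
      by (rule seg[OF betweenness.sum_vertical[OF S] _ InfY']) (use S Axis[OF S] h in auto)
    then obtain \<delta> where \<delta>: "\<delta> > 0" "P (SumPt e f) = finite_pt \<tau> h (x (Add e f)) \<delta>" by auto
    have "x e + \<beta> = x f + \<gamma> \<and> \<beta> = x f"
      by (rule inj) (use \<beta> \<gamma> Axis[OF ef(1)] Axis[OF ef(2)] in auto)
    moreover have "x e + \<beta> = x (Add e f) \<and> \<beta> = \<delta>"
      by (rule inj) (use \<beta> \<delta> Axis[OF ef(1)] Axis[OF S] in auto)
    ultimately show ?thesis using \<beta> by auto
  qed
  have Prod: "P (ProdPt e f) = finite_pt \<tau> h (x e * x f) (x e) \<and> x (Mul e f) = x e * x f" if S: "Mul e f \<in> S" for e f
  proof -
    have ef: "e \<in> S" "f \<in> S" "f \<noteq> One" using Mul_S[OF S] by auto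
    have "\<exists>\<beta>>0. P (ProdPt e f) = finite_pt \<tau> h (x e + \<beta> * 1) (x e + \<beta> * 0)"
      by (rule seg[OF betweenness.prod_horizontal[OF S] _ InfX']) (use S Axis[OF ef(1)] Diag[OF ef(1)] \<tau> in auto)
    then obtain \<gamma> where \<gamma>: "\<gamma> > 0" "P (ProdPt e f) = finite_pt \<tau> h (x e + \<gamma>) (x e)" by auto
    have "\<exists>\<beta>>0. P (ProdPt e f) = finite_pt \<tau> h (x (Mul e f) + \<beta> * 0) (0 + \<beta> * 1)"
      by (rule seg[OF betweenness.prod_vertical[OF S] _ InfY']) (use S Axis[OF S] h in auto)
    then obtain \<delta> where \<delta>: "\<delta> > 0" "P (ProdPt e f) = finite_pt \<tau> h (x (Mul e f)) \<delta>" by auto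
    have "x e + \<gamma> = x (Mul e f) \<and> x e = \<delta>"
      by (rule inj) (use \<gamma> \<delta> Axis[OF ef(1)] Axis[OF S] in auto)
    then have P: "P (ProdPt e f) = finite_pt \<tau> h (x (Mul e f)) (x e)" using \<delta> by simp
    have "P (Row f) \<in> open_segment (P Org) (P (ProdPt e f))"
      by (rule btw[OF betweenness.prod_ray[OF S]])
    then have "finite_pt \<tau> h (x f) 1 \<in> open_segment 0 (finite_pt \<tau> h (x (Mul e f)) (x e))"
      by (simp add: Org P Row ef)
    then have "x (Mul e f) = x f * x e"
      using open_segment_from_origin[OF \<tau> h, of "x f" "x (Mul e f)" "x e"] Axis[OF ef(1)] Axis[OF ef(2)] Axis[OF S]
      by simp
    then show ?thesis using P by (simp add: mult.commute)
  qed
  have x: "x e = val \<rho> e" if "e \<in> S" for e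
    using that
  proof (induction e)
    case (Add e f)
    then show ?case using Sum[of e f] Add_S[of e f] by simp
  next
    case (Mul e f)
    then show ?case using Prod[of e f] Mul_S[of e f] by simp
  next
    case One
    then show ?case by (simp add: xOne)
  qed (simp add: \<rho>_def x_def)
  show "\<rho> i > 1" if "i < 2 * n" for i
    using Axis[OF Var_S[OF that]] by (simp add: \<rho>_def x_def)
  show "val \<rho> e < val \<rho> f" if L: "(e, f) \<in> L" for e f
  proof -
    have ef: "e \<in> S" "f \<in> S" using L L_S by auto
    have "\<exists>\<beta>>0. P (Axis f) = finite_pt \<tau> h (x e + \<beta> * 1) (0 + \<beta> * 0)"
      by (rule seg[OF betweenness.less[OF L] _ InfX']) (use L Axis[OF ef(1)] \<tau> in auto)
    then obtain \<beta> where \<beta>: "\<beta> > 0" "P (Axis f) = finite_pt \<tau> h (x e + \<beta>) 0" by auto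
    have "x f = x e + \<beta> \<and> (0::real) = 0"
      by (rule inj) (use \<beta> Axis[OF ef(1)] Axis[OF ef(2)] in auto)
    then show ?thesis using \<beta> x ef by simp
  qed
  show "P a = place \<tau> h \<rho> a" if "a \<in> points S" for a
  proof (cases a)
    case (SumPt e f)
    then have "Add e f \<in> S" using that by (simp add: points_iff)
    then show ?thesis using SumPt Sum[of e f] Add_S[of e f] x by simp
  next
    case (ProdPt e f)
    then have "Mul e f \<in> S" using that by (simp add: points_iff)
    then show ?thesis using ProdPt Prod[of e f] Mul_S[of e f] x by simp
  qed (use that Org' InfX' InfY' InfD' Axis Diag Row x in \<open>simp_all add: points_iff\<close>)
qed

end

section \<open>From a system of expressions to a stratum\<close>

lemma rat_poly_fun_val:
  assumes "vars e \<subseteq> {..<2 * n}" "2 * n \<le> k"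
  shows "rat_poly_fun k (\<lambda>\<omega>. val (split_env n \<omega>) e)"
  using assms(1)
proof (induction e)
  case One
  then show ?case by (simp add: rat_poly_fun_const)
next
  case (Var i)
  show ?case
  proof (cases "i < n")
    case True
    then have "rat_poly_fun k (\<lambda>\<omega>. \<omega> i + \<omega> (n + i))"
      using assms(2) by (intro rat_poly_fun_add rat_poly_fun_var) auto
    then show ?thesis using True by (simp add: split_env_def)
  next
    case False
    then show ?thesis using Var assms(2) by (simp add: split_env_def rat_poly_fun_var)
  qed
qed (auto intro: rat_poly_fun_add rat_poly_fun_mult)

lemma rat_fun_on_finite_pt:
  assumes "rat_poly_fun k t" "rat_poly_fun k h" "rat_poly_fun k u" "rat_poly_fun k v"
    and "\<And>\<omega>. \<omega> \<in> X \<Longrightarrow> t \<omega> > 0 \<and> h \<omega> > 0 \<and> u \<omega> \<ge> 0 \<and> v \<omega> \<ge> 0"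
  shows "rat_fun_on k X (\<lambda>\<omega>. finite_pt (t \<omega>) (h \<omega>) (u \<omega>) (v \<omega>) $ c)"
proof -
  have one: "rat_poly_fun k (\<lambda>\<omega>. 1)" by (simp add: rat_poly_fun_const)
  have "1 + t \<omega> * u \<omega> + h \<omega> * v \<omega> \<noteq> 0" if "\<omega> \<in> X" for \<omega>
  proof -
    have "t \<omega> * u \<omega> \<ge> 0" "h \<omega> * v \<omega> \<ge> 0" using assms(5)[OF that] by simp_all
    then show ?thesis by linarith
  qed
  then have "rat_fun_on k X (\<lambda>\<omega>. t \<omega> * u \<omega> / (1 + t \<omega> * u \<omega> + h \<omega> * v \<omega>))"
    "rat_fun_on k X (\<lambda>\<omega>. h \<omega> * v \<omega> / (1 + t \<omega> * u \<omega> + h \<omega> * v \<omega>))"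
    by (intro rat_fun_on_divide rat_fun_on_poly rat_poly_fun_add rat_poly_fun_mult one assms(1-4); simp)+
  then show ?thesis
    using exhaust_2[of c] by (auto simp: finite_pt_def)
qed

lemma rat_fun_on_infinite_pt:
  assumes "rat_poly_fun k t" "rat_poly_fun k h" "a \<in> \<rat>" "b \<in> \<rat>"
    and "\<And>\<omega>. \<omega> \<in> X \<Longrightarrow> t \<omega> * a + h \<omega> * b \<noteq> 0"
  shows "rat_fun_on k X (\<lambda>\<omega>. infinite_pt (t \<omega>) (h \<omega>) a b $ c)"
proof -
  have "rat_fun_on k X (\<lambda>\<omega>. t \<omega> * a / (t \<omega> * a + h \<omega> * b))"
    "rat_fun_on k X (\<lambda>\<omega>. h \<omega> * b / (t \<omega> * a + h \<omega> * b))"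
    by (intro rat_fun_on_divide rat_fun_on_poly rat_poly_fun_add rat_poly_fun_mult rat_poly_fun_const
        assms(1-4); use assms(5) in simp)+
  then show ?thesis
    using exhaust_2[of c] by (auto simp: infinite_pt_def)
qed

context expr_system
begin

text \<open>
  The choice of the numberings of points and triples is arbitrary.
\<close>

definition idx :: "pt \<Rightarrow> nat" where
  "idx = (SOME f. bij_betw f (points S) {..<card (points S)})"

definition triples :: "(pt \<times> pt \<times> pt) list" where
  "triples = (SOME l. set l = betweenness S L)"

definition gadget_point :: "nat \<Rightarrow> nat \<Rightarrow> pt" where
  "gadget_point g r = (case (if g = 0 then (Org, InfX, InfY) else triples ! (g - 1)) of
     (a, b, c) \<Rightarrow> if r = 0 then a else if r = 1 then b else c)"

definition gadget :: "nat \<Rightarrow> nat \<Rightarrow> nat" where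
  "gadget g r = idx (gadget_point g r)"

lemma bij_idx: "bij_betw idx (points S) {..<card (points S)}"
proof -
  have "\<exists>f. bij_betw f (points S) {..<card (points S)}"
    using ex_bij_betw_finite_nat[OF finite_points] by (simp add: atLeast0LessThan)
  then show ?thesis unfolding idx_def by (rule someI_ex)
qed

lemma set_triples: "set triples = betweenness S L"
  unfolding triples_def using finite_list[OF finite_betweenness] by (rule someI_ex)

lemma idx_less: "a \<in> points S \<Longrightarrow> idx a < card (points S)"
  using bij_idx by (auto dest: bij_betwE)

lemma gadget_point_in_points:
  assumes "g \<le> length triples" shows "gadget_point g r \<in> points S"
proof -
  obtain a b c where abc: "(if g = 0 then (Org, InfX, InfY) else triples ! (g - 1)) = (a, b, c)"
    by (rule prod_cases3)
  have "(a, b, c) \<in> points S \<times> points S \<times> points S"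
  proof (cases "g = 0")
    case True
    then show ?thesis using abc by (auto simp: points_iff)
  next
    case False
    then have "(a, b, c) \<in> set triples" using abc assms by (auto simp: in_set_conv_nth intro!: exI[of _ "g - 1"])
    then show ?thesis using set_triples betweenness_points by blast
  qed
  then show ?thesis unfolding gadget_point_def abc by simp
qed

sublocale link: triangle_linkage "card (points S)" "length triples" gadget
  by unfold_locales (simp add: gadget_def idx_less gadget_point_in_points)

lemma gadget_conditions:
  "link.normal_form q \<and> (\<forall>g. 1 \<le> g \<and> g \<le> length triples \<longrightarrow>
      q (gadget g 1) \<in> open_segment (q (gadget g 0)) (q (gadget g 2))) \<longleftrightarrow> realizes (\<lambda>a. q (idx a))"
proof -
  have "(\<forall>g. 1 \<le> g \<and> g \<le> length triples \<longrightarrow>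
      q (gadget g 1) \<in> open_segment (q (gadget g 0)) (q (gadget g 2))) \<longleftrightarrow>
    (\<forall>i<length triples. case triples ! i of (a, b, c) \<Rightarrow> q (idx b) \<in> open_segment (q (idx a)) (q (idx c)))"
    (is "?l \<longleftrightarrow> ?r")
  proof
    assume l: ?l
    show ?r
    proof (intro allI impI)
      fix i assume "i < length triples"
      then show "case triples ! i of (a, b, c) \<Rightarrow> q (idx b) \<in> open_segment (q (idx a)) (q (idx c))"
        using l[rule_format, of "Suc i"] by (auto simp: gadget_def gadget_point_def split: prod.splits)
    qed
  next
    assume r: ?r
    show ?l
    proof (intro allI impI)
      fix g assume "1 \<le> g \<and> g \<le> length triples"
      then show "q (gadget g 1) \<in> open_segment (q (gadget g 0)) (q (gadget g 2))"
        using r[rule_format, of "g - 1"] by (auto simp: gadget_def gadget_point_def split: prod.splits)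
    qed
  qed
  also have "\<dots> \<longleftrightarrow> (\<forall>(a, b, c)\<in>betweenness S L. q (idx b) \<in> open_segment (q (idx a)) (q (idx c)))"
    unfolding set_triples[symmetric] by (simp add: all_set_conv_all_nth)
  finally show ?thesis
    by (simp add: link.normal_form_def realizes_def gadget_def gadget_point_def)
qed

definition params :: "(nat \<Rightarrow> real) set" where
  "params = {\<omega> \<in> Rn (2 * n + 2). (\<forall>i<2 * n. split_env n \<omega> i > 1) \<and> \<omega> (2 * n) > 0 \<and> \<omega> (2 * n + 1) > 0 \<and>
     (\<forall>(e, f)\<in>L. val (split_env n \<omega>) e < val (split_env n \<omega>) f)}"

definition point_of :: "nat \<Rightarrow> pt" where
  "point_of v = inv_into (points S) idx (link.base v)"

definition draw :: "(nat \<Rightarrow> real) \<Rightarrow> realization" where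
  "draw \<omega> = (\<lambda>v\<in>{..<link.num_vertices}. place (\<omega> (2 * n)) (\<omega> (2 * n + 1)) (split_env n \<omega>) (point_of v))"

definition read_off :: "(nat \<Rightarrow> real) \<Rightarrow> (nat \<Rightarrow> real)" where
  "read_off z = (let P = (\<lambda>a. point_at z (idx a)) in (\<lambda>i.
     if i < n then coord_of P (Var i) - coord_of P (Var (n + i)) else if i < 2 * n then coord_of P (Var i)
     else if i = 2 * n then scale_of P else if i = 2 * n + 1 then height_of P else 0))"

lemma point_of_idx: "a \<in> points S \<Longrightarrow> point_of (idx a) = a"
  using bij_idx idx_less[of a] by (simp add: point_of_def link.base_def bij_betw_def)

lemma point_of_in_points: "v < link.num_vertices \<Longrightarrow> point_of v \<in> points S"
  unfolding point_of_def using bij_idx link.base_less[of v]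
  by (intro inv_into_into) (simp add: bij_betw_def)

lemma idx_point_of: "v < link.num_vertices \<Longrightarrow> idx (point_of v) = link.base v"
  unfolding point_of_def using bij_idx link.base_less[of v]
  by (intro f_inv_into_f) (simp add: bij_betw_def)

lemma idx_less_num_vertices: "a \<in> points S \<Longrightarrow> idx a < link.num_vertices"
  using idx_less[of a] by (simp add: link.num_vertices_def)

lemma normal_coords_iff:
  "z \<in> coords link.num_vertices ` link.normal_configs \<longleftrightarrow> z \<in> Rn (2 * link.num_vertices) \<and>
     (\<forall>v<link.num_vertices. point_at z v = point_at z (link.base v)) \<and> realizes (\<lambda>a. point_at z (idx a))"
  unfolding link.coords_normal_configs using gadget_conditions[of "point_at z"] by simp

lemma params_gt_1: "\<omega> \<in> params \<Longrightarrow> i < 2 * n \<Longrightarrow> split_env n \<omega> i > 1"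
  by (simp add: params_def)

lemma params_val_ge_1:
  assumes "\<omega> \<in> params" "e \<in> S" shows "val (split_env n \<omega>) e \<ge> 1"
  using val_ge_1[OF wf_S[OF assms(2)], of "split_env n \<omega>"] params_gt_1[OF assms(1)] vars_S[OF assms(2)] by blast

lemma realizes_cong:
  assumes "\<And>a. a \<in> points S \<Longrightarrow> P a = P' a" shows "realizes P \<longleftrightarrow> realizes P'"
proof -
  have "(\<forall>(a, b, c)\<in>betweenness S L. P b \<in> open_segment (P a) (P c)) \<longleftrightarrow>
    (\<forall>(a, b, c)\<in>betweenness S L. P' b \<in> open_segment (P' a) (P' c))"
    using betweenness_points assms by (intro ball_cong refl) fastforce
  moreover have "P a = P' a" if "a \<in> {Org, InfX, InfY}" for a
    using assms[of a] that by (auto simp: points_iff)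
  ultimately show ?thesis by (simp add: realizes_def)
qed

lemma readout_cong:
  assumes "\<And>a. a \<in> points S \<Longrightarrow> P a = P' a"
  shows "scale_of P = scale_of P'" "height_of P = height_of P'" "e \<in> S \<Longrightarrow> coord_of P e = coord_of P' e"
proof -
  have "P (Axis One) = P' (Axis One)" "P InfD = P' InfD" "e \<in> S \<Longrightarrow> P (Axis e) = P' (Axis e)"
    by (rule assms, simp add: points_iff One_S)+
  then show "scale_of P = scale_of P'" "height_of P = height_of P'" "e \<in> S \<Longrightarrow> coord_of P e = coord_of P' e"
    by (simp_all add: scale_of_def height_of_def coord_of_def)
qed

text \<open>
  One half of the bijection between parameters and normalized configurations.
\<close>

lemma coords_draw:
  assumes \<omega>: "\<omega> \<in> params"
  shows "coords link.num_vertices (draw \<omega>) \<in> coords link.num_vertices ` link.normal_configs \<and> read_off (coords link.num_vertices (draw \<omega>)) = \<omega>"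
proof
  let ?z = "coords link.num_vertices (draw \<omega>)" and ?t = "\<omega> (2 * n)" and ?h = "\<omega> (2 * n + 1)"
  let ?P = "\<lambda>a. point_at ?z (idx a)" and ?P' = "place ?t ?h (split_env n \<omega>)"
  have pos: "?t > 0" "?h > 0" using \<omega> by (simp_all add: params_def)
  have pt: "point_at ?z v = ?P' (point_of v)" if "v < link.num_vertices" for v
    using that by (simp add: point_at_coords draw_def)
  have P: "?P a = ?P' a" if "a \<in> points S" for a
    using pt[OF idx_less_num_vertices[OF that]] point_of_idx[OF that] by simp
  have "realizes ?P'"
    using \<omega> by (intro realizes_place pos) (auto simp: params_def)
  then have "realizes ?P"
    using realizes_cong[of ?P ?P'] P by blast
  moreover have "point_at ?z v = point_at ?z (link.base v)" if "v < link.num_vertices" for v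
    using P[OF point_of_in_points[OF that]] pt[OF that] by (simp add: idx_point_of[OF that])
  moreover have "?z \<in> Rn (2 * link.num_vertices)" by (simp add: Rn_iff coords_def)
  ultimately show "?z \<in> coords link.num_vertices ` link.normal_configs"
    unfolding normal_coords_iff by blast
  have r: "scale_of ?P = ?t" "height_of ?P = ?h"
    using readout_cong(1,2)[of ?P ?P'] P readout_place[OF pos] by simp_all
  have c: "coord_of ?P (Var i) = split_env n \<omega> i" if "i < 2 * n" for i
    using readout_cong(3)[of ?P ?P' "Var i"] P Var_S[OF that] readout_place(3)[OF pos, of "split_env n \<omega>" "Var i"]
      params_gt_1[OF \<omega> that] by simp
  show "read_off ?z = \<omega>"
  proof
    fix i
    consider "i < n" | "n \<le> i" "i < 2 * n" | "i = 2 * n" | "i = 2 * n + 1" | "i \<ge> 2 * n + 2" by linarith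
    then show "read_off ?z i = \<omega> i"
    proof cases
      case 5
      then have "\<omega> i = 0" using \<omega> by (simp add: params_def Rn_iff)
      then show ?thesis using 5 by (simp add: read_off_def Let_def)
    qed (simp_all add: read_off_def Let_def c r, simp_all add: split_env_def)
  qed
qed

text \<open>
  The other half: a normalized configuration is redrawn from the parameters read off from it.
\<close>

lemma draw_read_off:
  assumes z: "z \<in> coords link.num_vertices ` link.normal_configs"
  shows "read_off z \<in> params \<and> coords link.num_vertices (draw (read_off z)) = z"
proof
  let ?P = "\<lambda>a. point_at z (idx a)"
  let ?\<rho> = "\<lambda>i. coord_of ?P (Var i)" and ?t = "scale_of ?P" and ?h = "height_of ?P"
  have zR: "z \<in> Rn (2 * link.num_vertices)" and linked: "\<And>v. v < link.num_vertices \<Longrightarrow> point_at z v = point_at z (link.base v)"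
    and real: "realizes ?P"
    using z unfolding normal_coords_iff by blast+
  note rp = realizes_imp_place[OF real]
  have env: "split_env n (read_off z) i = ?\<rho> i" if "i < 2 * n" for i
    using that by (simp add: split_env_def read_off_def Let_def)
  have val: "val (split_env n (read_off z)) e = val ?\<rho> e" if "e \<in> S" for e
    using vars_S[OF that] env by (intro val_cong) auto
  have th: "read_off z (2 * n) = ?t" "read_off z (2 * n + 1) = ?h"
    by (simp_all add: read_off_def Let_def)
  have "read_off z \<in> Rn (2 * n + 2)" by (simp add: Rn_iff read_off_def Let_def)
  moreover have "val (split_env n (read_off z)) e < val (split_env n (read_off z)) f" if "(e, f) \<in> L" for e f
    using rp(9)[OF that] val L_S that by auto
  ultimately show "read_off z \<in> params"
    using rp(5,6,8) by (auto simp: params_def env th simp del: One_nat_def add_Suc_right)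
  have "place ?t ?h (split_env n (read_off z)) a = place ?t ?h ?\<rho> a" if "a \<in> points S" for a
  proof (cases a)
    case (SumPt e f)
    then show ?thesis using that Add_S[of e f] by (simp add: points_iff val)
  next
    case (ProdPt e f)
    then show ?thesis using that Mul_S[of e f] by (simp add: points_iff val)
  qed (use that in \<open>simp_all add: points_iff val\<close>)
  then have "point_at z v = draw (read_off z) v" if "v < link.num_vertices" for v
    using linked[OF that] idx_point_of[OF that] rp(10)[OF point_of_in_points[OF that]] that
      point_of_in_points[OF that] by (simp add: draw_def th del: One_nat_def add_Suc_right)
  then have "draw (read_off z) = (\<lambda>v\<in>{..<link.num_vertices}. point_at z v)"
    by (auto simp: draw_def fun_eq_iff)
  then show "coords link.num_vertices (draw (read_off z)) = z"
    using coords_point_at[OF zR] by simp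
qed

lemma rat_fun_on_place:
  assumes "a \<in> points S"
  shows "rat_fun_on (2 * n + 2) params (\<lambda>\<omega>. place (\<omega> (2 * n)) (\<omega> (2 * n + 1)) (split_env n \<omega>) a $ c)"
proof -
  let ?k = "2 * n + 2"
  have th: "rat_poly_fun ?k (\<lambda>\<omega>. \<omega> (2 * n))" "rat_poly_fun ?k (\<lambda>\<omega>. \<omega> (2 * n + 1))"
    by (simp_all add: rat_poly_fun_var)
  have pos: "\<omega> (2 * n) > 0" "\<omega> (2 * n + 1) > 0" "\<omega> (Suc (2 * n)) > 0" if "\<omega> \<in> params" for \<omega>
    using that by (simp_all add: params_def)
  have val: "rat_poly_fun ?k (\<lambda>\<omega>. val (split_env n \<omega>) e)" if "e \<in> S" for e
    using rat_poly_fun_val[OF vars_S[OF that]] by simp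
  have c: "rat_poly_fun ?k (\<lambda>\<omega>. 0)" "rat_poly_fun ?k (\<lambda>\<omega>. 1)"
    by (simp_all add: rat_poly_fun_const)
  have ge: "val (split_env n \<omega>) e \<ge> 0" if "\<omega> \<in> params" "e \<in> S" for \<omega> e
    by (rule order_trans[OF zero_le_one params_val_ge_1[OF that]])
  note fin = rat_fun_on_finite_pt[OF th] and inf = rat_fun_on_infinite_pt[OF th]
  show ?thesis
  proof (cases a)
    case (SumPt e f)
    then have ef: "e \<in> S" "f \<in> S" using assms Add_S[of e f] by (simp_all add: points_iff)
    show ?thesis
      unfolding SumPt place.simps
      by (rule fin[OF rat_poly_fun_add[OF val val] val]; simp add: ef pos ge)
  next
    case (ProdPt e f)
    then have ef: "e \<in> S" "f \<in> S" using assms Mul_S[of e f] by (simp_all add: points_iff)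
    show ?thesis
      unfolding ProdPt place.simps
      by (rule fin[OF rat_poly_fun_mult[OF val val] val]; simp add: ef pos ge)
  next
    case (Axis e)
    then have e: "e \<in> S" using assms by (simp add: points_iff)
    show ?thesis unfolding Axis place.simps by (rule fin[OF val c(1)]; simp add: e pos ge)
  next
    case (Diag e)
    then have e: "e \<in> S" using assms by (simp add: points_iff)
    show ?thesis unfolding Diag place.simps by (rule fin[OF val val]; simp add: e pos ge)
  next
    case (Row e)
    then have e: "e \<in> S" using assms by (simp add: points_iff)
    show ?thesis unfolding Row place.simps by (rule fin[OF val c(2)]; simp add: e pos ge)
  next
    case Org
    show ?thesis unfolding Org place.simps by (rule fin[OF c(1) c(1)]) (simp add: pos)
  next
    case InfX
    show ?thesis unfolding InfX place.simps by (rule inf) (auto dest: pos)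
  next
    case InfY
    show ?thesis unfolding InfY place.simps by (rule inf) (auto dest: pos)
  next
    case InfD
    have "\<omega> (2 * n) * 1 + \<omega> (2 * n + 1) * 1 \<noteq> 0" if "\<omega> \<in> params" for \<omega>
      using pos[OF that] by linarith
    then show ?thesis unfolding InfD place.simps by (intro inf) simp_all
  qed
qed

lemma normal_configs_draw: "link.normal_configs = draw ` params"
proof -
  have inj: "p = q" if "p \<in> link.normal_configs" "q \<in> topspace (realizations link.num_vertices)"
    "coords link.num_vertices p = coords link.num_vertices q" for p q
  proof -
    have "p \<in> topspace (realizations link.num_vertices)"
      using that(1) by (simp add: link.normal_configs_def link.configs_def)
    moreover have "p v = q v" if "v < link.num_vertices" for v
      using \<open>coords link.num_vertices p = coords link.num_vertices q\<close> point_at_coords[OF that] by metis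
    ultimately show ?thesis
      using that(2) unfolding topspace_realizations by (intro PiE_ext) auto
  qed
  have top: "draw \<omega> \<in> topspace (realizations link.num_vertices)" for \<omega>
    by (auto simp: draw_def topspace_realizations)
  show ?thesis
  proof (intro equalityI subsetI)
    fix p assume p: "p \<in> link.normal_configs"
    then show "p \<in> draw ` params"
      using draw_read_off[of "coords link.num_vertices p"] inj[OF p top] by (metis imageI)
  next
    fix p assume "p \<in> draw ` params"
    then obtain \<omega> where \<omega>: "\<omega> \<in> params" "p = draw \<omega>" by blast
    obtain q where "q \<in> link.normal_configs" "coords link.num_vertices (draw \<omega>) = coords link.num_vertices q"
      using coords_draw[OF \<omega>(1)] by blast
    then show "p \<in> link.normal_configs" using inj[of q "draw \<omega>"] top \<omega>(2) by metis
  qed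
qed

lemma continuous_map_draw: "continuous_map (top_of_set params) (realizations link.num_vertices) draw"
proof -
  have "continuous_on params (\<lambda>\<omega>. place (\<omega> (2 * n)) (\<omega> (2 * n + 1)) (split_env n \<omega>) a)" if "a \<in> points S" for a
  proof -
    have "continuous_on params (\<lambda>\<omega>. \<chi> c. place (\<omega> (2 * n)) (\<omega> (2 * n + 1)) (split_env n \<omega>) a $ c)"
      by (intro continuous_on_vec_lambda rat_fun_on_continuous[OF rat_fun_on_place[OF that]])
    then show ?thesis by simp
  qed
  then have "continuous_on params (\<lambda>\<omega>. draw \<omega> v)" if "v < link.num_vertices" for v
    using that point_of_in_points[OF that] by (simp add: draw_def)
  then show ?thesis
    unfolding realizations_def continuous_map_componentwise
    by (simp add: draw_def image_subset_iff)
qed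

lemma rationally_equivalent_params:
  "rationally_equivalent (2 * link.num_vertices, coords link.num_vertices ` link.normal_configs) (2 * n + 2, params)"
proof (rule rationally_equivalentI[where f = read_off and g = "\<lambda>\<omega>. coords link.num_vertices (draw \<omega>)"])
  let ?Z = "coords link.num_vertices ` link.normal_configs" and ?m = "2 * link.num_vertices"
  show "?Z \<subseteq> Rn ?m" using normal_coords_iff by blast
  show "params \<subseteq> Rn (2 * n + 2)" by (auto simp: params_def)
  show "read_off z \<in> params \<and> coords link.num_vertices (draw (read_off z)) = z" if "z \<in> ?Z" for z
    using draw_read_off[OF that] .
  show "coords link.num_vertices (draw \<omega>) \<in> ?Z \<and> read_off (coords link.num_vertices (draw \<omega>)) = \<omega>" if "\<omega> \<in> params" for \<omega>
    using coords_draw[OF that] .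
  let ?P = "\<lambda>z a. point_at z (idx a)"
  have x: "rat_fun_on ?m ?Z (\<lambda>z. ?P z a $ 1)" if "a \<in> points S" for a
    using idx_less_num_vertices[OF that] by (auto simp: point_at_def intro!: rat_fun_on_poly rat_poly_fun_var)
  have pts: "Axis One \<in> points S" "InfD \<in> points S" and Ax: "\<And>e. e \<in> S \<Longrightarrow> Axis e \<in> points S"
    by (simp_all add: points_iff One_S)
  have one: "rat_fun_on ?m ?Z (\<lambda>z. 1)" by (simp add: rat_fun_on_poly rat_poly_fun_const)
  have real: "realizes (?P z)" if "z \<in> ?Z" for z
    using that unfolding normal_coords_iff by blast
  have scale: "rat_fun_on ?m ?Z (\<lambda>z. scale_of (?P z))"
    unfolding scale_of_def
    by (intro rat_fun_on_divide rat_fun_on_diff one x pts) (use realizes_imp_place(2)[OF real] in force)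
  have height: "rat_fun_on ?m ?Z (\<lambda>z. height_of (?P z))"
    unfolding height_of_def
    by (intro rat_fun_on_divide rat_fun_on_mult rat_fun_on_diff one x pts scale)
      (use realizes_imp_place(3)[OF real] in force)
  have coord: "rat_fun_on ?m ?Z (\<lambda>z. coord_of (?P z) e)" if e: "e \<in> S" for e
    unfolding coord_of_def
  proof (intro rat_fun_on_divide rat_fun_on_mult rat_fun_on_diff one x Ax[OF e] scale)
    fix z assume "z \<in> ?Z"
    from realizes_imp_place(5)[OF real[OF this]] realizes_imp_place(7)[OF real[OF this] e]
    show "scale_of (?P z) * (1 - ?P z (Axis e) $ 1) \<noteq> 0" by simp
  qed
  show "rat_fun_on ?m ?Z (\<lambda>z. read_off z i)" if i: "i < 2 * n + 2" for i
  proof -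
    consider "i < n" | "n \<le> i" "i < 2 * n" | "i = 2 * n" | "i = 2 * n + 1" using i by linarith
    then show ?thesis
    proof cases
      case 1
      then show ?thesis by (simp add: read_off_def Let_def rat_fun_on_diff coord Var_S)
    next
      case 2
      then show ?thesis by (simp add: read_off_def Let_def coord Var_S)
    qed (simp_all add: read_off_def Let_def scale height)
  qed
  show "rat_fun_on (2 * n + 2) params (\<lambda>\<omega>. coords link.num_vertices (draw \<omega>) l)" if "l < ?m" for l
  proof -
    have l: "l div 2 < link.num_vertices" using that by simp
    show ?thesis
      using that l rat_fun_on_place[OF point_of_in_points[OF l]] by (simp add: coords_def draw_def)
  qed
qed

lemma semialgebraic_params: "semialgebraic (2 * n + 2) params"
proof -
  let ?k = "2 * n + 2"
  let ?J = "(\<lambda>i \<omega>. split_env n \<omega> i - 1) ` {..<2 * n} \<union> {\<lambda>\<omega>. \<omega> (2 * n), \<lambda>\<omega>. \<omega> (2 * n + 1)} \<union>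
    (\<lambda>(e, f) \<omega>. val (split_env n \<omega>) f - val (split_env n \<omega>) e) ` L"
  have "finite L" using L_S finite_S by (meson finite_SigmaI finite_subset)
  then have fin: "finite ?J" by simp
  have params: "params = {\<omega> \<in> Rn ?k. (\<forall>i\<in>({} :: unit set). 0 = 0) \<and> (\<forall>f\<in>?J. f \<omega> > 0)}"
    by (auto simp: params_def ball_Un)
  have one: "rat_poly_fun ?k (\<lambda>\<omega>. 1)" by (simp add: rat_poly_fun_const)
  have env: "rat_poly_fun ?k (\<lambda>\<omega>. split_env n \<omega> i)" if "i < 2 * n" for i
    using rat_poly_fun_val[of "Var i" n ?k] that by simp
  have "rat_poly_fun ?k f" if "f \<in> ?J" for f
    using that
  proof (elim UnE)
    assume "f \<in> (\<lambda>i \<omega>. split_env n \<omega> i - 1) ` {..<2 * n}"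
    then obtain i where "i < 2 * n" "f = (\<lambda>\<omega>. split_env n \<omega> i - 1)" by auto
    then show ?thesis using rat_poly_fun_diff[OF env one] by simp
  next
    assume "f \<in> {\<lambda>\<omega>. \<omega> (2 * n), \<lambda>\<omega>. \<omega> (2 * n + 1)}"
    then show ?thesis by (auto intro!: rat_poly_fun_var)
  next
    assume "f \<in> (\<lambda>(e, f) \<omega>. val (split_env n \<omega>) f - val (split_env n \<omega>) e) ` L"
    then obtain e e' where ef: "(e, e') \<in> L" "f = (\<lambda>\<omega>. val (split_env n \<omega>) e' - val (split_env n \<omega>) e)"
      by auto
    then have "e \<in> S" "e' \<in> S" using L_S by auto
    then show ?thesis unfolding ef(2) by (intro rat_poly_fun_diff rat_poly_fun_val vars_S) simp_all
  qed
  then show ?thesis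
    by (intro basic_semialgebraic[OF _ fin _ _ params]) auto
qed

text \<open>
  The parameters describe the normalized configurations continuously, so their connectedness makes the class a
  stratum, and they describe them rationally in both directions, which is the first step of the
  stable equivalence.
\<close>

lemma stratum_of_system:
  assumes "params \<noteq> {}" "connected params"
  shows "\<exists>m E. simple_graph m E \<and> (\<exists>R\<in>strata m E. \<exists>i j k. affine_frame m R i j k \<and>
           stable_step (2 * m, normalized m R i j k) (2 * n + 2, params))"
proof -
  have "link.normal_configs \<noteq> {}" using assms(1) by (simp add: normal_configs_draw)
  moreover have "connectedin (realizations link.num_vertices) link.normal_configs"
    unfolding normal_configs_draw
    by (rule connectedin_continuous_map_image[OF continuous_map_draw])
      (simp add: connectedin_subtopology assms(2))
  ultimately have "affine_class link.num_vertices ` link.configs \<in> strata link.num_vertices link.edges"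
    by (rule link.stratum_configs)
  moreover have "stable_step (2 * link.num_vertices, normalized link.num_vertices (affine_class link.num_vertices ` link.configs)
      (gadget 0 0) (gadget 0 1) (gadget 0 2)) (2 * n + 2, params)"
    unfolding link.normalized_configs stable_step_def
    using link.semialgebraic_normal_configs semialgebraic_params rationally_equivalent_params by simp
  ultimately show ?thesis
    using link.simple_graph_edges link.affine_frame_configs by blast
qed

end

section \<open>Projection to the semialgebraic set\<close>

text \<open>
  All conditions that define the fibres of the final projection have this shape: a single fibre coordinate is
  bounded below by a polynomial in the base coordinates.
\<close>

lemma affine_val_shift:
  assumes "rat_poly_fun a f" "k < d"
  obtains c where "\<forall>j\<le>d. c j \<in> polys \<rat> a" "\<And>z. affine_val a d c z = f (proj a z) + z (a + k)"
proof -
  obtain p where p: "p \<in> polys \<rat> a" "\<And>x. eval_poly p x = f x"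
    using assms(1) unfolding rat_poly_fun_def by blast
  have "rat_poly_fun a (\<lambda>x. 1)" by (simp add: rat_poly_fun_const)
  then obtain q where q: "q \<in> polys \<rat> a" "\<And>x. eval_poly q x = 1"
    unfolding rat_poly_fun_def by blast
  define c where "c j = (if j = 0 then p else if j = Suc k then q else 0)" for j
  have "\<forall>j\<le>d. c j \<in> polys \<rat> a"
    using p(1) q(1) by (auto simp: c_def polys_def)
  moreover have "affine_val a d c z = f (proj a z) + z (a + k)" for z
  proof -
    have zero: "eval_poly 0 x = 0" for x by (simp add: eval_poly_def)
    have "(\<Sum>j<d. eval_poly (c (Suc j)) (proj a z) * z (a + j)) =
        (\<Sum>j<d. if j = k then z (a + j) else 0)"
      by (rule sum.cong) (auto simp: c_def q(2) zero)
    then show ?thesis using assms(2) by (simp add: affine_val_def c_def p(2))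
  qed
  ultimately show thesis using that by blast
qed

lemma connected_UNIV_sequences: "connected (UNIV :: (nat \<Rightarrow> real) set)"
proof -
  have "connected_space (product_topology (\<lambda>i::nat. euclidean :: real topology) UNIV)"
    unfolding connected_space_product_topology using connected_UNIV[where 'a = real]
    by (simp flip: connectedin_topspace)
  then show ?thesis
    unfolding euclidean_product_topology by (simp flip: connectedin_topspace)
qed

theorem theorem2:
  fixes n :: nat and A :: "(nat \<Rightarrow> real) set"
  assumes "open_basic_primary n A" and "A \<noteq> {}" and "connected A"
  shows "\<exists>m E. simple_graph m E \<and>
           (\<exists>R\<in>strata m E. \<exists>i j k. affine_frame m R i j k \<and>
              stably_equivalent (2 * m, normalized m R i j k) (n, A))"
proof -
  obtain Q where Q: "finite Q" "Q \<subseteq> polys \<rat> n" and A: "A = {x \<in> Rn n. \<forall>q\<in>Q. eval_poly q x > 0}"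
    using assms(1) unfolding open_basic_primary_def by blast
  \<comment> \<open>The three expressions for \<open>q\<close>, as a triple, to choose them all at once.\<close>
  have "\<forall>q\<in>Q. \<exists>t. admissible n (fst t) \<and> admissible n (fst (snd t)) \<and> admissible n (snd (snd t)) \<and>
     (\<forall>\<omega>. val (split_env n \<omega>) (fst t) * eval_poly q \<omega> =
          val (split_env n \<omega>) (fst (snd t)) - val (split_env n \<omega>) (snd (snd t)))"
  proof
    fix q assume "q \<in> Q"
    then have "expressible n (eval_poly q)" using Q(2) expressible_poly by blast
    then show "\<exists>t. admissible n (fst t) \<and> admissible n (fst (snd t)) \<and> admissible n (snd (snd t)) \<and>
     (\<forall>\<omega>. val (split_env n \<omega>) (fst t) * eval_poly q \<omega> =
          val (split_env n \<omega>) (fst (snd t)) - val (split_env n \<omega>) (snd (snd t)))"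
      unfolding expressible_def by (metis fst_conv snd_conv)
  qed
  then obtain t where t: "\<forall>q\<in>Q. admissible n (fst (t q)) \<and> admissible n (fst (snd (t q))) \<and> admissible n (snd (snd (t q))) \<and>
     (\<forall>\<omega>. val (split_env n \<omega>) (fst (t q)) * eval_poly q \<omega> =
          val (split_env n \<omega>) (fst (snd (t q))) - val (split_env n \<omega>) (snd (snd (t q))))"
    by (rule bchoice[THEN exE])
  define D where "D q = fst (t q)" for q
  define P where "P q = fst (snd (t q))" for q
  define M where "M q = snd (snd (t q))" for q
  have arith: "admissible n (D q)" "admissible n (P q)" "admissible n (M q)"
    and split: "val (split_env n \<omega>) (D q) * eval_poly q \<omega> = val (split_env n \<omega>) (P q) - val (split_env n \<omega>) (M q)"
    if "q \<in> Q" for q \<omega>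
    using t that by (simp_all add: D_def P_def M_def)
  define T where "T = {One} \<union> Var ` {..<2 * n} \<union> P ` Q \<union> M ` Q"
  define S where "S = \<Union> (subexprs ` T)"
  define L where "L = (\<lambda>q. (M q, P q)) ` Q"
  have T: "wf_expr e \<and> vars e \<subseteq> {..<2 * n}" if e: "e \<in> T" for e
  proof -
    consider "e = One" | i where "i < 2 * n" "e = Var i" | q where "q \<in> Q" "e = P q \<or> e = M q"
      using e by (auto simp: T_def)
    then show ?thesis
    proof cases
      case 3
      then show ?thesis using arith(2,3)[OF 3(1)] by (auto simp: admissible_def)
    qed simp_all
  qed
  have TS: "T \<subseteq> S" using subexprs_self by (auto simp: S_def)
  interpret expr_system n S L
  proof
    show "finite S" using Q(1) by (simp add: S_def T_def finite_subexprs)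
    show "One \<in> S" "\<And>i. i < 2 * n \<Longrightarrow> Var i \<in> S" using TS by (auto simp: T_def)
    show "e \<in> S \<and> f \<in> S" if ef: "Add e f \<in> S \<or> Mul e f \<in> S" for e f
    proof -
      obtain g where g: "g \<in> T" "Add e f \<in> subexprs g \<or> Mul e f \<in> subexprs g"
        using ef unfolding S_def by blast
      then show ?thesis using subexprs_closed[OF g(2)] unfolding S_def by blast
    qed
    show "wf_expr e" "vars e \<subseteq> {..<2 * n}" if "e \<in> S" for e
      using that T subexprs_wf unfolding S_def by blast+
    have "P q \<in> S" "M q \<in> S" if "q \<in> Q" for q using TS that by (auto simp: T_def)
    then show "L \<subseteq> S \<times> S" unfolding L_def by blast
  qed
  have eval_proj: "eval_poly q (proj n \<omega>) = eval_poly q \<omega>" if "q \<in> Q" for q \<omega>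
    by (rule eval_poly_cong[of q \<rat> n]) (use Q(2) that in \<open>auto simp: proj_def\<close>)
  \<comment> \<open>The factors \<open>D q\<close> are positive, so they can be cancelled from the inequalities.\<close>
  have L_iff: "(\<forall>(e, f)\<in>L. val (split_env n \<omega>) e < val (split_env n \<omega>) f) \<longleftrightarrow> (\<forall>q\<in>Q. eval_poly q \<omega> > 0)"
    if env: "\<forall>i<2 * n. split_env n \<omega> i > 1" for \<omega>
  proof -
    have "val (split_env n \<omega>) (M q) < val (split_env n \<omega>) (P q) \<longleftrightarrow> eval_poly q \<omega> > 0" if q: "q \<in> Q" for q
    proof -
      have "val (split_env n \<omega>) (D q) \<ge> 1"
        using val_ge_1[of "D q" "split_env n \<omega>"] arith(1)[OF q] env by (auto simp: admissible_def)
      then have "eval_poly q \<omega> > 0 \<longleftrightarrow> val (split_env n \<omega>) (D q) * eval_poly q \<omega> > 0"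
        by (simp add: zero_less_mult_iff)
      then show ?thesis using split[OF q, of \<omega>] by auto
    qed
    then show ?thesis by (simp add: L_def)
  qed
  have env_iff: "(\<forall>i<2 * n. split_env n \<omega> i > 1) \<longleftrightarrow> (\<forall>i<n. \<omega> (n + i) > 1 \<and> \<omega> i + \<omega> (n + i) > 1)" for \<omega>
  proof
    assume *: "\<forall>i<2 * n. split_env n \<omega> i > 1"
    show "\<forall>i<n. \<omega> (n + i) > 1 \<and> \<omega> i + \<omega> (n + i) > 1"
    proof (intro allI impI)
      fix i assume "i < n"
      then show "\<omega> (n + i) > 1 \<and> \<omega> i + \<omega> (n + i) > 1"
        using *[rule_format, of i] *[rule_format, of "n + i"] by (simp add: split_env_def)
    qed
  next
    assume *: "\<forall>i<n. \<omega> (n + i) > 1 \<and> \<omega> i + \<omega> (n + i) > 1"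
    show "\<forall>i<2 * n. split_env n \<omega> i > 1"
    proof (intro allI impI)
      fix i assume "i < 2 * n"
      then show "split_env n \<omega> i > 1"
        using *[rule_format, of i] *[rule_format, of "i - n"] by (auto simp: split_env_def)
    qed
  qed
  have proj_Rn: "proj n \<omega> \<in> Rn n" for \<omega> by (simp add: proj_def Rn_iff)
  have params_iff: "\<omega> \<in> params \<longleftrightarrow> \<omega> \<in> Rn (2 * n + 2) \<and> proj n \<omega> \<in> A \<and>
      (\<forall>i<n. \<omega> (n + i) > 1 \<and> \<omega> i + \<omega> (n + i) > 1) \<and> \<omega> (2 * n) > 0 \<and> \<omega> (2 * n + 1) > 0" for \<omega>
  proof -
    have "proj n \<omega> \<in> A \<longleftrightarrow> (\<forall>q\<in>Q. eval_poly q \<omega> > 0)"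
      using eval_proj proj_Rn by (simp add: A)
    then show ?thesis
      unfolding params_def env_iff[symmetric] using L_iff[of \<omega>] by blast
  qed
  \<comment> \<open>A parametrization of the tuples by \<open>A \<times> UNIV\<close>: the exponential turns the fibre over \<open>x\<close> into a space of
    sequences, and the maximum is the lower bound that \<open>x\<close> imposes on a coordinate of \<open>z\<close>.\<close>
  define lift where "lift x s = (\<lambda>i. if i < n then x i else if i < 2 * n then max 1 (1 - x (i - n)) + exp (s i)
      else if i < 2 * n + 2 then exp (s i) else 0 :: real)" for x s :: "nat \<Rightarrow> real"
  have proj_lift: "proj n (lift x s) = x" if "x \<in> Rn n" for x s
    using that by (auto simp: proj_def lift_def Rn_iff fun_eq_iff)
  have lift_params: "lift x s \<in> params" if x: "x \<in> A" for x s
  proof -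
    have "x \<in> Rn n" using x by (simp add: A)
    moreover have "max 1 (1 - x i) + exp (s (n + i)) > 1" "x i + (max 1 (1 - x i) + exp (s (n + i))) > 1" for i
      using exp_gt_zero[of "s (n + i)"] max.cobounded1[of 1 "1 - x i"] max.cobounded2[of "1 - x i" 1]
      by linarith+
    ultimately show ?thesis
      unfolding params_iff using x proj_lift[of x s] by (auto simp: lift_def Rn_iff)
  qed
  have "params = (\<lambda>(x, s). lift x s) ` (A \<times> UNIV)"
  proof (intro equalityI subsetI)
    fix \<omega> assume \<omega>: "\<omega> \<in> params"
    define s where "s i = ln (if i < 2 * n then \<omega> i - max 1 (1 - \<omega> (i - n)) else \<omega> i)" for i
    have "lift (proj n \<omega>) s = \<omega>"
    proof
      fix i
      consider "i < n" | "n \<le> i" "i < 2 * n" | "i = 2 * n \<or> i = 2 * n + 1" | "i \<ge> 2 * n + 2" by linarith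
      then show "lift (proj n \<omega>) s i = \<omega> i"
      proof cases
        case 2
        then have "\<omega> (n + (i - n)) > 1 \<and> \<omega> (i - n) + \<omega> (n + (i - n)) > 1"
          using \<omega> unfolding params_iff by (metis less_diff_conv2 mult_2)
        then have "\<omega> i - max 1 (1 - \<omega> (i - n)) > 0" using 2 by (auto simp: max_def)
        moreover have "i - n < n" using 2 by linarith
        ultimately show ?thesis using 2 by (simp add: lift_def s_def proj_def)
      next
        case 3
        then have "\<omega> i > 0" using \<omega> unfolding params_iff by auto
        then show ?thesis using 3 by (auto simp: lift_def s_def)
      next
        case 4
        then have "\<omega> i = 0" using \<omega> unfolding params_iff by (simp add: Rn_iff)
        then show ?thesis using 4 by (simp add: lift_def)
      qed (simp add: lift_def proj_def)
    qed
    moreover have "proj n \<omega> \<in> A" using \<omega> unfolding params_iff by blast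
    ultimately show "\<omega> \<in> (\<lambda>(x, s). lift x s) ` (A \<times> UNIV)"
      by (intro image_eqI[of _ _ "(proj n \<omega>, s)"]) simp_all
  qed (use lift_params in auto)
  moreover have "continuous_on (A \<times> UNIV) (\<lambda>(x, s). lift x s)"
  proof (rule continuous_on_coordinatewise_then_product)
    fix i
    have fst_i: "continuous_on (A \<times> UNIV) (\<lambda>z :: (nat \<Rightarrow> real) \<times> (nat \<Rightarrow> real). fst z j)" for j
      by (intro continuous_on_compose2[OF continuous_on_product_coordinates continuous_on_fst[OF continuous_on_id]]) auto
    have snd_i: "continuous_on (A \<times> UNIV) (\<lambda>z :: (nat \<Rightarrow> real) \<times> (nat \<Rightarrow> real). snd z j)" for j
      by (intro continuous_on_compose2[OF continuous_on_product_coordinates continuous_on_snd[OF continuous_on_id]]) auto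
    show "continuous_on (A \<times> UNIV) (\<lambda>z. (case z of (x, s) \<Rightarrow> lift x s) i)"
      unfolding lift_def case_prod_beta
      by (cases "i < n"; cases "i < 2 * n"; cases "i < 2 * n + 2")
         (simp_all add: fst_i snd_i continuous_intros)
  qed
  ultimately have conn: "connected params"
    using connected_continuous_image connected_Times[OF assms(3) connected_UNIV_sequences] by metis
  have nonempty: "params \<noteq> {}" using assms(2) lift_params by blast
  obtain m E R i j k where graph: "simple_graph m E" "R \<in> strata m E" "affine_frame m R i j k"
    and step: "stable_step (2 * m, normalized m R i j k) (2 * n + 2, params)"
    using stratum_of_system[OF nonempty conn] by blast
  have semA: "semialgebraic n A"
  proof (rule basic_semialgebraic[where I = "{} :: unit set" and f = "\<lambda>_ _. 0" and J = Q and g = eval_poly])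
    show "rat_poly_fun n (eval_poly q)" if "q \<in> Q" for q
      using that Q(2) by (intro rat_poly_fun_eval) auto
  qed (use Q(1) A rat_poly_fun_const in auto)
  \<comment> \<open>The conditions \<open>z i > 1\<close>, \<open>x i + z i > 1\<close> and positivity of the two scales, as affine functions on the fibre.\<close>
  have one: "rat_poly_fun n (\<lambda>x. - 1)" "rat_poly_fun n (\<lambda>x. 0)" by (simp_all add: rat_poly_fun_const)
  have "\<exists>c. (\<forall>j\<le>n + 2. c j \<in> polys \<rat> n) \<and> (\<forall>z. affine_val n (n + 2) c z = f (proj n z) + z (n + i))"
    if "rat_poly_fun n f" "i < n + 2" for f i
    using affine_val_shift[OF that] by metis
  note shift = this
  have "\<forall>i<n. \<exists>c. (\<forall>j\<le>n + 2. c j \<in> polys \<rat> n) \<and> (\<forall>z. affine_val n (n + 2) c z = - 1 + z (n + i))"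
    using shift[OF one(1)] by simp
  then obtain cz where cz: "\<And>i. i < n \<Longrightarrow> \<forall>j\<le>n + 2. cz i j \<in> polys \<rat> n"
    "\<And>i z. i < n \<Longrightarrow> affine_val n (n + 2) (cz i) z = - 1 + z (n + i)" by metis
  have "\<forall>i<n. \<exists>c. (\<forall>j\<le>n + 2. c j \<in> polys \<rat> n) \<and> (\<forall>z. affine_val n (n + 2) c z = (z i - 1) + z (n + i))"
  proof (intro allI impI)
    fix i assume i: "i < n"
    have "rat_poly_fun n (\<lambda>x. x i - 1)"
      by (intro rat_poly_fun_diff rat_poly_fun_var rat_poly_fun_const i) simp
    from shift[OF this, of i]
    show "\<exists>c. (\<forall>j\<le>n + 2. c j \<in> polys \<rat> n) \<and> (\<forall>z. affine_val n (n + 2) c z = (z i - 1) + z (n + i))"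
      using i by (simp add: proj_def)
  qed
  then obtain cx where cx: "\<And>i. i < n \<Longrightarrow> \<forall>j\<le>n + 2. cx i j \<in> polys \<rat> n"
    "\<And>i z. i < n \<Longrightarrow> affine_val n (n + 2) (cx i) z = (z i - 1) + z (n + i)" by metis
  obtain ct where ct: "\<forall>j\<le>n + 2. ct j \<in> polys \<rat> n" "\<And>z. affine_val n (n + 2) ct z = z (2 * n)"
    using shift[OF one(2), of n] by (auto simp: mult_2)
  obtain ch where ch: "\<forall>j\<le>n + 2. ch j \<in> polys \<rat> n" "\<And>z. affine_val n (n + 2) ch z = z (2 * n + 1)"
    using shift[OF one(2), of "n + 1"] by (auto simp: mult_2)
  have "stable_projection (n, A) (2 * n + 2, params)"
    unfolding stable_projection_def prod.case
  proof (intro exI conjI)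
    show "2 * n + 2 = n + (n + 2)" by simp
    have "x \<in> proj n ` params" if "x \<in> A" for x
      using proj_lift[of x "\<lambda>_. 0"] lift_params[OF that, of "\<lambda>_. 0"] that by (metis (no_types, lifting) A imageI mem_Collect_eq)
    then show "proj n ` params = A" unfolding params_iff[abs_def] by (auto simp: params_iff)
    let ?K = "cz ` {..<n} \<union> cx ` {..<n} \<union> {ct, ch}"
    show "finite ?K" "finite {}" by simp_all
    show "\<forall>c\<in>?K \<union> {}. \<forall>j\<le>n + 2. c j \<in> polys \<rat> n"
      using cz(1) cx(1) ct(1) ch(1) by blast
    have K: "(\<forall>c\<in>?K. affine_val n (n + 2) c z > 0) \<longleftrightarrow>
        (\<forall>i<n. z (n + i) > 1 \<and> z i + z (n + i) > 1) \<and> z (2 * n) > 0 \<and> z (2 * n + 1) > 0" for z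
    proof -
      have "0 < affine_val n (n + 2) (cz i) z \<longleftrightarrow> z (n + i) > 1"
        "0 < affine_val n (n + 2) (cx i) z \<longleftrightarrow> z i + z (n + i) > 1" if "i < n" for i
        unfolding cz(2)[OF that] cx(2)[OF that] by linarith+
      then show ?thesis unfolding ball_Un ball_simps ct(2) ch(2) by blast
    qed
    show "params = {z \<in> Rn (n + (n + 2)). proj n z \<in> A \<and>
        (\<forall>c\<in>?K. affine_val n (n + 2) c z > 0) \<and> (\<forall>c\<in>{}. affine_val n (n + 2) c z = 0)}"
      unfolding K using params_iff by (auto simp: mult_2)
  qed
  then have "stable_step (n, A) (2 * n + 2, params)"
    using semA semialgebraic_params by (simp add: stable_step_def)
  then have "equivclp stable_step (2 * m, normalized m R i j k) (n, A)"
    using step by (meson equivclp_sym equivclp_trans r_into_equivclp)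
  then have "stably_equivalent (2 * m, normalized m R i j k) (n, A)"
    using step semA by (simp add: stably_equivalent_def stable_step_def)
  then show ?thesis using graph by blast
qed

end
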